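(* Let $(M^1;\Omega_1^1,S^1)$ and $(M^2;\Omega_1^2,S^2)$ be two admissible triplets, with associated noises $(N^i;\mathbb{P}^i,T^i):=(N^{M^i};\mathbb{P}^{M^i},T^{M^i})$, $i\in\{1,2\}$. The following are equivalent. (A) Neither $M^1\triangle M^2$ nor $M^1\triangle M^2(-B)$ is ($\mathsf{W}$-a.s.) empty. (B) The noises $(N^1;\mathbb{P}^1,T^1)$ and $(N^2;\mathbb{P}^2,T^2)$ are not isomorphic.
   Context: Wiener setting. $\Omega_0:=\{\omega:\mathbb{R}\to\mathbb{R}\text{ continuous},\ \omega(0)=0\}$, canonical process $B$ (the identity on $\Omega_0$), $\mathsf{W}$ the completed two-sided Wiener measure with domain $\mathcal{G}$; for extended-real $s<t$, $\mathcal{F}_{s,t}$ is generated by the increments of $B$ between $s$ and $t$ and all events of $\mathsf{W}$-probability $0$ or $1$; $\Delta_u(\omega)(t):=\omega(u+t)-\omega(u)$. $\mathbb{R}^\dagger:=\mathbb{R}\cup\{\dagger\}$, $\dagger\notin\mathbb{R}$; for a sequence $s$ in $\mathbb{R}^\dagger$, $[s]:=\{s_i:i\in\mathbb{N}\}\setminus\{\dagger\}$. For $\mathcal{A}\subset\mathcal{G}$, an $\mathcal{A}$-measurable enumeration of $M:\Omega_0\to2^{\mathbb{R}}$ is a sequence $S$ of $\mathcal{A}$-measurable $\mathbb{R}^\dagger$-valued random variables with $M=[S]$ $\mathsf{W}$-a.s. ("measurable" means $\mathcal{A}=\mathcal{G}$). $M$ is a random countable set if it has a measurable enumeration; it is dense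 (empty) if $\mathsf{W}$-a.s. dense in $\mathbb{R}$ (empty); local if each $M\cap(s,t)$, $s<t$ extended-real, has an $\mathcal{F}_{s,t}$-measurable enumeration; perfectly stationary if $M(\omega)=u+M(\Delta_u\omega)$ for all $u\in\mathbb{R}$, $\omega\in\Omega_0$. $M(-B)$ is the random set $\omega\mapsto M(-\omega)$. Admissible triplet $(M;\Omega_1,S)$: $M$ is a dense perfectly stationary local random countable set with $M(\omega)$ countable for every $\omega$; $\Omega_1\subset\Omega_0$ satisfies $\mathsf{W}(\Omega_1)=1$, $\Delta_v^{-1}(\Omega_1)=\Omega_1$ for all $v\in\mathbb{R}$, and $M(\omega)$ is dense for $\omega\in\Omega_1$; $S$ is a measurable enumeration of $M$ which on $\Omega_1$ is injective, $\mathbb{R}^{\mathbb{N}}$-valued and satisfies $M=[S]$. Noise of the triplet. $\mathbb{W}:=\mathsf{W}$ restricted to $\Omega_1$; $\Omega^M:=\{(\omega_1,\eta):\omega_1\in\Omega_1,\eta\in\{-1,1\}^{M(\omega_1)}\}$; $\Theta^M:\Omega^M\to\Omega_1\times\{-1,1\}^{\mathbb{N}}$ is the bijection $\Theta^M(\omega_1,\eta):=(\omega_1,(\eta(S_k(\omega_1)))_{k\in\mathbb{N}})$; $\mathbb{P}^M$ (with domain $\mathcal{B}^M$) is the completion of the pull-back along $\Theta^M$ of $\mathbb{W}\times(\frac12\delta_{-1}+\frac12\delta_1)^{\times\mathbb{N}}$. $W$ is the first coordinate projection on $\Omega_1\times\{-1,1\}^{\mathbb{N}}$, so $W\circ\Theta^M(\omega_1,\eta)=\omega_1$.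 For extended-real $s<t$, $N^M_{s,t}$ is the $\mathbb{P}^M$-complete $\sigma$-field generated by the increments of $W\circ\Theta^M$ on $(s,t)$ and by the random variables $(\omega_1,\eta)\mapsto\eta(S_{s,t}(k)(\omega_1))$, $k\in\mathbb{N}$, where $S_{s,t}$ is an $\mathcal{F}_{s,t}$-measurable enumeration of $M\cap(s,t)$ that on $\Omega_1$ is injective, $(s,t)^{\mathbb{N}}$-valued and satisfies $M\cap(s,t)=[S_{s,t}]$ ($N^M_{s,t}$ does not depend on its choice). $T^M_h(\omega_1,\eta):=(\Delta_h(\omega_1),\eta(\cdot+h))$, $h\in\mathbb{R}$. The system $(N^M;\mathbb{P}^M,T^M)$ is the noise associated to $M$. An isomorphism of two noises $(N^1;\mathbb{P}^1,T^1)$ and $(N^2;\mathbb{P}^2,T^2)$ is a mod-$0$ isomorphism $\psi$ between the probabilities $\mathbb{P}^1$ and $\mathbb{P}^2$ (a bimeasurable measure-preserving bijection after removal of null sets) which sends $N^1_{s,t}$ onto $N^2_{s,t}$ for all extended-real $s<t$ and satisfies $\psi\circ T^1_h=T^2_h\circ\psi$ $\mathbb{P}^1$-a.s. for all $h\in\mathbb{R}$. *)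

theory Defs
  imports "HOL-Probability.Probability"
begin

section \<open>The Wiener setting\<close>

definition \<Omega>\<^sub>0 :: "(real \<Rightarrow> real) set" where
  "\<Omega>\<^sub>0 = {\<omega>. continuous_on UNIV \<omega> \<and> \<omega> 0 = 0}"

text \<open>
  The two-sided Wiener measure is the unique probability on \<open>\<Omega>\<^sub>0\<close> with the
  \<open>\<sigma>\<close>-field of the coordinate maps that satisfies this predicate. It is not constructed here:
  results are stated for a \<open>W\<close> with \<open>completed_wiener W\<close>.
\<close>
definition two_sided_wiener :: "(real \<Rightarrow> real) measure \<Rightarrow> bool" where
  "two_sided_wiener P \<longleftrightarrow>
     prob_space P \<and>
     sets P = sets (restrict_space (\<Pi>\<^sub>M t\<in>UNIV. borel) \<Omega>\<^sub>0) \<and>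
     (\<forall>u v. u < v \<longrightarrow>
        distributed P lborel (\<lambda>\<omega>. \<omega> v - \<omega> u) (normal_density 0 (sqrt (v - u)))) \<and>
     (\<forall>(n::nat) (t :: nat \<Rightarrow> real). (\<forall>i<n. t i < t (Suc i)) \<longrightarrow>
        prob_space.indep_vars P (\<lambda>_. borel) (\<lambda>i \<omega>. \<omega> (t (Suc i)) - \<omega> (t i)) {..<n})"

definition completed_wiener :: "(real \<Rightarrow> real) measure \<Rightarrow> bool" where
  "completed_wiener W \<longleftrightarrow> (\<exists>P. two_sided_wiener P \<and> W = completion P)"

definition \<Delta> :: "real \<Rightarrow> (real \<Rightarrow> real) \<Rightarrow> real \<Rightarrow> real" where
  "\<Delta> u \<omega> = (\<lambda>t. \<omega> (u + t) - \<omega> u)"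

definition \<F> :: "(real \<Rightarrow> real) measure \<Rightarrow> ereal \<Rightarrow> ereal \<Rightarrow> (real \<Rightarrow> real) measure" where
  "\<F> W s t = sigma \<Omega>\<^sub>0
     ({{\<omega> \<in> \<Omega>\<^sub>0. \<omega> v - \<omega> u \<in> A} | u v A.
         s \<le> ereal u \<and> u \<le> v \<and> ereal v \<le> t \<and> A \<in> sets borel} \<union>
      {A \<in> sets W. measure W A = 0 \<or> measure W A = 1})"

section \<open>Random countable sets\<close>

text \<open>
  \<open>\<real> \<union> {\<dagger>}\<close> is rendered as \<^typ>\<open>real option\<close> with \<^const>\<open>None\<close> for \<open>\<dagger>\<close>; its
  \<open>\<sigma>\<close>-field is the Borel one, \<open>\<dagger>\<close> being an isolated point.
\<close>
definition borel_dagger :: "real option measure" where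
  "borel_dagger = sigma UNIV (insert {None} {Some ` A | A. A \<in> sets borel})"

definition real_values :: "(nat \<Rightarrow> real option) \<Rightarrow> real set" where
  "real_values s = {x. \<exists>i. s i = Some x}"

type_synonym random_set = "(real \<Rightarrow> real) \<Rightarrow> real set"
type_synonym enumeration = "nat \<Rightarrow> (real \<Rightarrow> real) \<Rightarrow> real option"

text \<open>\<open>A\<close> carries the sub-\<open>\<sigma>\<close>-field only; almost sure statements always refer to \<open>W\<close>.\<close>
definition measurable_enumeration ::
  "(real \<Rightarrow> real) measure \<Rightarrow> (real \<Rightarrow> real) measure \<Rightarrow> enumeration \<Rightarrow> random_set \<Rightarrow> bool" where
  "measurable_enumeration W A S M \<longleftrightarrow>
     (\<forall>k. S k \<in> A \<rightarrow>\<^sub>M borel_dagger) \<and> (AE \<omega> in W. M \<omega> = real_values (\<lambda>k. S k \<omega>))"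

definition random_countable_set :: "(real \<Rightarrow> real) measure \<Rightarrow> random_set \<Rightarrow> bool" where
  "random_countable_set W M \<longleftrightarrow> (\<exists>S. measurable_enumeration W W S M)"

definition dense_random_set :: "(real \<Rightarrow> real) measure \<Rightarrow> random_set \<Rightarrow> bool" where
  "dense_random_set W M \<longleftrightarrow> (AE \<omega> in W. closure (M \<omega>) = UNIV)"

definition empty_random_set :: "(real \<Rightarrow> real) measure \<Rightarrow> random_set \<Rightarrow> bool" where
  "empty_random_set W M \<longleftrightarrow> (AE \<omega> in W. M \<omega> = {})"

definition ereal_interval :: "ereal \<Rightarrow> ereal \<Rightarrow> real set" where
  "ereal_interval s t = {x. s < ereal x \<and> ereal x < t}"

definition local_random_set :: "(real \<Rightarrow> real) measure \<Rightarrow> random_set \<Rightarrow> bool" where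
  "local_random_set W M \<longleftrightarrow>
     (\<forall>s t. s < t \<longrightarrow>
        (\<exists>S. measurable_enumeration W (\<F> W s t) S (\<lambda>\<omega>. M \<omega> \<inter> ereal_interval s t)))"

definition perfectly_stationary :: "random_set \<Rightarrow> bool" where
  "perfectly_stationary M \<longleftrightarrow> (\<forall>u. \<forall>\<omega>\<in>\<Omega>\<^sub>0. M \<omega> = (\<lambda>x. u + x) ` M (\<Delta> u \<omega>))"

definition reflected :: "random_set \<Rightarrow> random_set" where
  "reflected M = (\<lambda>\<omega>. M (\<lambda>t. - \<omega> t))"

definition admissible_triplet ::
  "(real \<Rightarrow> real) measure \<Rightarrow> random_set \<Rightarrow> (real \<Rightarrow> real) set \<Rightarrow> enumeration \<Rightarrow> bool" where
  "admissible_triplet W M \<Omega>\<^sub>1 S \<longleftrightarrow>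
     random_countable_set W M \<and> dense_random_set W M \<and> perfectly_stationary M \<and>
     local_random_set W M \<and> (\<forall>\<omega>\<in>\<Omega>\<^sub>0. countable (M \<omega>)) \<and>
     \<Omega>\<^sub>1 \<in> sets W \<and> measure W \<Omega>\<^sub>1 = 1 \<and>
     (\<forall>v. {\<omega> \<in> \<Omega>\<^sub>0. \<Delta> v \<omega> \<in> \<Omega>\<^sub>1} = \<Omega>\<^sub>1) \<and>
     (\<forall>\<omega>\<in>\<Omega>\<^sub>1. closure (M \<omega>) = UNIV) \<and>
     measurable_enumeration W W S M \<and>
     (\<forall>\<omega>\<in>\<Omega>\<^sub>1. inj (\<lambda>k. S k \<omega>) \<and> (\<forall>k. S k \<omega> \<noteq> None) \<and> M \<omega> = real_values (\<lambda>k. S k \<omega>))"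

section \<open>The noise of an admissible triplet\<close>

text \<open>
  A map \<open>\<eta>\<close> from \<open>M \<omega>\<close> to \<open>{-1,1}\<close> is a function on \<open>\<real>\<close> which is
  \<^const>\<open>undefined\<close> off \<open>M \<omega>\<close>; this is preserved by the translation in
  \<open>shift_M\<close> because of perfect stationarity.
\<close>
type_synonym sample = "(real \<Rightarrow> real) \<times> (real \<Rightarrow> int)"

definition \<Omega>_M :: "random_set \<Rightarrow> (real \<Rightarrow> real) set \<Rightarrow> sample set" where
  "\<Omega>_M M \<Omega>\<^sub>1 = (SIGMA \<omega>:\<Omega>\<^sub>1. M \<omega> \<rightarrow>\<^sub>E {-1, 1})"

definition \<Theta> :: "enumeration \<Rightarrow> sample \<Rightarrow> (real \<Rightarrow> real) \<times> (nat \<Rightarrow> int)" where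
  "\<Theta> S = (\<lambda>(\<omega>, \<eta>). (\<omega>, \<lambda>k. \<eta> (the (S k \<omega>))))"

definition base_measure ::
  "(real \<Rightarrow> real) measure \<Rightarrow> (real \<Rightarrow> real) set \<Rightarrow> ((real \<Rightarrow> real) \<times> (nat \<Rightarrow> int)) measure" where
  "base_measure W \<Omega>\<^sub>1 =
     restrict_space W \<Omega>\<^sub>1 \<Otimes>\<^sub>M (\<Pi>\<^sub>M k\<in>UNIV. uniform_count_measure {-1, 1})"

text \<open>
  As \<open>\<Theta>\<close> is a bijection of \<open>\<Omega>_M\<close> onto the space of \<open>base_measure\<close>, pulling back along it is
  embedding along its inverse.
\<close>
definition \<P>_M ::
  "(real \<Rightarrow> real) measure \<Rightarrow> random_set \<Rightarrow> (real \<Rightarrow> real) set \<Rightarrow> enumeration \<Rightarrow> sample measure" where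
  "\<P>_M W M \<Omega>\<^sub>1 S =
     completion (embed_measure (base_measure W \<Omega>\<^sub>1) (the_inv_into (\<Omega>_M M \<Omega>\<^sub>1) (\<Theta> S)))"

definition local_enumeration ::
  "(real \<Rightarrow> real) measure \<Rightarrow> random_set \<Rightarrow> (real \<Rightarrow> real) set \<Rightarrow> ereal \<Rightarrow> ereal \<Rightarrow> enumeration \<Rightarrow> bool"
where
  "local_enumeration W M \<Omega>\<^sub>1 s t R \<longleftrightarrow>
     measurable_enumeration W (\<F> W s t) R (\<lambda>\<omega>. M \<omega> \<inter> ereal_interval s t) \<and>
     (\<forall>\<omega>\<in>\<Omega>\<^sub>1. inj (\<lambda>k. R k \<omega>) \<and> (\<forall>k. R k \<omega> \<in> Some ` ereal_interval s t) \<and>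
              M \<omega> \<inter> ereal_interval s t = real_values (\<lambda>k. R k \<omega>))"

text \<open>The generated \<open>\<sigma>\<close>-field does not depend on the local enumeration that is selected.\<close>
definition N_M ::
  "(real \<Rightarrow> real) measure \<Rightarrow> random_set \<Rightarrow> (real \<Rightarrow> real) set \<Rightarrow> enumeration \<Rightarrow>
     ereal \<Rightarrow> ereal \<Rightarrow> sample set set" where
  "N_M W M \<Omega>\<^sub>1 S s t =
     (let R = (SOME R. local_enumeration W M \<Omega>\<^sub>1 s t R) in
      sigma_sets (\<Omega>_M M \<Omega>\<^sub>1)
        ({{(\<omega>, \<eta>) \<in> \<Omega>_M M \<Omega>\<^sub>1. \<omega> v - \<omega> u \<in> A} | u v A.
            s < ereal u \<and> u \<le> v \<and> ereal v < t \<and> A \<in> sets borel} \<union>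
         {{(\<omega>, \<eta>) \<in> \<Omega>_M M \<Omega>\<^sub>1. \<eta> (the (R k \<omega>)) \<in> C} | k C. True} \<union>
         null_sets (\<P>_M W M \<Omega>\<^sub>1 S)))"

definition shift_M :: "real \<Rightarrow> sample \<Rightarrow> sample" where
  "shift_M h = (\<lambda>(\<omega>, \<eta>). (\<Delta> h \<omega>, \<lambda>x. \<eta> (x + h)))"

record 'a noise_system =
  noise_fields :: "ereal \<Rightarrow> ereal \<Rightarrow> 'a set set"
  noise_law :: "'a measure"
  noise_shift :: "real \<Rightarrow> 'a \<Rightarrow> 'a"

definition noise_of ::
  "(real \<Rightarrow> real) measure \<Rightarrow> random_set \<Rightarrow> (real \<Rightarrow> real) set \<Rightarrow> enumeration \<Rightarrow>
     sample noise_system" where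
  "noise_of W M \<Omega>\<^sub>1 S =
     \<lparr>noise_fields = N_M W M \<Omega>\<^sub>1 S, noise_law = \<P>_M W M \<Omega>\<^sub>1 S, noise_shift = shift_M\<rparr>"

section \<open>Isomorphism of noises\<close>

text \<open>\<open>\<psi>\<close> is a mod-\<open>0\<close> isomorphism witnessed by the removal of the null sets \<open>X\<close> and \<open>Y\<close>.\<close>
definition mod0_isomorphism ::
  "'a measure \<Rightarrow> 'b measure \<Rightarrow> 'a set \<Rightarrow> 'b set \<Rightarrow> ('a \<Rightarrow> 'b) \<Rightarrow> bool" where
  "mod0_isomorphism P Q X Y \<psi> \<longleftrightarrow>
     X \<in> null_sets P \<and> Y \<in> null_sets Q \<and>
     bij_betw \<psi> (space P - X) (space Q - Y) \<and>
     \<psi> \<in> restrict_space P (space P - X) \<rightarrow>\<^sub>M restrict_space Q (space Q - Y) \<and>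
     the_inv_into (space P - X) \<psi>
       \<in> restrict_space Q (space Q - Y) \<rightarrow>\<^sub>M restrict_space P (space P - X) \<and>
     distr (restrict_space P (space P - X)) (restrict_space Q (space Q - Y)) \<psi> =
       restrict_space Q (space Q - Y)"

definition noise_isomorphism ::
  "'a noise_system \<Rightarrow> 'b noise_system \<Rightarrow> 'a set \<Rightarrow> 'b set \<Rightarrow> ('a \<Rightarrow> 'b) \<Rightarrow> bool" where
  "noise_isomorphism N N' X Y \<psi> \<longleftrightarrow>
     mod0_isomorphism (noise_law N) (noise_law N') X Y \<psi> \<and>
     (\<forall>s t. s < t \<longrightarrow>
        {\<psi> ` (A - X) | A. A \<in> noise_fields N s t} = {B - Y | B. B \<in> noise_fields N' s t}) \<and>
     (\<forall>h. AE x in noise_law N. \<psi> (noise_shift N h x) = noise_shift N' h (\<psi> x))"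

definition isomorphic_noises :: "'a noise_system \<Rightarrow> 'b noise_system \<Rightarrow> bool" where
  "isomorphic_noises N N' \<longleftrightarrow> (\<exists>X Y \<psi>. noise_isomorphism N N' X Y \<psi>)"

end

theory Submission
  imports Defs
begin

text \<open>
  The path component of an isomorphism \<open>\<phi>\<close> is a stationary Brownian motion \<open>\<xi>\<close> whose increments are
  local. By additivity and stationarity, the increments of \<open>\<xi>\<close> and of the path \<open>\<omega>\<close> from \<open>s\<close> to \<open>t\<close>
  have covariance \<open>c * (t - s)\<close>, so that \<open>v = \<xi> - c * \<omega>\<close> is uncorrelated with the path. A characteristic
  function estimate over fine partitions shows that \<open>v\<close> is even centred given the path, and flipping
  single signs shows that its Walsh coefficients with respect to the signs vanish as well. So \<open>v = 0\<close>
  and \<open>c = 1\<close> or \<open>c = -1\<close>.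

  Hence \<open>\<phi>\<close> turns the sign attached to a point \<open>r\<close> of \<open>M2 (c * \<omega>)\<close> into a sign that is local to every
  neighbourhood of \<open>r\<close> and centred given \<open>\<omega>\<close>. If \<open>r\<close> were not in \<open>M1 \<omega>\<close>, flipping any single sign of
  \<open>M1 \<omega>\<close> would leave it unchanged, all its Walsh coefficients would vanish, and so would the sign.
  Thus \<open>M2 (c * \<omega>) \<subseteq> M1 \<omega>\<close>, and the inverse isomorphism gives the converse inclusion. Conversely, if
  \<open>M1 \<omega> = M2 (c * \<omega>)\<close> almost surely, then \<open>(\<omega>, \<eta>) \<mapsto> (c * \<omega>, \<eta>)\<close> is an isomorphism.
\<close>

text \<open>The copy \<xi> is built from path and signs together, so it need not be Gaussian jointly
  with the path, and a vanishing covariance gives no independence. The substitute is locality: what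
  belongs to (s,t) is independent of the path increments outside (s,t). In E(v exp(i l w)) each
  piece of v over a partition therefore meets only the exponential of its own piece of w, and the
  rest of the path factors out.

  A second obstacle is that the index of a point in the enumeration depends on the whole path, so
  changing the sign with a given index is not a local operation. Making the change only when the
  point lies outside I gives a map that preserves the law and still fixes everything local to I.

  Isomorphisms are given up to null sets. They are handled through everywhere defined maps that
  preserve the law and pull local events back to local events (\<open>noise_hom\<close>). An
  isomorphism yields two of them, with the same constant c because c squared is 1; two of them that
  are mutually inverse off null sets yield an isomorphism.\<close>

section \<open>Preliminaries on completions, image laws and independence\<close>

lemma (in complete_measure) distr_completion_eqI:
  assumes f: "f \<in> M \<rightarrow>\<^sub>M N" and eq: "distr M N f = N"
  shows "f \<in> M \<rightarrow>\<^sub>M completion N" and "distr M (completion N) f = completion N"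
proof -
  show "f \<in> M \<rightarrow>\<^sub>M completion N"
    by (rule measurable_completion2[OF f]) (simp add: eq)
  show "distr M (completion N) f = completion N"
    using completion_distr_eq[OF f] eq by simp
qed

text \<open>Independence is a property of the joint law, and the joint law of the \<open>X i\<close>
  under the image measure is that of the composites with \<open>f\<close>.\<close>

lemma (in prob_space) indep_vars_distr_iff:
  assumes "I \<noteq> {}" and f: "f \<in> M \<rightarrow>\<^sub>M N" and X: "\<And>i. i \<in> I \<Longrightarrow> X i \<in> N \<rightarrow>\<^sub>M M' i"
  shows "prob_space.indep_vars (distr M N f) M' X I \<longleftrightarrow> indep_vars M' (\<lambda>i x. X i (f x)) I"
proof -
  interpret D: prob_space "distr M N f"
    by (rule prob_space_distr[OF f])
  have R: "(\<lambda>x. \<lambda>i\<in>I. X i x) \<in> N \<rightarrow>\<^sub>M PiM I M'"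
    using X by measurable
  have "distr (distr M N f) (PiM I M') (\<lambda>x. \<lambda>i\<in>I. X i x) = distr M (PiM I M') (\<lambda>x. \<lambda>i\<in>I. X i (f x))"
    by (subst distr_distr[OF R f]) (simp add: comp_def)
  moreover have "PiM I (\<lambda>i. distr (distr M N f) (M' i) (X i)) = PiM I (\<lambda>i. distr M (M' i) (\<lambda>x. X i (f x)))"
    using distr_distr[OF X f] by (intro PiM_cong) (auto simp: comp_def)
  ultimately show ?thesis
    using assms measurable_compose[OF f X]
    by (subst D.indep_vars_iff_distr_eq_PiM', simp, simp)
       (subst indep_vars_iff_distr_eq_PiM', simp_all)
qed

lemma (in prob_space) indep_sets_reindex:
  assumes inj: "inj_on g I" and F: "indep_sets F (g ` I)"
  shows "indep_sets (\<lambda>i. F (g i)) I"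
proof (rule indep_setsI)
  fix A J assume J: "J \<noteq> {}" "J \<subseteq> I" "finite J" and A: "\<forall>j\<in>J. A j \<in> F (g j)"
  have injJ: "inj_on g J"
    using inj J(2) by (rule inj_on_subset)
  let ?B = "\<lambda>i. A (the_inv_into J g i)"
  have "prob (\<Inter>i\<in>g ` J. ?B i) = (\<Prod>i\<in>g ` J. prob (?B i))"
    by (rule indep_setsD[OF F]) (use J A injJ in \<open>auto simp: the_inv_into_f_f\<close>)
  then show "prob (\<Inter>j\<in>J. A j) = (\<Prod>j\<in>J. prob (A j))"
    using injJ by (simp add: prod.reindex the_inv_into_f_f cong: INF_cong prod.cong)
qed (use F in \<open>auto simp: indep_sets_def\<close>)

lemma (in prob_space) indep_vars_reindex:
  assumes "inj_on g I" "indep_vars M' X (g ` I)"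
  shows "indep_vars (\<lambda>i. M' (g i)) (\<lambda>i. X (g i)) I"
  using assms indep_sets_reindex[OF assms(1)] unfolding indep_vars_def2 by auto

section \<open>Increments of Brownian paths\<close>

text \<open>The successor of \<open>u\<close> in a finite set of times. \<open>Min {}\<close> is
  unspecified, so all facts about it are restricted to \<open>u\<close> in
  \<open>steps J\<close>.\<close>

definition next_in :: "real set \<Rightarrow> real \<Rightarrow> real" where
  "next_in J u = Min {v \<in> J. u < v}"

text \<open>The left end points of the intervals into which \<open>J\<close> cuts the line. Indexing
  the increments by them allows finite sets of times to be enlarged without renumbering a
  sequence.\<close>

definition steps :: "real set \<Rightarrow> real set" where
  "steps J = {u \<in> J. \<exists>v\<in>J. u < v}"

lemma finite_steps: "finite J \<Longrightarrow> finite (steps J)"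
  by (simp add: steps_def)

lemma next_in:
  assumes "finite J" "u \<in> steps J"
  shows "next_in J u \<in> J" "u < next_in J u" "\<And>v. v \<in> J \<Longrightarrow> u < v \<Longrightarrow> next_in J u \<le> v"
proof -
  have "next_in J u \<in> {v \<in> J. u < v}"
    unfolding next_in_def using assms by (intro Min_in) (auto simp: steps_def)
  then show "next_in J u \<in> J" "u < next_in J u"
    by auto
  show "\<And>v. v \<in> J \<Longrightarrow> u < v \<Longrightarrow> next_in J u \<le> v"
    using assms unfolding next_in_def by (intro Min_le) auto
qed

text \<open>Telescoping, by induction on the number of points of \<open>J\<close> in [u,v).\<close>

lemma diff_eq_sum_steps:
  fixes f :: "real \<Rightarrow> 'a::ab_group_add"
  assumes J: "finite J" and uv: "u \<in> J" "v \<in> J" "u \<le> v"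
  shows "f v - f u = (\<Sum>w\<in>{w\<in>J. u \<le> w \<and> w < v}. f (next_in J w) - f w)"
  using uv
proof (induction "card {w\<in>J. u \<le> w \<and> w < v}" arbitrary: u rule: less_induct)
  case less
  show ?case
  proof (cases "u = v")
    case False
    then have "u < v" and u: "u \<in> steps J"
      using less.prems False by (auto simp: steps_def intro!: bexI[of _ v])
    note n = next_in[OF J u]
    have nv: "next_in J u \<le> v"
      using n less.prems \<open>u < v\<close> by auto
    have eq: "{w\<in>J. u \<le> w \<and> w < v} = insert u {w\<in>J. next_in J u \<le> w \<and> w < v}"
      using n \<open>u < v\<close> less.prems by fastforce
    have ni: "u \<notin> {w\<in>J. next_in J u \<le> w \<and> w < v}"
      using n by auto
    have "f v - f (next_in J u) = (\<Sum>w\<in>{w\<in>J. next_in J u \<le> w \<and> w < v}. f (next_in J w) - f w)"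
      by (rule less.hyps) (use n less.prems nv J ni in \<open>auto simp: eq\<close>)
    then show ?thesis
      unfolding eq using ni J by (simp add: algebra_simps)
  next
    case True
    then have "(\<Sum>w\<in>{w\<in>J. u \<le> w \<and> w < v}. f (next_in J w) - f w) = 0"
      by (intro sum.neutral) auto
    then show ?thesis
      using True by (simp only: diff_self)
  qed
qed

text \<open>
  The base point \<open>p u\<close> may depend on \<open>u\<close>, so that one notion covers the increments inside an interval
  and those outside of it.
\<close>
definition increment_events :: "(real \<Rightarrow> real) \<Rightarrow> real set \<Rightarrow> (real \<Rightarrow> real) set set" where
  "increment_events p I =
     {{\<omega> \<in> \<Omega>\<^sub>0. \<forall>u\<in>J. \<omega> u - \<omega> (p u) \<in> A u} | J A. finite J \<and> J \<subseteq> I \<and> (\<forall>u. A u \<in> sets (borel :: real measure))}"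

definition increment_field :: "(real \<Rightarrow> real) \<Rightarrow> real set \<Rightarrow> (real \<Rightarrow> real) measure" where
  "increment_field p I = sigma \<Omega>\<^sub>0 (increment_events p I)"

lemma space_increment_field [simp]: "space (increment_field p I) = \<Omega>\<^sub>0"
  by (auto simp: increment_field_def increment_events_def intro!: space_measure_of)

lemma sets_increment_field: "sets (increment_field p I) = sigma_sets \<Omega>\<^sub>0 (increment_events p I)"
  unfolding increment_field_def by (rule sets_measure_of) (auto simp: increment_events_def)

lemma increment_events_subset: "increment_events p I \<subseteq> Pow \<Omega>\<^sub>0"
  by (auto simp: increment_events_def)

lemma space_in_increment_events: "\<Omega>\<^sub>0 \<in> increment_events p I"
  unfolding increment_events_def by (rule CollectI, intro exI[of _ "{}"]) auto

lemma Int_stable_increment_events: "Int_stable (increment_events p I)"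
proof (rule Int_stableI)
  fix a b assume "a \<in> increment_events p I" "b \<in> increment_events p I"
  then obtain J A J' A' where a: "a = {\<omega> \<in> \<Omega>\<^sub>0. \<forall>u\<in>J. \<omega> u - \<omega> (p u) \<in> A u}"
    and b: "b = {\<omega> \<in> \<Omega>\<^sub>0. \<forall>u\<in>J'. \<omega> u - \<omega> (p u) \<in> A' u}"
    and J: "finite J" "J \<subseteq> I" "finite J'" "J' \<subseteq> I" and A: "\<And>u. A u \<in> sets borel" "\<And>u. A' u \<in> sets borel"
    by (auto simp: increment_events_def)
  define B where "B u = (if u \<in> J then A u else UNIV) \<inter> (if u \<in> J' then A' u else UNIV)" for u
  have ab: "a \<inter> b = {\<omega> \<in> \<Omega>\<^sub>0. \<forall>u\<in>J \<union> J'. \<omega> u - \<omega> (p u) \<in> B u}"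
    unfolding a b by (rule set_eqI) (auto simp: B_def)
  have "B u \<in> sets borel" for u
    unfolding B_def using A by auto
  then show "a \<inter> b \<in> increment_events p I"
    unfolding increment_events_def mem_Collect_eq ab
    using J by (intro exI[of _ "J \<union> J'"] exI[of _ B] conjI refl) auto
qed

lemma increment_eventsE:
  assumes "a \<in> increment_events p I"
  obtains J A where "a = {\<omega> \<in> \<Omega>\<^sub>0. \<forall>u\<in>J. \<omega> u - \<omega> (p u) \<in> A u}" "finite J" "J \<subseteq> I"
    "\<And>u. A u \<in> sets (borel :: real measure)"
  using assms unfolding increment_events_def by blast

lemma increment_measurable [measurable (raw)]:
  assumes "u \<in> I"
  shows "(\<lambda>\<omega>. \<omega> u - \<omega> (p u)) \<in> borel_measurable (increment_field p I)"
proof (rule measurableI)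
  fix A :: "real set" assume "A \<in> sets borel"
  then have "{\<omega> \<in> \<Omega>\<^sub>0. \<forall>v\<in>{u}. \<omega> v - \<omega> (p v) \<in> A} \<in> increment_events p I"
    unfolding increment_events_def mem_Collect_eq
    by (intro exI[of _ "{u}"] exI[of _ "\<lambda>_. A"]) (use assms in auto)
  then have "{\<omega> \<in> \<Omega>\<^sub>0. \<forall>v\<in>{u}. \<omega> v - \<omega> (p v) \<in> A} \<in> sets (increment_field p I)"
    by (simp add: sets_increment_field sigma_sets.Basic)
  also have "{\<omega> \<in> \<Omega>\<^sub>0. \<forall>v\<in>{u}. \<omega> v - \<omega> (p v) \<in> A} =
      (\<lambda>\<omega>. \<omega> u - \<omega> (p u)) -` A \<inter> space (increment_field p I)"
    by auto
  finally show "(\<lambda>\<omega>. \<omega> u - \<omega> (p u)) -` A \<inter> space (increment_field p I) \<in> sets (increment_field p I)" .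
qed simp

section \<open>Wiener measure: independent steps, and uniqueness of the law\<close>

locale wiener =
  fixes P W :: "(real \<Rightarrow> real) measure"
  assumes wiener: "two_sided_wiener P" and W_eq: "W = completion P"
begin

lemma prob_P: "prob_space P"
  using wiener by (simp add: two_sided_wiener_def)

sublocale P: prob_space P
  by (rule prob_P)

sublocale W: prob_space W
  unfolding W_eq by (rule prob_spaceI) (simp add: P.emeasure_space_1)

sublocale W: complete_measure W
  unfolding W_eq by unfold_locales

lemma sets_P: "sets P = sets (restrict_space (\<Pi>\<^sub>M t\<in>UNIV. borel) \<Omega>\<^sub>0)"
  using wiener by (simp add: two_sided_wiener_def)

lemma space_P [simp]: "space P = \<Omega>\<^sub>0"
  using sets_eq_imp_space_eq[OF sets_P] by (simp add: space_restrict_space space_PiM)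

lemma space_W [simp]: "space W = \<Omega>\<^sub>0"
  by (simp add: W_eq)

lemma sets_P_subset: "A \<in> sets P \<Longrightarrow> A \<in> sets W"
  by (simp add: W_eq)

lemma measurable_P_W: "f \<in> P \<rightarrow>\<^sub>M N \<Longrightarrow> f \<in> W \<rightarrow>\<^sub>M N"
  unfolding W_eq by (rule measurable_completion)

lemma eval_measurable_P [measurable]: "(\<lambda>\<omega>. \<omega> t) \<in> borel_measurable P"
  by (subst measurable_cong_sets[OF sets_P refl]) (intro measurable_restrict_space1 measurable_component_singleton, simp)

lemma eval_measurable_W [measurable]: "(\<lambda>\<omega>. \<omega> t) \<in> borel_measurable W"
  by (rule measurable_P_W) measurable

lemma increment_events_in_P:
  assumes "a \<in> increment_events p I" shows "a \<in> sets P"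
proof -
  obtain J A where "finite J" "\<And>u. A u \<in> sets borel" and a: "a = {\<omega> \<in> space P. \<forall>u\<in>J. \<omega> u - \<omega> (p u) \<in> A u}"
    using assms by (auto simp: increment_events_def)
  note [measurable] = this(2)
  show ?thesis
    unfolding a using \<open>finite J\<close> by measurable
qed

lemma sets_increment_field_subset: "sets (increment_field p I) \<subseteq> sets P"
  unfolding sets_increment_field using increment_events_in_P sets.sigma_sets_subset[of "increment_events p I" P]
  by auto

text \<open>Paths vanish at 0, so the coordinate maps are the increments based at 0. This gives an
  intersection-stable generator on which laws can be compared.\<close>

lemma sets_P_eq: "sets P = sigma_sets \<Omega>\<^sub>0 (increment_events (\<lambda>_. 0) UNIV)"
proof
  let ?F = "increment_field (\<lambda>_. 0) UNIV"
  have "(\<lambda>\<omega>. \<omega>) \<in> ?F \<rightarrow>\<^sub>M (\<Pi>\<^sub>M t\<in>UNIV. borel)"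
  proof (rule measurable_PiM_single')
    fix t
    have "(\<lambda>\<omega>. \<omega> t - \<omega> 0) \<in> borel_measurable ?F"
      by (rule increment_measurable) simp
    also have "?this \<longleftrightarrow> (\<lambda>\<omega>. \<omega> t) \<in> borel_measurable ?F"
      by (rule measurable_cong) (simp add: \<Omega>\<^sub>0_def)
    finally show "(\<lambda>\<omega>. \<omega> t) \<in> borel_measurable ?F" .
  qed auto
  then have "(\<lambda>\<omega>. \<omega>) \<in> ?F \<rightarrow>\<^sub>M restrict_space (\<Pi>\<^sub>M t\<in>UNIV. borel) \<Omega>\<^sub>0"
    by (intro measurable_restrict_space2) auto
  from measurable_sets[OF this] have "A \<in> sets P \<Longrightarrow> A \<inter> \<Omega>\<^sub>0 \<in> sets ?F" for A
    by (simp add: sets_P)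
  moreover have "A \<in> sets P \<Longrightarrow> A \<inter> \<Omega>\<^sub>0 = A" for A
    using sets.sets_into_space[of A P] by auto
  ultimately show "sets P \<subseteq> sigma_sets \<Omega>\<^sub>0 (increment_events (\<lambda>_. 0) UNIV)"
    by (auto simp: sets_increment_field)
qed (use sets_increment_field_subset sets_increment_field in blast)

lemma distributed_increment:
  "u < v \<Longrightarrow> distributed P lborel (\<lambda>\<omega>. \<omega> v - \<omega> u) (normal_density 0 (sqrt (v - u)))"
  using wiener by (simp add: two_sided_wiener_def)

lemma indep_vars_steps:
  assumes J: "finite J"
  shows "P.indep_vars (\<lambda>_. borel) (\<lambda>u \<omega>. \<omega> (next_in J u) - \<omega> u) (steps J)"
proof -
  \<comment> \<open>\<open>h\<close> lists \<open>J\<close> in increasing order and \<open>g\<close>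
    below inverts it, which turns independence along increasing sequences into independence indexed
    by left end points.\<close>
  define h where "h i = sorted_list_of_set J ! i" for i
  have hmono: "i < j \<Longrightarrow> j < card J \<Longrightarrow> h i < h j" for i j
    unfolding h_def by (rule sorted_wrt_nth_less[of "(<)"]) auto
  have hJ: "i < card J \<Longrightarrow> h i \<in> J" for i
    unfolding h_def using J nth_mem[of i "sorted_list_of_set J"] by simp
  have "\<exists>i<card J. h i = u" if "u \<in> J" for u
    using that J unfolding h_def by (metis in_set_conv_nth length_sorted_list_of_set set_sorted_list_of_set)
  then obtain g where g: "\<And>u. u \<in> J \<Longrightarrow> h (g u) = u \<and> g u < card J"
    by metis
  \<comment> \<open>The number of intervals, one less than the number of points; truncated
    subtraction makes it 0 for empty \<open>J\<close>.\<close>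
  define n where "n = card J - 1"
  have steps_sub: "steps J \<subseteq> J"
    by (auto simp: steps_def)
  have nx: "next_in J u = h (Suc (g u)) \<and> g u < n" if u: "u \<in> steps J" for u
  proof -
    from u obtain v where v: "v \<in> J" "u < v" "u \<in> J"
      by (auto simp: steps_def)
    have "g u < g v"
    proof (rule ccontr)
      assume "\<not> g u < g v"
      then have "g v < g u \<or> g u = g v" by auto
      then show False
        using hmono[of "g v" "g u"] g[OF v(1)] g[OF v(3)] v(2) by auto
    qed
    then have l: "Suc (g u) < card J"
      using g[OF v(1)] by auto
    have "next_in J u = h (Suc (g u))"
      unfolding next_in_def
    proof (rule Min_eqI)
      show "h (Suc (g u)) \<in> {v \<in> J. u < v}"
        using hJ[OF l] l hmono[of "g u" "Suc (g u)"] g[OF v(3)] by auto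
      fix y assume y: "y \<in> {v \<in> J. u < v}"
      have "g u < g y"
      proof (rule ccontr)
        assume "\<not> g u < g y"
        then have "g y < g u \<or> g u = g y" by auto
        then show False
          using hmono[of "g y" "g u"] g[of y] g[OF v(3)] y by auto
      qed
      then show "h (Suc (g u)) \<le> y"
        using hmono[of "Suc (g u)" "g y"] g[of y] y by (cases "Suc (g u) = g y") auto
    qed (use J in auto)
    then show ?thesis
      using l by (auto simp: n_def)
  qed
  have "\<forall>i<n. h i < h (Suc i)"
    by (auto simp: n_def intro!: hmono)
  then have "P.indep_vars (\<lambda>_. borel) (\<lambda>i \<omega>. \<omega> (h (Suc i)) - \<omega> (h i)) {..<n}"
    using wiener unfolding two_sided_wiener_def by blast
  then have "P.indep_vars (\<lambda>_. borel) (\<lambda>i \<omega>. \<omega> (h (Suc i)) - \<omega> (h i)) (g ` steps J)"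
    by (rule P.indep_vars_subset) (use nx in auto)
  then have "P.indep_vars (\<lambda>_. borel) (\<lambda>u \<omega>. \<omega> (h (Suc (g u))) - \<omega> (h (g u))) (steps J)"
    by (intro P.indep_vars_reindex[where g=g and X="\<lambda>i \<omega>. \<omega> (h (Suc i)) - \<omega> (h i)"])
       (rule inj_onI, metis g steps_sub subsetD)
  then show ?thesis
    by (rule iffD1[OF P.indep_vars_cong, rotated -1]) (use nx g in \<open>auto simp: steps_def fun_eq_iff\<close>)
qed

text \<open>Finitely many increments of either kind are sums of steps of one finite set
  \<open>K\<close> of times that contains s and t: the inside ones use steps starting in [s,t), the
  outside ones the remaining steps. Disjoint groups of independent steps are independent, and both
  families of events are intersection-stable.\<close>

lemma indep_inside_outside:
  assumes st: "s < t"
  shows "P.indep_set (sets (increment_field (\<lambda>_. s) {s..t}))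
    (sets (increment_field (\<lambda>u. if u \<le> s then s else t) (- {s<..<t})))"
proof -
  have "P.indep_set (increment_events (\<lambda>_. s) {s..t})
    (increment_events (\<lambda>u. if u \<le> s then s else t) (- {s<..<t}))"
  proof (rule P.indep_setI)
    fix a b
    assume "a \<in> increment_events (\<lambda>_. s) {s..t}"
      and "b \<in> increment_events (\<lambda>u. if u \<le> s then s else t) (- {s<..<t})"
    note ab = this
    obtain J A where a: "a = {\<omega> \<in> \<Omega>\<^sub>0. \<forall>u\<in>J. \<omega> u - \<omega> s \<in> A u}"
      and J: "finite J" "J \<subseteq> {s..t}" and A [measurable]: "\<And>u. A u \<in> sets borel"
      by (rule increment_eventsE[OF ab(1)]) (rule that)
    obtain J' A' where b: "b = {\<omega> \<in> \<Omega>\<^sub>0. \<forall>u\<in>J'. \<omega> u - \<omega> (if u \<le> s then s else t) \<in> A' u}"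
      and J': "finite J'" "J' \<subseteq> - {s<..<t}" and A' [measurable]: "\<And>u. A' u \<in> sets borel"
      by (rule increment_eventsE[OF ab(2)]) (rule that)
    note J = J J'
    define K where "K = J \<union> J' \<union> {s, t}"
    have K: "finite K" "s \<in> K" "t \<in> K" "J \<subseteq> K" "J' \<subseteq> K"
      using J by (auto simp: K_def)
    define Li where "Li = {w \<in> steps K. s \<le> w \<and> w < t}"
    define Lo where "Lo = {w \<in> steps K. \<not> (s \<le> w \<and> w < t)}"
    let ?X = "\<lambda>w \<omega>. \<omega> (next_in K w) - \<omega> w"
    define fi where "fi u f = (\<Sum>w\<in>{w\<in>K. s \<le> w \<and> w < u}. f w)" for u and f :: "real \<Rightarrow> real"
    \<comment> \<open>Times up to s have base point s and lie to its left, hence the minus sign; the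
      other times have base point t and lie to its right.\<close>
    define fo where "fo u f = (if u \<le> s then - (\<Sum>w\<in>{w\<in>K. u \<le> w \<and> w < s}. f w)
       else (\<Sum>w\<in>{w\<in>K. t \<le> w \<and> w < u}. f w))" for u and f :: "real \<Rightarrow> real"
    have sub: "v \<in> K \<Longrightarrow> {w\<in>K. u \<le> w \<and> w < v} \<subseteq> steps K" for u v
      by (auto simp: steps_def)
    have subi: "u \<in> J \<Longrightarrow> {w\<in>K. s \<le> w \<and> w < u} \<subseteq> Li" for u
      using sub[of u s] J K unfolding Li_def by force
    have subo1: "{w\<in>K. u \<le> w \<and> w < s} \<subseteq> Lo" for u
      using sub[of s u] K unfolding Lo_def by force
    have subo2: "u \<in> J' \<Longrightarrow> {w\<in>K. t \<le> w \<and> w < u} \<subseteq> Lo" for u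
      using sub[of u t] K st unfolding Lo_def by force
    have sum_meas: "(\<lambda>f. \<Sum>w\<in>S. f w) \<in> borel_measurable (PiM L (\<lambda>_. borel :: real measure))" if "S \<subseteq> L" for S L :: "real set"
      using that by (intro borel_measurable_sum measurable_component_singleton) auto
    have fi_m: "u \<in> J \<Longrightarrow> fi u \<in> borel_measurable (PiM Li (\<lambda>_. borel))" for u
      unfolding fi_def by (rule sum_meas[OF subi])
    have fo_m: "u \<in> J' \<Longrightarrow> fo u \<in> borel_measurable (PiM Lo (\<lambda>_. borel))" for u
      unfolding fo_def using sum_meas[OF subo1] sum_meas[OF subo2, of u] by (cases "u \<le> s") auto
    define ai where "ai = {f \<in> space (PiM Li (\<lambda>_. borel :: real measure)). \<forall>u\<in>J. fi u f \<in> A u}"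
    define bo where "bo = {f \<in> space (PiM Lo (\<lambda>_. borel :: real measure)). \<forall>u\<in>J'. fo u f \<in> A' u}"
    have ai: "ai \<in> sets (PiM Li (\<lambda>_. borel))"
      unfolding ai_def by (intro sets.sets_Collect_finite_All J) (use fi_m in measurable)
    have bo: "bo \<in> sets (PiM Lo (\<lambda>_. borel))"
      unfolding bo_def by (intro sets.sets_Collect_finite_All J) (use fo_m in measurable)
    let ?Xi = "\<lambda>\<omega>. restrict (\<lambda>w. ?X w \<omega>) Li" and ?Xo = "\<lambda>\<omega>. restrict (\<lambda>w. ?X w \<omega>) Lo"
    have iv: "P.indep_var (PiM Li (\<lambda>_. borel)) ?Xi (PiM Lo (\<lambda>_. borel)) ?Xo"
      by (rule P.indep_var_restrict[OF indep_vars_steps[OF K(1)]]) (auto simp: Li_def Lo_def)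
    have fi_X: "fi u (?Xi \<omega>) = \<omega> u - \<omega> s" if "u \<in> J" for u \<omega>
    proof -
      have "fi u (?Xi \<omega>) = (\<Sum>w\<in>{w\<in>K. s \<le> w \<and> w < u}. ?X w \<omega>)"
        unfolding fi_def using subi[OF that] by (intro sum.cong) auto
      also have "\<dots> = \<omega> u - \<omega> s"
        using that J K by (intro diff_eq_sum_steps[symmetric]) auto
      finally show ?thesis .
    qed
    have fo_X: "fo u (?Xo \<omega>) = \<omega> u - \<omega> (if u \<le> s then s else t)" if "u \<in> J'" for u \<omega>
    proof (cases "u \<le> s")
      case True
      have "(\<Sum>w\<in>{w\<in>K. u \<le> w \<and> w < s}. ?Xo \<omega> w) = (\<Sum>w\<in>{w\<in>K. u \<le> w \<and> w < s}. ?X w \<omega>)"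
        using subo1 by (intro sum.cong) auto
      also have "\<dots> = \<omega> s - \<omega> u"
        using that K True by (intro diff_eq_sum_steps[symmetric]) auto
      finally show ?thesis
        using True by (simp add: fo_def)
    next
      case False
      have "(\<Sum>w\<in>{w\<in>K. t \<le> w \<and> w < u}. ?Xo \<omega> w) = (\<Sum>w\<in>{w\<in>K. t \<le> w \<and> w < u}. ?X w \<omega>)"
        using subo2[OF that] by (intro sum.cong) auto
      also have "\<dots> = \<omega> u - \<omega> t"
        using that J K False by (intro diff_eq_sum_steps[symmetric]) auto
      finally show ?thesis
        using False by (simp add: fo_def)
    qed
    have a': "a = ?Xi -` ai \<inter> space P"
      unfolding a ai_def using fi_X by (auto simp: space_PiM)
    have b': "b = ?Xo -` bo \<inter> space P"
      unfolding b bo_def using fo_X by (auto simp: space_PiM)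
    have "a \<inter> b = (\<lambda>\<omega>. (?Xi \<omega>, ?Xo \<omega>)) -` (ai \<times> bo) \<inter> space P"
      unfolding a' b' by auto
    then show "P.prob (a \<inter> b) = P.prob a * P.prob b"
      using P.indep_varD[OF iv ai bo] by (simp add: a' b')
  qed (use increment_events_in_P in auto)
  from P.indep_set_sigma_sets[OF this Int_stable_increment_events Int_stable_increment_events]
  show ?thesis
    by (simp only: sets_increment_field space_P)
qed

text \<open>The image law again has the defining properties of two-sided Wiener measure, and these
  determine a law: an event about finitely many times is an event about steps, whose joint law is a
  product of normal laws.\<close>

lemma distr_eq_wienerI:
  assumes f: "f \<in> P \<rightarrow>\<^sub>M P"
    and d: "\<And>u v. u < v \<Longrightarrow> distributed P lborel (\<lambda>\<omega>. f \<omega> v - f \<omega> u) (normal_density 0 (sqrt (v - u)))"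
    and i: "\<And>n t. \<forall>i<n. t i < t (Suc i) \<Longrightarrow> P.indep_vars (\<lambda>_. borel) (\<lambda>i \<omega>. f \<omega> (t (Suc i)) - f \<omega> (t i)) {..<n::nat}"
  shows "distr P P f = P"
proof -
  have dd: "distributed (distr P P f) lborel (\<lambda>\<omega>. \<omega> v - \<omega> u) (normal_density 0 (sqrt (v - u)))" if "u < v" for u v
    using d[OF that] f by (simp add: distributed_def distr_distr comp_def)
  interpret D: prob_space "distr P P f"
    by (rule P.prob_space_distr[OF f])
  have "D.indep_vars (\<lambda>_. borel) (\<lambda>i \<omega>. \<omega> (t (Suc i)) - \<omega> (t i)) {..<n}" if "\<forall>i<n. t i < t (Suc i)" for n :: nat and t
  \<comment> \<open>\<open>indep_vars_distr_iff\<close> compares laws on a nonempty product, so the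
    empty family is treated directly.\<close>
  proof (cases "n = 0")
    case True
    then show ?thesis
      by (simp add: D.indep_vars_def D.indep_sets_def)
  next
    case False
    then show ?thesis
      using i[OF that] by (subst P.indep_vars_distr_iff[OF _ f]) auto
  qed
  then interpret D: wiener "distr P P f" "completion (distr P P f)"
    by unfold_locales (auto simp: two_sided_wiener_def sets_P[symmetric] dd intro: D.prob_space_axioms)
  show ?thesis
  proof (rule measure_eqI_generator_eq[OF Int_stable_increment_events increment_events_subset])
    show "sets P = sigma_sets \<Omega>\<^sub>0 (increment_events (\<lambda>_. 0) UNIV)"
      by (rule sets_P_eq)
    then show "sets (distr P P f) = sigma_sets \<Omega>\<^sub>0 (increment_events (\<lambda>_. 0) UNIV)"
      by simp
    show "range (\<lambda>_::nat. \<Omega>\<^sub>0) \<subseteq> increment_events (\<lambda>_. 0) UNIV"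
      using space_in_increment_events by auto
    fix a assume "a \<in> increment_events (\<lambda>_. 0) UNIV"
    note a_in = this
    obtain J A
      where a: "a = {\<omega> \<in> \<Omega>\<^sub>0. \<forall>u\<in>J. \<omega> u - \<omega> 0 \<in> A u}"
        and J: "finite J" and A [measurable]: "\<And>u. A u \<in> sets borel"
      by (rule increment_eventsE[OF a_in]) (rule that)
    \<comment> \<open>The time 0 is the base point of the increments; the time 1 ensures that there
      is at least one step, as required for describing independence by a product law.\<close>
    define K where "K = J \<union> {0, 1}"
    have K: "finite K" "0 \<in> K" "J \<subseteq> K"
      using J by (auto simp: K_def)
    have ne: "steps K \<noteq> {}"
      by (auto simp: steps_def K_def intro!: exI[of _ "0::real"] bexI[of _ "1::real"])
    define F where "F u f = (if 0 \<le> u then (\<Sum>w\<in>{w\<in>K. 0 \<le> w \<and> w < u}. f w)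
       else - (\<Sum>w\<in>{w\<in>K. u \<le> w \<and> w < 0}. f w))" for u and f :: "real \<Rightarrow> real"
    have sub: "v \<in> K \<Longrightarrow> {w\<in>K. u \<le> w \<and> w < v} \<subseteq> steps K" for u v
      by (auto simp: steps_def)
    have sum_meas: "(\<lambda>f. \<Sum>w\<in>S. f w) \<in> borel_measurable (PiM L (\<lambda>_. borel :: real measure))" if "S \<subseteq> L" for S L :: "real set"
      using that by (intro borel_measurable_sum measurable_component_singleton) auto
    have F_m: "u \<in> J \<Longrightarrow> F u \<in> borel_measurable (PiM (steps K) (\<lambda>_. borel))" for u
      unfolding F_def using sum_meas[OF sub, of u] sum_meas[OF sub[OF K(2)], of u] K by (cases "0 \<le> u") auto
    define B where "B = {f \<in> space (PiM (steps K) (\<lambda>_. borel :: real measure)). \<forall>u\<in>J. F u f \<in> A u}"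
    have B: "B \<in> sets (PiM (steps K) (\<lambda>_. borel))"
      unfolding B_def by (intro sets.sets_Collect_finite_All J) (use F_m in measurable)
    let ?X = "\<lambda>\<omega>. \<lambda>w\<in>steps K. \<omega> (next_in K w) - \<omega> w"
    have F_X: "F u (?X \<omega>) = \<omega> u - \<omega> 0" if "u \<in> J" for u \<omega>
    proof (cases "0 \<le> u")
      case True
      have "(\<Sum>w\<in>{w\<in>K. 0 \<le> w \<and> w < u}. ?X \<omega> w) = (\<Sum>w\<in>{w\<in>K. 0 \<le> w \<and> w < u}. \<omega> (next_in K w) - \<omega> w)"
        using sub[of u 0] K that by (intro sum.cong) auto
      also have "\<dots> = \<omega> u - \<omega> 0"
        using that K True by (intro diff_eq_sum_steps[symmetric]) auto
      finally show ?thesis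
        using True by (simp add: F_def)
    next
      case False
      have "(\<Sum>w\<in>{w\<in>K. u \<le> w \<and> w < 0}. ?X \<omega> w) = (\<Sum>w\<in>{w\<in>K. u \<le> w \<and> w < 0}. \<omega> (next_in K w) - \<omega> w)"
        using sub[OF K(2), of u] by (intro sum.cong) auto
      also have "\<dots> = \<omega> 0 - \<omega> u"
        using that K False by (intro diff_eq_sum_steps[symmetric]) auto
      finally show ?thesis
        using False by (simp add: F_def)
    qed
    have a': "a = ?X -` B \<inter> space P"
      unfolding a B_def using F_X by (auto simp: space_PiM)
    have X: "?X \<in> P \<rightarrow>\<^sub>M PiM (steps K) (\<lambda>_. borel)"
      by measurable
    \<comment> \<open>Stated for an arbitrary Wiener law, in order to be applied both to
      \<open>P\<close> and to the image law.\<close>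
    have law: "distr Q (PiM (steps K) (\<lambda>_. borel)) ?X =
        PiM (steps K) (\<lambda>w. density lborel (normal_density 0 (sqrt (next_in K w - w))))"
      if "wiener Q (completion Q)" for Q
    proof -
      interpret Q: wiener Q "completion Q" by fact
      have "distr Q (PiM (steps K) (\<lambda>_. borel)) ?X = PiM (steps K) (\<lambda>w. distr Q borel (\<lambda>\<omega>. \<omega> (next_in K w) - \<omega> w))"
        using Q.indep_vars_steps[OF K(1)] by (subst (asm) Q.P.indep_vars_iff_distr_eq_PiM') (use ne in auto)
      also have "\<dots> = PiM (steps K) (\<lambda>w. density lborel (normal_density 0 (sqrt (next_in K w - w))))"
      proof (intro PiM_cong refl)
        fix w assume "w \<in> steps K"
        then have "distributed Q lborel (\<lambda>\<omega>. \<omega> (next_in K w) - \<omega> w) (normal_density 0 (sqrt (next_in K w - w)))"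
          using next_in[OF K(1)] by (intro Q.distributed_increment) auto
        from distributed_distr_eq_density[OF this]
        show "distr Q borel (\<lambda>\<omega>. \<omega> (next_in K w) - \<omega> w) = density lborel (normal_density 0 (sqrt (next_in K w - w)))"
          by (simp cong: distr_cong)
      qed
      finally show ?thesis .
    qed
    have eq: "emeasure Q a = emeasure (distr Q (PiM (steps K) (\<lambda>_. borel)) ?X) B" if "wiener Q (completion Q)" for Q
    proof -
      interpret Q: wiener Q "completion Q" by fact
      have "?X \<in> Q \<rightarrow>\<^sub>M PiM (steps K) (\<lambda>_. borel)"
        by measurable
      then show ?thesis
        using B by (subst emeasure_distr) (auto simp: a')
    qed
    have wP: "wiener P (completion P)"
      using wiener by (rule wiener.intro) (rule refl)
    show "emeasure (distr P P f) a = emeasure P a"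
      unfolding eq[OF D.wiener_axioms] eq[OF wP] law[OF D.wiener_axioms] law[OF wP] ..
  qed auto
qed

end

section \<open>Symmetries and fields of Wiener space\<close>

lemma (in prob_space) normal_moments:
  assumes D: "distributed M lborel X (normal_density 0 \<sigma>)" and \<sigma>: "0 < \<sigma>"
  shows "integrable M (\<lambda>x. X x ^ k)" and "expectation X = 0"
    and "expectation (\<lambda>x. X x ^ 2) = \<sigma>\<^sup>2" and "expectation (\<lambda>x. X x ^ 4) = 3 * \<sigma> ^ 4"
proof -
  show "integrable M (\<lambda>x. X x ^ k)"
    using integrable_normal_moment[OF \<sigma>, of 0 k]
    by (subst distributed_integrable[OF D, symmetric]) auto
  show "expectation X = 0"
    by (rule normal_distributed_expectation[OF \<sigma> D])
  have "expectation (\<lambda>x. X x ^ (2 * j)) = fact (2 * j) / ((2 / \<sigma>\<^sup>2) ^ j * fact j)" for j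
    using integral_normal_moment_even[OF \<sigma>, of 0 j]
    by (subst distributed_integral[OF D, symmetric]) auto
  from this[of 1] this[of 2] show "expectation (\<lambda>x. X x ^ 2) = \<sigma>\<^sup>2" "expectation (\<lambda>x. X x ^ 4) = 3 * \<sigma> ^ 4"
    using \<sigma> by (simp_all add: fact_numeral power2_eq_square power4_eq_xxxx field_simps)
qed

lemma scale_\<Omega>\<^sub>0: "\<omega> \<in> \<Omega>\<^sub>0 \<Longrightarrow> (\<lambda>t. c * \<omega> t) \<in> \<Omega>\<^sub>0"
  by (auto simp: \<Omega>\<^sub>0_def intro!: continuous_intros)

lemma \<Delta>_\<Omega>\<^sub>0: "\<omega> \<in> \<Omega>\<^sub>0 \<Longrightarrow> \<Delta> h \<omega> \<in> \<Omega>\<^sub>0"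
  by (auto simp: \<Omega>\<^sub>0_def \<Delta>_def intro!: continuous_intros elim: continuous_on_compose2)

lemma space_borel_dagger [simp]: "space borel_dagger = UNIV"
  by (simp add: borel_dagger_def space_measure_of_conv)

lemma sets_borel_dagger: "sets borel_dagger = sigma_sets UNIV (insert {None} {Some ` A | A. A \<in> sets borel})"
  by (simp add: borel_dagger_def)

text \<open>The preimage of \<open>None\<close> is the complement of the preimage of all real
  values, so it needs no test of its own.\<close>

lemma borel_daggerI:
  assumes "\<And>B. B \<in> sets borel \<Longrightarrow> {x \<in> space A. f x \<in> Some ` B} \<in> sets A"
  shows "f \<in> A \<rightarrow>\<^sub>M borel_dagger"
  unfolding borel_dagger_def
proof (rule measurable_measure_of)
  fix y :: "real option set" assume "y \<in> insert {None} {Some ` A | A. A \<in> sets borel}"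
  then show "f -` y \<inter> space A \<in> sets A"
  proof
    assume y: "y = {None}"
    have "f -` y \<inter> space A = space A - {x \<in> space A. f x \<in> Some ` UNIV}"
      unfolding y by auto
    then show ?thesis
      using assms[of UNIV] by auto
  next
    assume "y \<in> {Some ` A | A. A \<in> sets borel}"
    then obtain B where "y = Some ` B" "B \<in> sets borel"
      by auto
    then show ?thesis
      using assms[of B] by (simp add: vimage_def Int_def conj_commute)
  qed
qed auto

lemma borel_daggerD:
  assumes f: "f \<in> A \<rightarrow>\<^sub>M borel_dagger"
  shows "B \<in> sets borel \<Longrightarrow> {x \<in> space A. f x \<in> Some ` B} \<in> sets A"
    and "{x \<in> space A. f x = None} \<in> sets A"
    and "(\<lambda>x. the (f x)) \<in> borel_measurable A"
proof -
  have 1: "B \<in> sets borel \<Longrightarrow> {x \<in> space A. f x \<in> Some ` B} \<in> sets A" for B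
    using measurable_sets[OF f, of "Some ` B"]
    by (auto simp: sets_borel_dagger vimage_def Int_def conj_commute intro: sigma_sets.Basic)
  then show "B \<in> sets borel \<Longrightarrow> {x \<in> space A. f x \<in> Some ` B} \<in> sets A" .
  show 2: "{x \<in> space A. f x = None} \<in> sets A"
    using measurable_sets[OF f, of "{None}"]
    by (auto simp: sets_borel_dagger vimage_def Int_def conj_commute intro: sigma_sets.Basic)
  show "(\<lambda>x. the (f x)) \<in> borel_measurable A"
  proof (rule measurableI)
    fix B :: "real set" assume "B \<in> sets borel"
    have "(\<lambda>x. the (f x)) -` B \<inter> space A =
        {x \<in> space A. f x \<in> Some ` B} \<union> (if the None \<in> B then {x \<in> space A. f x = None} else {})"
      by (auto split: if_splits) (metis imageI option.collapse)+
    then show "(\<lambda>x. the (f x)) -` B \<inter> space A \<in> sets A"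
      using 1[OF \<open>B \<in> sets borel\<close>] 2 by auto
  qed auto
qed

lemma borel_dagger_eq:
  assumes f: "f \<in> A \<rightarrow>\<^sub>M borel_dagger" and g: "g \<in> A \<rightarrow>\<^sub>M borel_dagger"
  shows "{x \<in> space A. f x = g x} \<in> sets A"
proof -
  note [measurable] = borel_daggerD(3)[OF f] borel_daggerD(3)[OF g]
  have [measurable]: "Measurable.pred A (\<lambda>x. f x = None)" "Measurable.pred A (\<lambda>x. g x = None)"
    using borel_daggerD(2)[OF f] borel_daggerD(2)[OF g] by (simp_all add: pred_def)
  have "{x \<in> space A. f x = g x} =
      {x \<in> space A. (f x = None \<and> g x = None) \<or> (f x \<noteq> None \<and> g x \<noteq> None \<and> the (f x) = the (g x))}"
    by (rule Collect_cong) (metis option.expand)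
  also have "\<dots> \<in> sets A"
    by measurable
  finally show ?thesis .
qed

lemma Some_measurable [measurable]: "f \<in> borel_measurable A \<Longrightarrow> (\<lambda>x. Some (f x)) \<in> A \<rightarrow>\<^sub>M borel_dagger"
proof (rule borel_daggerI)
  fix B :: "real set" assume [measurable]: "f \<in> borel_measurable A" "B \<in> sets borel"
  have "{x \<in> space A. Some (f x) \<in> Some ` B} = {x \<in> space A. f x \<in> B}"
    by auto
  then show "{x \<in> space A. Some (f x) \<in> Some ` B} \<in> sets A"
    by simp
qed

context wiener
begin

lemma measurable_PI:
  assumes "\<And>t. (\<lambda>x. f x t) \<in> borel_measurable M" "\<And>x. x \<in> space M \<Longrightarrow> f x \<in> \<Omega>\<^sub>0"
  shows "f \<in> M \<rightarrow>\<^sub>M P"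
proof -
  have "f \<in> M \<rightarrow>\<^sub>M restrict_space (\<Pi>\<^sub>M t\<in>UNIV. borel) \<Omega>\<^sub>0"
    using assms by (intro measurable_restrict_space2 measurable_PiM_single') auto
  then show ?thesis
    using measurable_cong_sets[OF refl sets_P] by blast
qed

lemma scale_P:
  assumes c: "c = 1 \<or> c = (-1 :: real)"
  shows "(\<lambda>\<omega> t. c * \<omega> t) \<in> P \<rightarrow>\<^sub>M P" and "distr P P (\<lambda>\<omega> t. c * \<omega> t) = P"
proof -
  show m: "(\<lambda>\<omega> t. c * \<omega> t) \<in> P \<rightarrow>\<^sub>M P"
    by (intro measurable_PI) (auto intro: scale_\<Omega>\<^sub>0)
  show "distr P P (\<lambda>\<omega> t. c * \<omega> t) = P"
  proof (rule distr_eq_wienerI[OF m])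
    fix u v :: real assume "u < v"
    then show "distributed P lborel (\<lambda>\<omega>. c * \<omega> v - c * \<omega> u) (normal_density 0 (sqrt (v - u)))"
      using P.normal_density_affine[OF distributed_increment[of u v], of c 0] c
      by (auto simp: algebra_simps)
  next
    fix n :: nat and t :: "nat \<Rightarrow> real" assume "\<forall>i<n. t i < t (Suc i)"
    then have "P.indep_vars (\<lambda>_. borel) (\<lambda>i \<omega>. \<omega> (t (Suc i)) - \<omega> (t i)) {..<n}"
      using wiener by (auto simp: two_sided_wiener_def)
    from P.indep_vars_compose2[OF this, of "\<lambda>_ x. c * x" "\<lambda>_. borel"]
    show "P.indep_vars (\<lambda>_. borel) (\<lambda>i \<omega>. c * \<omega> (t (Suc i)) - c * \<omega> (t i)) {..<n}"
      by (simp add: algebra_simps)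
  qed
qed

lemma \<Delta>_P: "\<Delta> h \<in> P \<rightarrow>\<^sub>M P" "distr P P (\<Delta> h) = P"
proof -
  show m: "\<Delta> h \<in> P \<rightarrow>\<^sub>M P"
  proof (rule measurable_PI)
    show "(\<lambda>\<omega>. \<Delta> h \<omega> t) \<in> borel_measurable P" for t
      unfolding \<Delta>_def by measurable
  qed (simp add: \<Delta>_\<Omega>\<^sub>0)
  show "distr P P (\<Delta> h) = P"
  proof (rule distr_eq_wienerI[OF m])
    fix u v :: real assume "u < v"
    then show "distributed P lborel (\<lambda>\<omega>. \<Delta> h \<omega> v - \<Delta> h \<omega> u) (normal_density 0 (sqrt (v - u)))"
      using distributed_increment[of "h + u" "h + v"] by (simp add: \<Delta>_def)
  next
    fix n :: nat and t :: "nat \<Rightarrow> real" assume t: "\<forall>i<n. t i < t (Suc i)"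
    have "\<forall>(n::nat) (t :: nat \<Rightarrow> real). (\<forall>i<n. t i < t (Suc i)) \<longrightarrow>
        P.indep_vars (\<lambda>_. borel) (\<lambda>i \<omega>. \<omega> (t (Suc i)) - \<omega> (t i)) {..<n}"
      using wiener by (auto simp: two_sided_wiener_def)
    from this[rule_format, of n "\<lambda>i. h + t i"] t
    show "P.indep_vars (\<lambda>_. borel) (\<lambda>i \<omega>. \<Delta> h \<omega> (t (Suc i)) - \<Delta> h \<omega> (t i)) {..<n}"
      by (simp add: \<Delta>_def)
  qed
qed

lemma measure_preserving_W:
  assumes f: "f \<in> P \<rightarrow>\<^sub>M P" and d: "distr P P f = P"
  shows "f \<in> W \<rightarrow>\<^sub>M W" and "distr W W f = W"
proof -
  have "distr W P f = P"
    unfolding W_eq using distr_completion[OF f] d by simp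
  from W.distr_completion_eqI[OF measurable_P_W[OF f] this]
  show "f \<in> W \<rightarrow>\<^sub>M W" and "distr W W f = W"
    by (simp_all add: W_eq)
qed

lemma scale_W:
  assumes "c = 1 \<or> c = (-1 :: real)"
  shows "(\<lambda>\<omega> t. c * \<omega> t) \<in> W \<rightarrow>\<^sub>M W" and "distr W W (\<lambda>\<omega> t. c * \<omega> t) = W"
  by (rule measure_preserving_W[OF scale_P[OF assms]])+

lemmas \<Delta>_W = measure_preserving_W[OF \<Delta>_P]

lemma distributed_increment_W:
  assumes "u < v"
  shows "distributed W lborel (\<lambda>\<omega>. \<omega> v - \<omega> u) (normal_density 0 (sqrt (v - u)))"
proof -
  have "distr W lborel (\<lambda>\<omega>. \<omega> v - \<omega> u) = distr P lborel (\<lambda>\<omega>. \<omega> v - \<omega> u)"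
    unfolding W_eq by (rule distr_completion) measurable
  then show ?thesis
    using distributed_increment[OF assms] by (simp add: distributed_def)
qed

lemma AE_W_vimage:
  assumes f: "f \<in> W \<rightarrow>\<^sub>M W" "distr W W f = W" and Q: "AE \<omega> in W. Q \<omega>"
  shows "AE \<omega> in W. Q (f \<omega>)"
proof -
  have "AE \<omega> in distr W W f. Q \<omega>"
    unfolding f(2) by (rule Q)
  then show ?thesis
    by (rule AE_distrD[OF f(1)])
qed

lemma sets_W_if_AE:
  assumes "AE \<omega> in W. Q \<omega>" shows "{\<omega> \<in> \<Omega>\<^sub>0. Q \<omega>} \<in> sets W"
proof (rule W.in_sets_AE)
  show "AE \<omega> in W. \<omega> \<in> space W \<longleftrightarrow> \<omega> \<in> {\<omega> \<in> \<Omega>\<^sub>0. Q \<omega>}"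
    using assms AE_space by eventually_elim auto
  show "space W \<in> sets W"
    by (rule sets.top)
qed auto

abbreviation increment_generator :: "ereal \<Rightarrow> ereal \<Rightarrow> (real \<Rightarrow> real) set set" where
  "increment_generator s t \<equiv> {{\<omega> \<in> \<Omega>\<^sub>0. \<omega> v - \<omega> u \<in> A} | u v A.
         s \<le> ereal u \<and> u \<le> v \<and> ereal v \<le> t \<and> A \<in> sets borel}"

lemma space_\<F> [simp]: "space (\<F> W s t) = \<Omega>\<^sub>0"
  unfolding \<F>_def by (rule space_measure_of) (use sets.sets_into_space[of _ W] in auto)

lemma sets_\<F>: "sets (\<F> W s t) =
    sigma_sets \<Omega>\<^sub>0 (increment_generator s t \<union> {A \<in> sets W. measure W A = 0 \<or> measure W A = 1})"
  unfolding \<F>_def by (rule sets_measure_of) (use sets.sets_into_space[of _ W] in auto)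

lemma increment_generator_W: "increment_generator s t \<subseteq> sets W"
proof safe
  fix u v and A :: "real set" assume [measurable]: "A \<in> sets borel"
  have "{\<omega> \<in> space W. \<omega> v - \<omega> u \<in> A} \<in> sets W"
    by measurable
  then show "{\<omega> \<in> \<Omega>\<^sub>0. \<omega> v - \<omega> u \<in> A} \<in> sets W"
    by simp
qed

lemma sets_\<F>_subset: "sets (\<F> W s t) \<subseteq> sets W"
  unfolding sets_\<F> space_W[symmetric] using increment_generator_W
  by (intro sets.sigma_sets_subset) auto

lemma measurable_\<F>_W: "f \<in> \<F> W s t \<rightarrow>\<^sub>M N \<Longrightarrow> f \<in> W \<rightarrow>\<^sub>M N"
  using sets_\<F>_subset[of s t] by (auto simp: measurable_def)

lemma null_in_\<F>: "A \<in> null_sets W \<Longrightarrow> A \<in> sets (\<F> W s t)"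
  unfolding sets_\<F> by (rule sigma_sets.Basic) (auto simp: measure_eq_0_null_sets)

lemma \<F>_if_AE:
  assumes "AE \<omega> in W. Q \<omega>" shows "{\<omega> \<in> \<Omega>\<^sub>0. Q \<omega>} \<in> sets (\<F> W s t)"
proof -
  have "{\<omega> \<in> space W. \<not> Q \<omega>} \<in> null_sets W"
    using assms W.AE_iff_null_sets by blast
  then have "{\<omega> \<in> \<Omega>\<^sub>0. \<not> Q \<omega>} \<in> sets (\<F> W s t)"
    by (auto intro: null_in_\<F>)
  then have "space (\<F> W s t) - {\<omega> \<in> \<Omega>\<^sub>0. \<not> Q \<omega>} \<in> sets (\<F> W s t)"
    by (rule sets.compl_sets)
  also have "space (\<F> W s t) - {\<omega> \<in> \<Omega>\<^sub>0. \<not> Q \<omega>} = {\<omega> \<in> \<Omega>\<^sub>0. Q \<omega>}"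
    by auto
  finally show ?thesis .
qed

text \<open>Scaling by c multiplies an increment by c without moving its interval, and it preserves
  \<open>W\<close>, so events of probability 0 or 1 remain such.\<close>

lemma scale_\<F>:
  assumes c: "c = 1 \<or> c = (-1 :: real)"
  shows "(\<lambda>\<omega> t. c * \<omega> t) \<in> \<F> W s t \<rightarrow>\<^sub>M \<F> W s t"
proof -
  let ?G = "increment_generator s t \<union> {A \<in> sets W. measure W A = 0 \<or> measure W A = 1}"
  have "(\<lambda>\<omega> t. c * \<omega> t) \<in> \<F> W s t \<rightarrow>\<^sub>M sigma \<Omega>\<^sub>0 ?G"
  proof (rule measurable_measure_of)
    show "?G \<subseteq> Pow \<Omega>\<^sub>0"
      using sets.sets_into_space[of _ W] by auto
    show "(\<lambda>\<omega> t. c * \<omega> t) \<in> space (\<F> W s t) \<rightarrow> \<Omega>\<^sub>0"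
      by (auto intro: scale_\<Omega>\<^sub>0)
    fix a assume "a \<in> ?G"
    then show "(\<lambda>\<omega> t. c * \<omega> t) -` a \<inter> space (\<F> W s t) \<in> sets (\<F> W s t)"
    proof
      assume "a \<in> increment_generator s t"
      then obtain u v A where a: "a = {\<omega> \<in> \<Omega>\<^sub>0. \<omega> v - \<omega> u \<in> A}"
        "s \<le> ereal u" "u \<le> v" "ereal v \<le> t" "A \<in> sets borel"
        by blast
      have "(\<lambda>x. c * x) -` A \<inter> space borel \<in> sets borel"
        by (rule measurable_sets[OF _ a(5)]) measurable
      then have "{\<omega> \<in> \<Omega>\<^sub>0. \<omega> v - \<omega> u \<in> (\<lambda>x. c * x) -` A} \<in> increment_generator s t"
        using a unfolding mem_Collect_eq
        by (intro exI[of _ u] exI[of _ v] exI[of _ "(\<lambda>x. c * x) -` A"] conjI refl) auto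
      moreover have "(\<lambda>\<omega> t. c * \<omega> t) -` a \<inter> space (\<F> W s t) = {\<omega> \<in> \<Omega>\<^sub>0. \<omega> v - \<omega> u \<in> (\<lambda>x. c * x) -` A}"
        using a(1) scale_\<Omega>\<^sub>0[of _ c] by (auto simp: right_diff_distrib)
      ultimately show ?thesis
        by (simp add: sets_\<F> sigma_sets.Basic)
    next
      assume a: "a \<in> {A \<in> sets W. measure W A = 0 \<or> measure W A = 1}"
      note scale = scale_W[OF c]
      have "measure W ((\<lambda>\<omega> t. c * \<omega> t) -` a \<inter> space W) = measure W a"
        using a measure_distr[OF scale(1), of a] scale(2) by auto
      then have "(\<lambda>\<omega> t. c * \<omega> t) -` a \<inter> \<Omega>\<^sub>0 \<in> ?G"
        using measurable_sets[OF scale(1), of a] a by auto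
      then show ?thesis
        by (simp add: sets_\<F> sigma_sets.Basic)
    qed
  qed
  then show ?thesis
    by (simp add: \<F>_def)
qed

end

section \<open>The law of the signs\<close>

text \<open>By Fubini, a map that keeps the first coordinate and preserves the measure on every
  fibre preserves the product. It serves for changes of the coins that depend on the path:
  reindexing and flipping.\<close>

lemma distr_pair_fibrewise:
  assumes A: "sigma_finite_measure A" and C: "sigma_finite_measure C"
    and u: "(\<lambda>(\<omega>, b). u \<omega> b) \<in> A \<Otimes>\<^sub>M C \<rightarrow>\<^sub>M C"
    and d: "\<And>\<omega>. \<omega> \<in> space A \<Longrightarrow> distr C C (u \<omega>) = C"
  shows "(\<lambda>(\<omega>, b). (\<omega>, u \<omega> b)) \<in> A \<Otimes>\<^sub>M C \<rightarrow>\<^sub>M A \<Otimes>\<^sub>M C"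
    and "distr (A \<Otimes>\<^sub>M C) (A \<Otimes>\<^sub>M C) (\<lambda>(\<omega>, b). (\<omega>, u \<omega> b)) = A \<Otimes>\<^sub>M C"
proof -
  interpret C: sigma_finite_measure C by fact
  have "(\<lambda>x. (fst x, u (fst x) (snd x))) \<in> A \<Otimes>\<^sub>M C \<rightarrow>\<^sub>M A \<Otimes>\<^sub>M C"
    using u by (intro measurable_Pair) (auto simp: case_prod_beta')
  then show m: "(\<lambda>(\<omega>, b). (\<omega>, u \<omega> b)) \<in> A \<Otimes>\<^sub>M C \<rightarrow>\<^sub>M A \<Otimes>\<^sub>M C"
    by (simp add: case_prod_beta')
  show "distr (A \<Otimes>\<^sub>M C) (A \<Otimes>\<^sub>M C) (\<lambda>(\<omega>, b). (\<omega>, u \<omega> b)) = A \<Otimes>\<^sub>M C"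
  proof (rule measure_eqI)
    fix X assume "X \<in> sets (distr (A \<Otimes>\<^sub>M C) (A \<Otimes>\<^sub>M C) (\<lambda>(\<omega>, b). (\<omega>, u \<omega> b)))"
    then have X: "X \<in> sets (A \<Otimes>\<^sub>M C)"
      by simp
    let ?Y = "(\<lambda>(\<omega>, b). (\<omega>, u \<omega> b)) -` X \<inter> space (A \<Otimes>\<^sub>M C)"
    have "emeasure (distr (A \<Otimes>\<^sub>M C) (A \<Otimes>\<^sub>M C) (\<lambda>(\<omega>, b). (\<omega>, u \<omega> b))) X = emeasure (A \<Otimes>\<^sub>M C) ?Y"
      by (rule emeasure_distr[OF m X])
    also have "\<dots> = (\<integral>\<^sup>+\<omega>. emeasure C (Pair \<omega> -` ?Y) \<partial>A)"
      by (rule C.emeasure_pair_measure_alt) (rule measurable_sets[OF m X])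
    also have "\<dots> = (\<integral>\<^sup>+\<omega>. emeasure C (Pair \<omega> -` X) \<partial>A)"
    proof (rule nn_integral_cong)
      fix \<omega> assume \<omega>: "\<omega> \<in> space A"
      have "u \<omega> \<in> C \<rightarrow>\<^sub>M C"
        using measurable_compose[OF measurable_Pair1'[OF \<omega>] u] by simp
      then have "emeasure C (Pair \<omega> -` X) = emeasure C (u \<omega> -` (Pair \<omega> -` X) \<inter> space C)"
        using d[OF \<omega>] sets_Pair1[OF X] emeasure_distr by metis
      also have "u \<omega> -` (Pair \<omega> -` X) \<inter> space C = Pair \<omega> -` ?Y"
        using \<omega> by (auto simp: space_pair_measure)
      finally show "emeasure C (Pair \<omega> -` ?Y) = emeasure C (Pair \<omega> -` X)" ..
    qed
    also have "\<dots> = emeasure (A \<Otimes>\<^sub>M C) X"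
      by (rule C.emeasure_pair_measure_alt[OF X, symmetric])
    finally show "emeasure (distr (A \<Otimes>\<^sub>M C) (A \<Otimes>\<^sub>M C) (\<lambda>(\<omega>, b). (\<omega>, u \<omega> b))) X = emeasure (A \<Otimes>\<^sub>M C) X" .
  qed simp
qed

abbreviation coins :: "(nat \<Rightarrow> int) measure" where
  "coins \<equiv> \<Pi>\<^sub>M k\<in>UNIV. uniform_count_measure {-1, 1}"

lemma prob_space_coin: "prob_space (uniform_count_measure {-1, 1 :: int})"
  by (rule prob_space_uniform_count_measure) auto

lemma prob_space_coins: "prob_space coins"
  by (rule prob_space_PiM) (rule prob_space_coin)

lemma space_coins: "space coins = (UNIV \<rightarrow> {-1, 1})"
  by (auto simp: space_PiM space_uniform_count_measure)

lemma coin_component [measurable]: "(\<lambda>b. b k) \<in> coins \<rightarrow>\<^sub>M uniform_count_measure {-1, 1}"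
  by measurable

lemma distr_coins_reindex:
  assumes "inj \<tau>" shows "distr coins coins (\<lambda>b k. b (\<tau> k)) = coins"
  using distr_PiM_reindex[of UNIV "\<lambda>_. uniform_count_measure {-1, 1 :: int}" \<tau> UNIV] assms prob_space_coin
  by (simp add: restrict_def)

lemma flip_coin_measurable: "(\<lambda>b. b(k := - b k)) \<in> coins \<rightarrow>\<^sub>M coins"
proof (rule measurable_PiM_single')
  have neg: "uminus \<in> uniform_count_measure {-1, 1} \<rightarrow>\<^sub>M uniform_count_measure {-1, 1 :: int}"
    by (auto simp: measurable_def space_uniform_count_measure sets_uniform_count_measure)
  show "(\<lambda>b. (b(k := - b k)) i) \<in> coins \<rightarrow>\<^sub>M uniform_count_measure {-1, 1}" for i
    using measurable_compose[OF coin_component neg] by (cases "i = k") auto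
  show "(\<lambda>b. b(k := - b k)) \<in> space coins \<rightarrow> (\<Pi>\<^sub>E i\<in>UNIV. space (uniform_count_measure {-1, 1}))"
  proof (rule Pi_I)
    fix b assume "b \<in> space coins"
    then have "b i = -1 \<or> b i = 1" for i
      by (auto simp: space_coins)
    from this this[of k] have *: "(b(k := - b k)) i \<in> {-1, 1}" for i
      by auto
    show "b(k := - b k) \<in> (\<Pi>\<^sub>E i\<in>UNIV. space (uniform_count_measure {-1, 1}))"
      unfolding space_uniform_count_measure PiE_UNIV_domain by (intro Pi_I *)
  qed
qed

lemma distr_flip_coin: "distr coins coins (\<lambda>b. b(k := - b k)) = coins"
proof (rule measure_eqI_PiM_infinite[symmetric, OF refl])
  interpret prob_space coins
    by (rule prob_space_coins)
  show "finite_measure coins"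
    by (rule finite_measure_axioms)
  fix A :: "nat \<Rightarrow> int set" and J :: "nat set"
  assume J: "finite J" "J \<subseteq> UNIV" and A: "\<And>i. i \<in> J \<Longrightarrow> A i \<in> sets (uniform_count_measure {-1, 1})"
  \<comment> \<open>The preimage of a box under the flip is the box whose k-th side is reflected;
    reflection does not change the number of points in a side.\<close>
  define A' where "A' i = (if i = k then uminus ` A i else A i)" for i
  have A': "i \<in> J \<Longrightarrow> A' i \<in> sets (uniform_count_measure {-1, 1})" for i
    using A by (force simp: A'_def sets_uniform_count_measure)
  let ?E = "\<lambda>A. prod_emb UNIV (\<lambda>_. uniform_count_measure {-1, 1 :: int}) J (Pi\<^sub>E J A)"
  have "emeasure coins (?E A) = (\<Prod>j\<in>J. emeasure (uniform_count_measure {-1, 1}) (A j))"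
    using J A by (intro emeasure_PiM_emb prob_space_coin) auto
  also have "\<dots> = (\<Prod>j\<in>J. emeasure (uniform_count_measure {-1, 1}) (A' j))"
    using A A' by (intro prod.cong refl)
      (auto simp: emeasure_uniform_count_measure_if sets_uniform_count_measure A'_def card_image)
  also have "\<dots> = emeasure coins (?E A')"
    using J A' by (intro emeasure_PiM_emb[symmetric] prob_space_coin) auto
  also have "?E A' = (\<lambda>b. b(k := - b k)) -` ?E A \<inter> space coins"
  proof -
    have m: "x \<in> uminus ` X \<longleftrightarrow> - x \<in> X" for x and X :: "int set"
      by force
    show ?thesis
      using J by (auto simp: prod_emb_def space_PiM space_uniform_count_measure PiE_iff A'_def m split: if_splits)
  qed
  also have "emeasure coins \<dots> = emeasure (distr coins coins (\<lambda>b. b(k := - b k))) (?E A)"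
    using J A by (intro emeasure_distr[symmetric] flip_coin_measurable sets_PiM_I) auto
  finally show "emeasure coins (?E A) = emeasure (distr coins coins (\<lambda>b. b(k := - b k))) (?E A)" .
qed simp

section \<open>The probability space of a triplet\<close>

locale triplet = wiener +
  fixes M :: random_set and \<Omega>\<^sub>1 :: "(real \<Rightarrow> real) set" and S :: enumeration
  assumes admissible: "admissible_triplet W M \<Omega>\<^sub>1 S"
begin

abbreviation B where "B \<equiv> base_measure W \<Omega>\<^sub>1"
abbreviation Q where "Q \<equiv> \<P>_M W M \<Omega>\<^sub>1 S"
abbreviation \<Omega>M where "\<Omega>M \<equiv> \<Omega>_M M \<Omega>\<^sub>1"
abbreviation decode where "decode \<equiv> the_inv_into \<Omega>M (\<Theta> S)"
abbreviation E where "E \<equiv> embed_measure B decode"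

lemma \<Omega>\<^sub>1_sets: "\<Omega>\<^sub>1 \<in> sets W" and \<Omega>\<^sub>1_prob: "measure W \<Omega>\<^sub>1 = 1"
  and \<Omega>\<^sub>1_shift: "\<omega> \<in> \<Omega>\<^sub>0 \<Longrightarrow> \<Delta> h \<omega> \<in> \<Omega>\<^sub>1 \<longleftrightarrow> \<omega> \<in> \<Omega>\<^sub>1"
  and M_dense: "\<omega> \<in> \<Omega>\<^sub>1 \<Longrightarrow> closure (M \<omega>) = UNIV"
  and S_meas: "S k \<in> W \<rightarrow>\<^sub>M borel_dagger"
  and S_inj: "\<omega> \<in> \<Omega>\<^sub>1 \<Longrightarrow> inj (\<lambda>k. S k \<omega>)"
  and S_not_None: "\<omega> \<in> \<Omega>\<^sub>1 \<Longrightarrow> S k \<omega> \<noteq> None"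
  and M_eq: "\<omega> \<in> \<Omega>\<^sub>1 \<Longrightarrow> M \<omega> = real_values (\<lambda>k. S k \<omega>)"
  and M_stationary: "perfectly_stationary M" and M_local: "local_random_set W M"
  and M_countable: "\<omega> \<in> \<Omega>\<^sub>0 \<Longrightarrow> countable (M \<omega>)"
  using admissible by (auto simp: admissible_triplet_def measurable_enumeration_def)

lemma \<Omega>\<^sub>1_subset: "\<Omega>\<^sub>1 \<subseteq> \<Omega>\<^sub>0"
  using sets.sets_into_space[OF \<Omega>\<^sub>1_sets] by simp

lemma AE_\<Omega>\<^sub>1: "AE \<omega> in W. \<omega> \<in> \<Omega>\<^sub>1"
  using \<Omega>\<^sub>1_prob by (intro W.AE_prob_1) (auto simp: W.prob_eq_1 \<Omega>\<^sub>1_sets)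

lemma Some_S: "\<omega> \<in> \<Omega>\<^sub>1 \<Longrightarrow> Some (the (S k \<omega>)) = S k \<omega>"
  using S_not_None by simp

lemma S_in_M: "\<omega> \<in> \<Omega>\<^sub>1 \<Longrightarrow> the (S k \<omega>) \<in> M \<omega>"
  using Some_S by (auto simp: M_eq real_values_def)

lemma prob_space_restrict: "prob_space (restrict_space W \<Omega>\<^sub>1)"
  using \<Omega>\<^sub>1_prob \<Omega>\<^sub>1_sets
  by (intro prob_spaceI) (simp add: emeasure_restrict_space space_restrict_space W.emeasure_eq_measure Int_absorb2 \<Omega>\<^sub>1_subset)

sublocale R: prob_space "restrict_space W \<Omega>\<^sub>1"
  by (rule prob_space_restrict)

sublocale C: prob_space coins
  by (rule prob_space_coins)

lemma B_eq: "B = restrict_space W \<Omega>\<^sub>1 \<Otimes>\<^sub>M coins"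
  by (simp add: base_measure_def)

lemma space_B: "space B = \<Omega>\<^sub>1 \<times> (UNIV \<rightarrow> {-1, 1})"
  using \<Omega>\<^sub>1_subset by (auto simp: B_eq space_pair_measure space_restrict_space space_coins)

sublocale B: pair_prob_space "restrict_space W \<Omega>\<^sub>1" coins
  by unfold_locales

lemma prob_B: "prob_space B"
  unfolding B_eq by (rule B.prob_space_axioms)

lemma fst_\<Theta> [simp]: "fst (\<Theta> S' x) = fst x" and snd_\<Theta> [simp]: "snd (\<Theta> S' x) k = snd x (the (S' k (fst x)))"
  by (auto simp: \<Theta>_def split_beta)

lemma \<Omega>M_iff: "x \<in> \<Omega>M \<longleftrightarrow> fst x \<in> \<Omega>\<^sub>1 \<and> snd x \<in> M (fst x) \<rightarrow>\<^sub>E {-1, 1}"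
  by (cases x) (auto simp: \<Omega>_M_def)

lemma fst_\<Omega>M: "x \<in> \<Omega>M \<Longrightarrow> fst x \<in> \<Omega>\<^sub>1" "x \<in> \<Omega>M \<Longrightarrow> fst x \<in> \<Omega>\<^sub>0"
  using \<Omega>\<^sub>1_subset by (auto simp: \<Omega>M_iff)

lemma sign_cases: "x \<in> \<Omega>M \<Longrightarrow> r \<in> M (fst x) \<Longrightarrow> snd x r = -1 \<or> snd x r = 1"
  by (auto simp: \<Omega>M_iff PiE_iff)

lemma \<Theta>_inj: "inj_on (\<Theta> S) \<Omega>M"
proof (rule inj_onI)
  fix x y assume x: "x \<in> \<Omega>M" and y: "y \<in> \<Omega>M" and eq: "\<Theta> S x = \<Theta> S y"
  have f: "fst x = fst y"
    using eq by (metis fst_\<Theta>)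
  have "snd x = snd y"
  proof
    fix r show "snd x r = snd y r"
    proof (cases "r \<in> M (fst x)")
      case True
      then obtain k where "S k (fst x) = Some r"
        using M_eq fst_\<Omega>M(1)[OF x] by (auto simp: real_values_def)
      then show ?thesis
        using snd_\<Theta>[of S x k] snd_\<Theta>[of S y k] eq f by simp
    next
      case False
      then show ?thesis
        using x y f by (auto simp: \<Omega>M_iff PiE_iff extensional_def)
    qed
  qed
  then show "x = y"
    using f by (simp add: prod_eq_iff)
qed

lemma \<Theta>_image: "\<Theta> S ` \<Omega>M = space B"
proof
  show "\<Theta> S ` \<Omega>M \<subseteq> space B"
  proof
    fix z assume "z \<in> \<Theta> S ` \<Omega>M"
    then obtain x where x: "x \<in> \<Omega>M" "z = \<Theta> S x"
      by auto
    have "snd z k \<in> {-1, 1}" for k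
      using sign_cases[OF x(1) S_in_M[OF fst_\<Omega>M(1)[OF x(1)], of k]] x(2) by auto
    moreover have "fst z \<in> \<Omega>\<^sub>1"
      using x fst_\<Omega>M by simp
    ultimately show "z \<in> space B"
      by (cases z) (auto simp: space_B)
  qed
  show "space B \<subseteq> \<Theta> S ` \<Omega>M"
  proof
    fix z assume "z \<in> space B"
    then obtain \<omega> b where z: "z = (\<omega>, b)" "\<omega> \<in> \<Omega>\<^sub>1" "b \<in> UNIV \<rightarrow> {-1, 1}"
      by (auto simp: space_B)
    \<comment> \<open>The sign at a point is the coin whose number is the index of that point in
      \<open>S\<close>.\<close>
    define \<eta> where "\<eta> = (\<lambda>r\<in>M \<omega>. b (inv (\<lambda>k. S k \<omega>) (Some r)))"
    have k: "\<eta> (the (S k \<omega>)) = b k" for k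
      using S_in_M[OF z(2), of k] Some_S[OF z(2), of k] inv_f_f[OF S_inj[OF z(2)], of k]
      by (simp add: \<eta>_def)
    then have "\<Theta> S (\<omega>, \<eta>) = z"
      using z by (simp add: \<Theta>_def)
    moreover have "(\<omega>, \<eta>) \<in> \<Omega>M"
      using z by (auto simp: \<Omega>M_iff \<eta>_def)
    ultimately show "z \<in> \<Theta> S ` \<Omega>M"
      by (metis image_eqI)
  qed
qed

lemma \<Theta>_decode: "z \<in> space B \<Longrightarrow> \<Theta> S (decode z) = z"
  using \<Theta>_inj \<Theta>_image by (simp add: f_the_inv_into_f)

lemma decode_\<Theta>: "x \<in> \<Omega>M \<Longrightarrow> decode (\<Theta> S x) = x"
  using \<Theta>_inj by (simp add: the_inv_into_f_f)

lemma decode_inj: "inj_on decode (space B)"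
  by (rule inj_onI) (metis \<Theta>_decode)

lemma decode_image: "decode ` space B = \<Omega>M"
  using \<Theta>_inj by (simp add: \<Theta>_image[symmetric] inj_on_the_inv_into the_inv_into_onto)

lemma Q_eq: "Q = completion E"
  by (simp add: \<P>_M_def)

lemma space_E: "space E = \<Omega>M"
  by (simp add: space_embed_measure decode_image)

lemma space_Q [simp]: "space Q = \<Omega>M"
  by (simp add: Q_eq space_E)

lemma E_eq_distr: "E = distr B E decode"
  by (rule embed_measure_eq_distr'[OF decode_inj])

lemma decode_measurable: "decode \<in> B \<rightarrow>\<^sub>M E"
  by (rule measurable_embed_measure2'[OF decode_inj])

lemma prob_E: "prob_space E"
  using prob_space.prob_space_distr[OF prob_B decode_measurable] E_eq_distr by simp

sublocale Q: prob_space Q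
  unfolding Q_eq by (rule prob_spaceI) (use prob_space.emeasure_space_1[OF prob_E] in simp)

sublocale Q: complete_measure Q
  unfolding Q_eq by unfold_locales

lemma measurable_E:
  assumes "(\<lambda>z. h (decode z)) \<in> B \<rightarrow>\<^sub>M N" shows "h \<in> E \<rightarrow>\<^sub>M N" "distr E N h = distr B N (\<lambda>z. h (decode z))"
proof -
  show m: "h \<in> E \<rightarrow>\<^sub>M N"
    using assms by (rule measurable_embed_measure1)
  have "distr E N h = distr (distr B E decode) N h"
    using E_eq_distr by simp
  then show "distr E N h = distr B N (\<lambda>z. h (decode z))"
    by (simp add: distr_distr[OF m decode_measurable] comp_def)
qed

lemma measurable_Q:
  assumes "(\<lambda>z. h (decode z)) \<in> B \<rightarrow>\<^sub>M N" shows "h \<in> Q \<rightarrow>\<^sub>M N" "distr Q N h = distr B N (\<lambda>z. h (decode z))"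
  using measurable_E[OF assms] by (simp_all add: Q_eq measurable_completion distr_completion)

lemma \<Theta>_measurable: "\<Theta> S \<in> Q \<rightarrow>\<^sub>M B" and distr_\<Theta>: "distr Q B (\<Theta> S) = B"
proof -
  have id: "(\<lambda>z. \<Theta> S (decode z)) \<in> B \<rightarrow>\<^sub>M B"
    by (subst measurable_cong[OF \<Theta>_decode]) auto
  show "\<Theta> S \<in> Q \<rightarrow>\<^sub>M B"
    by (rule measurable_Q[OF id])
  have "distr Q B (\<Theta> S) = distr B B (\<lambda>z. \<Theta> S (decode z))"
    by (rule measurable_Q[OF id])
  also have "\<dots> = distr B B (\<lambda>z. z)"
    by (rule distr_cong) (auto simp: \<Theta>_decode)
  finally show "distr Q B (\<Theta> S) = B"
    by simp
qed

lemma sets_E: "D \<in> sets E \<Longrightarrow> \<exists>D'\<in>sets B. D = \<Theta> S -` D' \<inter> \<Omega>M"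
proof -
  assume D: "D \<in> sets E"
  have "D = \<Theta> S -` (decode -` D \<inter> space B) \<inter> \<Omega>M"
  proof (rule set_eqI)
    fix x
    show "x \<in> D \<longleftrightarrow> x \<in> \<Theta> S -` (decode -` D \<inter> space B) \<inter> \<Omega>M"
      using sets.sets_into_space[OF D] \<Theta>_image decode_\<Theta>[of x]
      by (cases "x \<in> \<Omega>M") (auto simp: space_E simp del: split_paired_All split_paired_Ex)
  qed
  then show ?thesis
    using measurable_sets[OF decode_measurable D] by blast
qed

text \<open>\<open>\<Theta> S\<close> is a bijection onto the space of \<open>B\<close>, and
  \<open>Q\<close> is the completed pull-back along it. It therefore suffices to look at the
  composite with \<open>\<Theta> S\<close>; completeness of \<open>L\<close> takes care of the null
  sets added by the completion.\<close>

lemma measure_preserving_Q: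
  assumes L: "complete_measure L" and \<phi>: "\<And>x. x \<in> space L \<Longrightarrow> \<phi> x \<in> \<Omega>M"
    and m: "(\<lambda>x. \<Theta> S (\<phi> x)) \<in> L \<rightarrow>\<^sub>M B" and d: "distr L B (\<lambda>x. \<Theta> S (\<phi> x)) = B"
  shows "\<phi> \<in> L \<rightarrow>\<^sub>M Q" and "distr L Q \<phi> = Q"
proof -
  interpret L: complete_measure L by fact
  have pre: "\<phi> -` (\<Theta> S -` D' \<inter> \<Omega>M) \<inter> space L = (\<lambda>x. \<Theta> S (\<phi> x)) -` D' \<inter> space L" for D'
    using \<phi> by auto
  have mE: "\<phi> \<in> L \<rightarrow>\<^sub>M E"
  proof (rule measurableI)
    fix D assume "D \<in> sets E"
    then obtain D' where D': "D' \<in> sets B" "D = \<Theta> S -` D' \<inter> \<Omega>M"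
      using sets_E by blast
    show "\<phi> -` D \<inter> space L \<in> sets L"
      unfolding D'(2) pre by (rule measurable_sets[OF m D'(1)])
  qed (use \<phi> in \<open>simp add: space_E\<close>)
  have dE: "distr L E \<phi> = E"
  proof (rule measure_eqI)
    fix D assume "D \<in> sets (distr L E \<phi>)"
    then have D: "D \<in> sets E"
      by simp
    then obtain D' where D': "D' \<in> sets B" "D = \<Theta> S -` D' \<inter> \<Omega>M"
      using sets_E by blast
    have "emeasure (distr L E \<phi>) D = emeasure L ((\<lambda>x. \<Theta> S (\<phi> x)) -` D' \<inter> space L)"
      using emeasure_distr[OF mE D] by (simp only: D'(2) pre)
    also have "\<dots> = emeasure B D'"
      using emeasure_distr[OF m D'(1)] d by simp
    also have "\<dots> = emeasure Q D"
      using emeasure_distr[OF \<Theta>_measurable D'(1)] distr_\<Theta> D' by simp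
    also have "\<dots> = emeasure E D"
      using D by (simp add: Q_eq)
    finally show "emeasure (distr L E \<phi>) D = emeasure E D" .
  qed simp
  show "\<phi> \<in> L \<rightarrow>\<^sub>M Q" and "distr L Q \<phi> = Q"
    using L.distr_completion_eqI[OF mE dE] by (simp_all add: Q_eq)
qed

text \<open>Reading the signs along \<open>S'\<close> amounts to reindexing the coins by
  \<open>\<tau> \<omega>\<close>, where \<open>\<tau> \<omega> k\<close> is the index in
  \<open>S\<close> of the k-th point of \<open>S'\<close>. This is injective for every path, so it
  preserves the law of the coins fibrewise. \<open>S'\<close> may list only some of the points,
  which is what makes the lemma apply to local enumerations.\<close>

lemma \<Theta>_other_enumeration:
  assumes m: "\<And>k. S' k \<in> W \<rightarrow>\<^sub>M borel_dagger"
    and S': "\<And>\<omega>. \<omega> \<in> \<Omega>\<^sub>1 \<Longrightarrow> inj (\<lambda>k. S' k \<omega>)" "\<And>\<omega> k. \<omega> \<in> \<Omega>\<^sub>1 \<Longrightarrow> S' k \<omega> \<in> Some ` M \<omega>"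
  shows "\<Theta> S' \<in> Q \<rightarrow>\<^sub>M B" and "distr Q B (\<Theta> S') = B"
proof -
  define \<tau> where "\<tau> \<omega> k = inv (\<lambda>j. S j \<omega>) (S' k \<omega>)" for \<omega> k
  have ex: "\<exists>j. S j \<omega> = S' k \<omega>" if "\<omega> \<in> \<Omega>\<^sub>1" for \<omega> k
    using S'(2)[OF that, of k] M_eq[OF that] by (auto simp: real_values_def)
  have \<tau>: "S (\<tau> \<omega> k) \<omega> = S' k \<omega>" if "\<omega> \<in> \<Omega>\<^sub>1" for \<omega> k
  proof -
    have "S' k \<omega> \<in> range (\<lambda>j. S j \<omega>)"
      using ex[OF that, of k] by (metis rangeI)
    from f_inv_into_f[OF this] show ?thesis
      by (simp add: \<tau>_def)
  qed
  have \<tau>_inj: "inj (\<tau> \<omega>)" if "\<omega> \<in> \<Omega>\<^sub>1" for \<omega>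
    using S'(1)[OF that] \<tau>[OF that] by (auto simp: inj_def) metis
  have \<tau>_iff: "\<tau> \<omega> k = j \<longleftrightarrow> S j \<omega> = S' k \<omega>" if "\<omega> \<in> \<Omega>\<^sub>1" for \<omega> k j
    using \<tau>[OF that, of k] inj_eq[OF S_inj[OF that], of "\<tau> \<omega> k" j] by auto
  have \<tau>_m: "(\<lambda>\<omega>. \<tau> \<omega> k) \<in> restrict_space W \<Omega>\<^sub>1 \<rightarrow>\<^sub>M count_space UNIV" for k
  proof (rule measurable_count_space_eq2_countable[THEN iffD2], intro conjI ballI)
    fix j :: nat
    have "(\<lambda>\<omega>. \<tau> \<omega> k) -` {j} \<inter> space (restrict_space W \<Omega>\<^sub>1) = {\<omega> \<in> space W. S j \<omega> = S' k \<omega>} \<inter> \<Omega>\<^sub>1"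
      using \<tau>_iff \<Omega>\<^sub>1_subset by (auto simp: space_restrict_space)
    also have "\<dots> \<in> sets (restrict_space W \<Omega>\<^sub>1)"
      using borel_dagger_eq[OF S_meas m] \<Omega>\<^sub>1_sets by (auto simp: sets_restrict_space_iff Int_absorb2[OF \<Omega>\<^sub>1_subset])
    finally show "(\<lambda>\<omega>. \<tau> \<omega> k) -` {j} \<inter> space (restrict_space W \<Omega>\<^sub>1) \<in> sets (restrict_space W \<Omega>\<^sub>1)" .
  qed auto
  have u: "(\<lambda>(\<omega>, b). \<lambda>k. b (\<tau> \<omega> k)) \<in> restrict_space W \<Omega>\<^sub>1 \<Otimes>\<^sub>M coins \<rightarrow>\<^sub>M coins"
    unfolding case_prod_beta'
  proof (rule measurable_PiM_single')
    fix k
    show "(\<lambda>z. snd z (\<tau> (fst z) k)) \<in> restrict_space W \<Omega>\<^sub>1 \<Otimes>\<^sub>M coins \<rightarrow>\<^sub>M uniform_count_measure {-1, 1}"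
    proof (rule measurable_compose_countable[where f="\<lambda>j z. snd z j" and g="\<lambda>z. \<tau> (fst z) k"])
      show "(\<lambda>z. \<tau> (fst z) k) \<in> restrict_space W \<Omega>\<^sub>1 \<Otimes>\<^sub>M coins \<rightarrow>\<^sub>M count_space UNIV"
        by (rule measurable_compose[OF measurable_fst \<tau>_m])
    qed (rule measurable_compose[OF measurable_snd coin_component])
  qed (auto simp: space_pair_measure space_coins space_uniform_count_measure Pi_iff)
  have d: "distr coins coins (\<lambda>b k. b (\<tau> \<omega> k)) = coins" if "\<omega> \<in> space (restrict_space W \<Omega>\<^sub>1)" for \<omega>
    using that by (intro distr_coins_reindex \<tau>_inj) (simp add: space_restrict_space)
  note fib = distr_pair_fibrewise[OF R.sigma_finite_measure_axioms C.sigma_finite_measure_axioms u d,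
      folded B_eq]
  have eq: "\<Theta> S' (decode z) = (case z of (\<omega>, b) \<Rightarrow> (\<omega>, \<lambda>k. b (\<tau> \<omega> k)))" if z: "z \<in> space B" for z
  proof -
    obtain \<omega> b where zz: "z = (\<omega>, b)" "\<omega> \<in> \<Omega>\<^sub>1"
      using z by (auto simp: space_B)
    have f: "fst (decode z) = \<omega>"
      using \<Theta>_decode[OF z] zz by (metis fst_\<Theta> fst_conv)
    have "snd (decode z) (the (S j \<omega>)) = snd (\<Theta> S (decode z)) j" for j
      by (simp add: f)
    then have "snd (decode z) (the (S j \<omega>)) = b j" for j
      by (simp only: \<Theta>_decode[OF z]) (simp add: zz)
    then have "snd (\<Theta> S' (decode z)) k = b (\<tau> \<omega> k)" for k
      by (simp add: f \<tau>[OF zz(2), symmetric])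
    then have "snd (\<Theta> S' (decode z)) = (\<lambda>k. b (\<tau> \<omega> k))"
      by (rule ext)
    then have "\<Theta> S' (decode z) = (\<omega>, \<lambda>k. b (\<tau> \<omega> k))"
      using f by (intro prod_eqI) (simp_all del: snd_\<Theta>)
    then show ?thesis
      by (simp only: zz(1) split)
  qed
  have m': "(\<lambda>z. \<Theta> S' (decode z)) \<in> B \<rightarrow>\<^sub>M B"
    using fib(1) by (subst measurable_cong[OF eq])
  show "\<Theta> S' \<in> Q \<rightarrow>\<^sub>M B"
    by (rule measurable_Q[OF m'])
  have "distr Q B (\<Theta> S') = distr B B (\<lambda>z. \<Theta> S' (decode z))"
    by (rule measurable_Q[OF m'])
  also have "\<dots> = distr B B (\<lambda>(\<omega>, b). (\<omega>, \<lambda>k. b (\<tau> \<omega> k)))"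
    by (rule distr_cong) (use eq in auto)
  finally show "distr Q B (\<Theta> S') = B"
    using fib(2) by simp
qed

text \<open>The coins integrate out, and \<open>\<Omega>\<^sub>1\<close> has full measure, so
  restricting \<open>W\<close> to it and mapping back changes nothing.\<close>

lemma fst_measurable: "fst \<in> Q \<rightarrow>\<^sub>M W" and distr_fst: "distr Q W fst = W"
proof -
  have id: "(\<lambda>\<omega>. \<omega>) \<in> restrict_space W \<Omega>\<^sub>1 \<rightarrow>\<^sub>M W"
    by (rule measurable_restrict_space1) auto
  have f: "fst \<in> B \<rightarrow>\<^sub>M W"
    unfolding B_eq by (rule measurable_compose[OF measurable_fst id])
  have eq: "(\<lambda>x. fst (\<Theta> S x)) = fst"
    by (rule ext) simp
  show "fst \<in> Q \<rightarrow>\<^sub>M W"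
    using measurable_compose[OF \<Theta>_measurable f] unfolding eq .
  have "distr Q W fst = distr B W fst"
    using distr_distr[OF f \<Theta>_measurable] by (simp add: distr_\<Theta> comp_def eq)
  also have "\<dots> = distr (distr B (restrict_space W \<Omega>\<^sub>1) fst) W (\<lambda>\<omega>. \<omega>)"
    unfolding B_eq by (subst distr_distr[OF id measurable_fst]) (simp add: comp_def)
  also have "distr B (restrict_space W \<Omega>\<^sub>1) fst = restrict_space W \<Omega>\<^sub>1"
    unfolding B_eq by (rule C.distr_pair_fst)
  also have "distr (restrict_space W \<Omega>\<^sub>1) W (\<lambda>\<omega>. \<omega>) = W"
  proof (rule measure_eqI)
    fix A assume "A \<in> sets (distr (restrict_space W \<Omega>\<^sub>1) W (\<lambda>\<omega>. \<omega>))"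
    then have A: "A \<in> sets W"
      by simp
    have "emeasure (distr (restrict_space W \<Omega>\<^sub>1) W (\<lambda>\<omega>. \<omega>)) A = emeasure (restrict_space W \<Omega>\<^sub>1) (A \<inter> \<Omega>\<^sub>1)"
      using A \<Omega>\<^sub>1_subset by (subst emeasure_distr[OF id A]) (simp add: space_restrict_space Int_absorb2)
    also have "\<dots> = emeasure W (A \<inter> \<Omega>\<^sub>1)"
      using \<Omega>\<^sub>1_sets A \<Omega>\<^sub>1_subset by (subst emeasure_restrict_space) (auto simp: Int_absorb2)
    also have "\<dots> = emeasure W A"
      using AE_\<Omega>\<^sub>1 A \<Omega>\<^sub>1_sets by (intro emeasure_eq_AE) auto
    finally show "emeasure (distr (restrict_space W \<Omega>\<^sub>1) W (\<lambda>\<omega>. \<omega>)) A = emeasure W A" .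
  qed simp
  finally show "distr Q W fst = W" .
qed

lemma AE_Q_fst: "AE \<omega> in W. R \<omega> \<Longrightarrow> AE x in Q. R (fst x)"
  by (rule AE_distrD[OF fst_measurable]) (simp only: distr_fst)

lemma AE_Q_fstD:
  assumes "AE x in Q. R (fst x)" "{\<omega> \<in> \<Omega>\<^sub>0. R \<omega>} \<in> sets W"
  shows "AE \<omega> in W. R \<omega>"
proof -
  have "AE \<omega> in distr Q W fst. R \<omega>"
    using AE_distr_iff[OF fst_measurable, of R] assms by simp
  then show ?thesis
    by (simp only: distr_fst)
qed

lemma AE_Q_\<Omega>M: "AE x in Q. x \<in> \<Omega>M"
  using AE_space[of Q] by simp

end

section \<open>Local enumerations and local fields\<close>

lemma ereal_interval_open: "open (ereal_interval s t)"
proof -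
  have "ereal_interval s t = ereal -` {s<..<t}"
    by (auto simp: ereal_interval_def)
  then show ?thesis
    by (simp add: open_vimage continuous_on_ereal)
qed

lemma ereal_interval_sets [measurable]: "ereal_interval s t \<in> sets borel"
  using ereal_interval_open by auto

lemma infinite_ereal_interval:
  assumes "s < t" shows "infinite (ereal_interval s t)"
proof -
  obtain a where a: "s < ereal a" "ereal a < t"
    using ereal_dense2[OF assms] by blast
  obtain b where b: "ereal a < ereal b" "ereal b < t"
    using ereal_dense2[OF a(2)] by blast
  have "{a..b} \<subseteq> ereal_interval s t"
    using a b by (auto simp: ereal_interval_def intro: less_le_trans le_less_trans[of _ "ereal b"])
  then show ?thesis
    by (rule infinite_super) (use b(1) in \<open>simp add: infinite_Icc\<close>)
qed

text \<open>If the intersection were finite, removing it from \<open>U\<close> would leave a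
  nonempty open set that misses the dense set.\<close>

lemma infinite_dense_Int_open:
  fixes D U :: "real set"
  assumes D: "closure D = UNIV" and U: "open U" "infinite U"
  shows "infinite (D \<inter> U)"
proof
  assume f: "finite (D \<inter> U)"
  have "open (U - (D \<inter> U))"
    using U f by (intro open_Diff finite_imp_closed)
  moreover have "U - (D \<inter> U) \<noteq> {}"
    using U(2) f finite_subset[of U "D \<inter> U"] by blast
  ultimately have "D \<inter> (U - (D \<inter> U)) \<noteq> {}"
    using open_Int_closure_eq_empty[of "U - (D \<inter> U)" D] D by auto
  then show False
    by auto
qed

text \<open>\<open>W\<close> is complete and the local fields contain all its null sets, so a
  modification on a null set stays adapted.\<close>

lemma measurable_\<F>_AE:
  assumes "wiener P W" and f: "f \<in> \<F> W s t \<rightarrow>\<^sub>M N" and ae: "AE \<omega> in W. f \<omega> = g \<omega>"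
    and g: "\<And>\<omega>. \<omega> \<in> \<Omega>\<^sub>0 \<Longrightarrow> g \<omega> \<in> space N"
  shows "g \<in> \<F> W s t \<rightarrow>\<^sub>M N"
proof -
  interpret wiener P W by fact
  let ?G = "{\<omega> \<in> \<Omega>\<^sub>0. f \<omega> = g \<omega>}"
  have G: "?G \<in> sets (\<F> W s t)"
    by (rule \<F>_if_AE[OF ae])
  show ?thesis
  proof (rule measurableI)
    fix A assume A: "A \<in> sets N"
    have "{\<omega> \<in> space W. f \<omega> \<noteq> g \<omega>} \<in> null_sets W"
      using ae by (rule iffD1[OF W.AE_iff_null_sets])
    then have "{\<omega> \<in> space W. f \<omega> \<noteq> g \<omega>} \<inter> g -` A \<in> null_sets W"
      by (rule W.complete2[rotated]) auto
    then have "(f -` A \<inter> space (\<F> W s t)) \<inter> ?G \<union> ({\<omega> \<in> space W. f \<omega> \<noteq> g \<omega>} \<inter> g -` A) \<in> sets (\<F> W s t)"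
      by (intro sets.Un[OF sets.Int[OF measurable_sets[OF f A] G]] null_in_\<F>)
    also have "(f -` A \<inter> space (\<F> W s t)) \<inter> ?G \<union> ({\<omega> \<in> space W. f \<omega> \<noteq> g \<omega>} \<inter> g -` A) = g -` A \<inter> space (\<F> W s t)"
      by auto
    finally show "g -` A \<inter> space (\<F> W s t) \<in> sets (\<F> W s t)" .
  qed (use g in auto)
qed

text \<open>The index of the k-th first occurrence of a real value in \<open>T\<close>; repetitions
  and \<open>None\<close> are skipped. Written with \<open>LEAST\<close> so that measurability in
  \<open>T\<close> follows by induction on k.\<close>

primrec nth_new :: "(nat \<Rightarrow> 'a option) \<Rightarrow> nat \<Rightarrow> nat" where
  "nth_new T 0 = (LEAST i. T i \<noteq> None \<and> (\<forall>j<i. T j \<noteq> T i))"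
| "nth_new T (Suc k) = (LEAST i. (T i \<noteq> None \<and> (\<forall>j<i. T j \<noteq> T i)) \<and> nth_new T k < i)"

text \<open>The set \<open>K\<close> of first occurrences is infinite because \<open>T\<close> has
  infinitely many real values; \<open>nth_new T\<close> enumerates \<open>K\<close> in increasing
  order, and \<open>T\<close> maps \<open>K\<close> injectively onto the real values.\<close>

lemma nth_new:
  assumes inf: "infinite {x. \<exists>i. T i = Some x}"
  shows "inj (\<lambda>k. T (nth_new T k))" and "range (\<lambda>k. T (nth_new T k)) = range T - {None}"
proof -
  define K where "K = {i. T i \<noteq> None \<and> (\<forall>j<i. T j \<noteq> T i)}"
  have first: "\<exists>i\<in>K. T i = Some x" if "T j = Some x" for x j
  proof -
    define i where "i = (LEAST i. T i = Some x)"
    have i: "T i = Some x"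
      unfolding i_def by (rule LeastI[of "\<lambda>i. T i = Some x", OF that])
    have "\<forall>j<i. T j \<noteq> Some x"
      unfolding i_def using not_less_Least by blast
    then have "i \<in> K"
      by (simp add: K_def i)
    then show ?thesis
      using i by (rule bexI[rotated])
  qed
  have "{x. \<exists>i. T i = Some x} \<subseteq> (\<lambda>i. the (T i)) ` K"
  proof
    fix x assume "x \<in> {x. \<exists>i. T i = Some x}"
    then obtain j where "T j = Some x"
      by auto
    from first[OF this] obtain i where i: "i \<in> K" "T i = Some x"
      by auto
    then have "x = the (T i)"
      by simp
    then show "x \<in> (\<lambda>i. the (T i)) ` K"
      using i(1) by (rule image_eqI)
  qed
  then have K: "infinite K"
    using inf finite_surj[of K] by auto
  have eq: "nth_new T k = enumerate K k" for k
  proof (induction k)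
    case 0
    show ?case
      by (simp add: enumerate_0 K_def)
  next
    case (Suc k)
    then show ?case
      by (subst enumerate_Suc''[OF K]) (simp add: K_def)
  qed
  have inj: "inj_on T K"
  proof (rule inj_onI)
    fix i j assume "i \<in> K" "j \<in> K" "T i = T j"
    then show "i = j"
      unfolding K_def by (cases i j rule: linorder_cases) auto
  qed
  have r: "range (enumerate K) = K"
    by (rule range_enumerate[OF K])
  show "inj (\<lambda>k. T (nth_new T k))"
  proof (rule injI)
    fix k l assume "T (nth_new T k) = T (nth_new T l)"
    then have "enumerate K k = enumerate K l"
      unfolding eq by (rule inj_onD[OF inj _ enumerate_in_set[OF K] enumerate_in_set[OF K]])
    then show "k = l"
      using strict_mono_eq[OF strict_mono_enumerate[OF K]] by simp
  qed
  have "range (\<lambda>k. T (nth_new T k)) = T ` K"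
    unfolding eq by (subst r[symmetric]) auto
  also have "\<dots> = range T - {None}"
  proof (intro equalityI subsetI)
    fix z assume "z \<in> range T - {None}"
    then obtain i y where "T i = Some y" "z = Some y"
      by auto
    then show "z \<in> T ` K"
      using first[of i y] by (metis image_eqI)
  qed (auto simp: K_def)
  finally show "range (\<lambda>k. T (nth_new T k)) = range T - {None}" .
qed

lemma nth_new_measurable:
  assumes T: "\<And>i. T i \<in> A \<rightarrow>\<^sub>M borel_dagger"
  shows "(\<lambda>x. nth_new (\<lambda>i. T i x) k) \<in> A \<rightarrow>\<^sub>M count_space UNIV"
proof -
  have [measurable]: "Measurable.pred A (\<lambda>x. T i x = None)" for i
    using borel_daggerD(2)[OF T] by (simp add: pred_def)
  have [measurable]: "Measurable.pred A (\<lambda>x. T i x = T j x)" for i j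
    using borel_dagger_eq[OF T T] by (simp add: pred_def)
  show ?thesis
  proof (induction k)
    case 0
    show ?case
      unfolding nth_new.simps by (intro measurable_Least) measurable
  next
    case (Suc k)
    note [measurable] = Suc.IH
    show ?case
      unfolding nth_new.simps by (intro measurable_Least) measurable
  qed
qed

context triplet
begin

text \<open>Locality provides an adapted list that may repeat points, take the value
  \<open>None\<close> and be wrong on a null set. Thinning by \<open>nth_new\<close> removes the
  first two defects; it never runs out because a dense set meets an open interval in infinitely many
  points.\<close>

lemma ex_local_enumeration:
  assumes st: "s < t"
  shows "\<exists>R. local_enumeration W M \<Omega>\<^sub>1 s t R"
proof -
  let ?I = "ereal_interval s t"
  obtain T where T: "\<And>k. T k \<in> \<F> W s t \<rightarrow>\<^sub>M borel_dagger" "AE \<omega> in W. M \<omega> \<inter> ?I = real_values (\<lambda>k. T k \<omega>)"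
    using M_local st unfolding local_random_set_def measurable_enumeration_def by blast
  define good where "good \<omega> \<longleftrightarrow> \<omega> \<in> \<Omega>\<^sub>1 \<and> M \<omega> \<inter> ?I = real_values (\<lambda>k. T k \<omega>)" for \<omega>
  have good: "AE \<omega> in W. good \<omega>"
    using T(2) AE_\<Omega>\<^sub>1 by eventually_elim (simp add: good_def)
  define R0 where "R0 k \<omega> = T (nth_new (\<lambda>i. T i \<omega>) k) \<omega>" for k \<omega>
  \<comment> \<open>Where the list is wrong, any enumeration of the countably infinite set is put
    in. This repairs every path of \<open>\<Omega>\<^sub>1\<close> and changes \<open>R0\<close> on
    a null set only.\<close>
  define R where "R k \<omega> = (if good \<omega> then R0 k \<omega> else Some (from_nat_into (M \<omega> \<inter> ?I) k))" for k \<omega>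
  have inf: "infinite (M \<omega> \<inter> ?I)" if "\<omega> \<in> \<Omega>\<^sub>1" for \<omega>
    by (rule infinite_dense_Int_open[OF M_dense[OF that] ereal_interval_open infinite_ereal_interval[OF st]])
  have R: "inj (\<lambda>k. R k \<omega>) \<and> range (\<lambda>k. R k \<omega>) = Some ` (M \<omega> \<inter> ?I)" if w: "\<omega> \<in> \<Omega>\<^sub>1" for \<omega>
  proof (cases "good \<omega>")
    case True
    then have *: "M \<omega> \<inter> ?I = {x. \<exists>i. T i \<omega> = Some x}"
      by (simp add: good_def real_values_def)
    note nn = nth_new[of "\<lambda>i. T i \<omega>", folded *, OF inf[OF w]]
    have "range (\<lambda>i. T i \<omega>) - {None} = Some ` (M \<omega> \<inter> ?I)"
    proof (intro equalityI subsetI)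
      fix z assume "z \<in> range (\<lambda>i. T i \<omega>) - {None}"
      then obtain i x where "T i \<omega> = Some x" "z = Some x"
        by auto
      then show "z \<in> Some ` (M \<omega> \<inter> ?I)"
        unfolding * by auto
    next
      fix z assume "z \<in> Some ` (M \<omega> \<inter> ?I)"
      then obtain i x where "T i \<omega> = Some x" "z = Some x"
        unfolding * by auto
      then show "z \<in> range (\<lambda>i. T i \<omega>) - {None}"
        by (metis DiffI option.distinct(1) rangeI singletonD)
    qed
    then show ?thesis
      using nn True by (simp add: R_def R0_def)
  next
    case False
    have "countable (M \<omega> \<inter> ?I)"
      using M_countable w \<Omega>\<^sub>1_subset by auto
    from bij_betw_from_nat_into[OF this inf[OF w]]
    show ?thesis
      using False by (auto simp: R_def bij_betw_def inj_def)
  qed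
  have "R k \<in> \<F> W s t \<rightarrow>\<^sub>M borel_dagger" for k
  proof (rule measurable_\<F>_AE[OF wiener_axioms])
    show "R0 k \<in> \<F> W s t \<rightarrow>\<^sub>M borel_dagger"
      unfolding R0_def
      by (rule measurable_compose_countable[where f="\<lambda>i \<omega>. T i \<omega>", OF T(1) nth_new_measurable[OF T(1)]])
    show "AE \<omega> in W. R0 k \<omega> = R k \<omega>"
      using good by eventually_elim (simp add: R_def)
  qed simp
  moreover have rv: "M \<omega> \<inter> ?I = real_values (\<lambda>k. R k \<omega>)" if "\<omega> \<in> \<Omega>\<^sub>1" for \<omega>
  proof (rule set_eqI)
    fix x
    have "x \<in> real_values (\<lambda>k. R k \<omega>) \<longleftrightarrow> Some x \<in> range (\<lambda>k. R k \<omega>)"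
      by (auto simp: real_values_def image_iff) metis+
    then show "x \<in> M \<omega> \<inter> ?I \<longleftrightarrow> x \<in> real_values (\<lambda>k. R k \<omega>)"
      using R[OF that] by auto
  qed
  moreover have "AE \<omega> in W. M \<omega> \<inter> ?I = real_values (\<lambda>k. R k \<omega>)"
    using AE_\<Omega>\<^sub>1 by eventually_elim (rule rv)
  moreover have "R k \<omega> \<in> Some ` ?I" if "\<omega> \<in> \<Omega>\<^sub>1" for k \<omega>
  proof -
    have "R k \<omega> \<in> range (\<lambda>k. R k \<omega>)"
      by (rule rangeI)
    then show ?thesis
      using R[OF that] by auto
  qed
  ultimately have "local_enumeration W M \<Omega>\<^sub>1 s t R"
    using R unfolding local_enumeration_def measurable_enumeration_def by auto
  then show ?thesis
    by (intro exI)
qed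

text \<open>The same choice as in \<open>N_M\<close>, so that \<open>N_eq\<close> below is a matter
  of unfolding.\<close>

definition R :: "ereal \<Rightarrow> ereal \<Rightarrow> enumeration" where
  "R s t = (SOME R. local_enumeration W M \<Omega>\<^sub>1 s t R)"

abbreviation N where "N \<equiv> N_M W M \<Omega>\<^sub>1 S"

definition N_generator :: "ereal \<Rightarrow> ereal \<Rightarrow> sample set set" where
  "N_generator s t = {{x \<in> \<Omega>M. fst x v - fst x u \<in> A} | u v A. s < ereal u \<and> u \<le> v \<and> ereal v < t \<and> A \<in> sets borel} \<union>
    {{x \<in> \<Omega>M. snd x (the (R s t k (fst x))) \<in> C} | k C. True} \<union> null_sets Q"

lemma N_eq: "N s t = sigma_sets \<Omega>M (N_generator s t)"
proof -
  have 1: "{(\<omega>, \<eta>) \<in> \<Omega>M. \<omega> v - \<omega> u \<in> A} = {x \<in> \<Omega>M. fst x v - fst x u \<in> A}" for u v and A :: "real set"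
    by auto
  have 2: "{(\<omega>, \<eta>) \<in> \<Omega>M. \<eta> (the (f \<omega>)) \<in> C} = {x \<in> \<Omega>M. snd x (the (f (fst x))) \<in> C}" for f C
    by auto
  show ?thesis
    by (simp add: N_M_def Let_def R_def[symmetric] N_generator_def 1 2)
qed

lemma R_local:
  assumes "s < t"
  shows "R s t k \<in> \<F> W s t \<rightarrow>\<^sub>M borel_dagger" "R s t k \<in> W \<rightarrow>\<^sub>M borel_dagger"
    and "\<omega> \<in> \<Omega>\<^sub>1 \<Longrightarrow> inj (\<lambda>k. R s t k \<omega>)"
    and "\<omega> \<in> \<Omega>\<^sub>1 \<Longrightarrow> R s t k \<omega> \<in> Some ` (M \<omega> \<inter> ereal_interval s t)"
    and "\<omega> \<in> \<Omega>\<^sub>1 \<Longrightarrow> r \<in> M \<omega> \<Longrightarrow> r \<in> ereal_interval s t \<Longrightarrow> \<exists>k. R s t k \<omega> = Some r"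
proof -
  have l: "local_enumeration W M \<Omega>\<^sub>1 s t (R s t)"
    unfolding R_def using ex_local_enumeration[OF assms] by (rule someI_ex)
  show m: "R s t k \<in> \<F> W s t \<rightarrow>\<^sub>M borel_dagger"
    using l by (simp add: local_enumeration_def measurable_enumeration_def)
  then show "R s t k \<in> W \<rightarrow>\<^sub>M borel_dagger"
    by (rule measurable_\<F>_W)
  show "\<omega> \<in> \<Omega>\<^sub>1 \<Longrightarrow> inj (\<lambda>k. R s t k \<omega>)"
    using l by (simp add: local_enumeration_def)
  show "\<omega> \<in> \<Omega>\<^sub>1 \<Longrightarrow> r \<in> M \<omega> \<Longrightarrow> r \<in> ereal_interval s t \<Longrightarrow> \<exists>k. R s t k \<omega> = Some r"
    using l by (auto simp: local_enumeration_def real_values_def)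
  assume w: "\<omega> \<in> \<Omega>\<^sub>1"
  then have "R s t k \<omega> \<in> Some ` ereal_interval s t"
    using l by (simp add: local_enumeration_def)
  then obtain r where r: "R s t k \<omega> = Some r"
    by auto
  then have "r \<in> M \<omega> \<inter> ereal_interval s t"
    using l w by (auto simp: local_enumeration_def real_values_def)
  then show "R s t k \<omega> \<in> Some ` (M \<omega> \<inter> ereal_interval s t)"
    using r by auto
qed

lemma R_in: "s < t \<Longrightarrow> \<omega> \<in> \<Omega>\<^sub>1 \<Longrightarrow> the (R s t k \<omega>) \<in> M \<omega> \<inter> ereal_interval s t"
  using R_local(4)[of s t \<omega> k] by auto

text \<open>The law of \<Theta> along \<open>S'\<close> is the product law, so a rectangle has the
  product of the two probabilities; the restriction to \<open>\<Omega>\<^sub>1\<close> costs only a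
  null set.\<close>

lemma law_rectangle:
  fixes S' :: enumeration
  assumes m: "\<And>k. S' k \<in> W \<rightarrow>\<^sub>M borel_dagger"
    and S': "\<And>\<omega>. \<omega> \<in> \<Omega>\<^sub>1 \<Longrightarrow> inj (\<lambda>k. S' k \<omega>)" "\<And>\<omega> k. \<omega> \<in> \<Omega>\<^sub>1 \<Longrightarrow> S' k \<omega> \<in> Some ` M \<omega>"
    and A: "A \<in> sets W" and c: "c \<in> sets coins"
  shows "{x \<in> \<Omega>M. fst x \<in> A \<and> snd (\<Theta> S' x) \<in> c} \<in> sets Q"
    and "measure Q {x \<in> \<Omega>M. fst x \<in> A \<and> snd (\<Theta> S' x) \<in> c} = measure W A * measure coins c"
proof -
  note \<Theta>' = \<Theta>_other_enumeration[OF m S']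
  have A1: "A \<inter> \<Omega>\<^sub>1 \<in> sets (restrict_space W \<Omega>\<^sub>1)"
    using A by (auto simp: sets_restrict_space)
  then have rect: "(A \<inter> \<Omega>\<^sub>1) \<times> c \<in> sets B"
    unfolding B_eq using c by auto
  have eq: "{x \<in> \<Omega>M. fst x \<in> A \<and> snd (\<Theta> S' x) \<in> c} = \<Theta> S' -` ((A \<inter> \<Omega>\<^sub>1) \<times> c) \<inter> space Q"
    by (auto simp: \<Theta>_def \<Omega>_M_def split: prod.splits)
  show "{x \<in> \<Omega>M. fst x \<in> A \<and> snd (\<Theta> S' x) \<in> c} \<in> sets Q"
    unfolding eq by (rule measurable_sets[OF \<Theta>'(1) rect])
  have "measure Q {x \<in> \<Omega>M. fst x \<in> A \<and> snd (\<Theta> S' x) \<in> c} = measure B ((A \<inter> \<Omega>\<^sub>1) \<times> c)"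
    using measure_distr[OF \<Theta>'(1) rect] \<Theta>'(2) by (simp add: eq)
  also have "\<dots> = measure (restrict_space W \<Omega>\<^sub>1) (A \<inter> \<Omega>\<^sub>1) * measure coins c"
    unfolding B_eq using A1 c
    by (simp add: measure_def C.emeasure_pair_measure_Times enn2real_mult)
  also have "measure (restrict_space W \<Omega>\<^sub>1) (A \<inter> \<Omega>\<^sub>1) = measure W (A \<inter> \<Omega>\<^sub>1)"
    using \<Omega>\<^sub>1_sets \<Omega>\<^sub>1_subset by (intro measure_restrict_space) (auto simp: Int_absorb2)
  also have "\<dots> = measure W A"
    using AE_\<Omega>\<^sub>1 A \<Omega>\<^sub>1_sets by (intro W.finite_measure_eq_AE) auto
  finally show "measure Q {x \<in> \<Omega>M. fst x \<in> A \<and> snd (\<Theta> S' x) \<in> c} = measure W A * measure coins c" .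
qed

lemma N_sigma_algebra: "sigma_algebra \<Omega>M (N s t)"
  unfolding N_eq by (rule sigma_algebra_sigma_sets)
    (use sets.sets_into_space[of _ Q] in \<open>auto simp: N_generator_def null_sets_def\<close>)

lemma coin_event: "{b \<in> space coins. b k \<in> D \<inter> {-1, 1}} \<in> sets coins"
  using measurable_sets[OF coin_component, of "D \<inter> {-1, 1}" k]
  by (auto simp: sets_uniform_count_measure vimage_def Int_def conj_commute)

text \<open>The \<sigma>-field of a coin consists of subsets of {-1, 1}, so \<open>D\<close> is cut
  down to these values; nothing is lost as signs take no others.\<close>

lemma sign_event_eq:
  fixes S' :: enumeration
  assumes S': "\<And>\<omega> k. \<omega> \<in> \<Omega>\<^sub>1 \<Longrightarrow> S' k \<omega> \<in> Some ` M \<omega>"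
  shows "{x \<in> \<Omega>M. snd x (the (S' k (fst x))) \<in> D} =
    {x \<in> \<Omega>M. fst x \<in> \<Omega>\<^sub>0 \<and> snd (\<Theta> S' x) \<in> {b \<in> space coins. b k \<in> D \<inter> {-1, 1}}}"
proof (rule Collect_cong, rule conj_cong[OF refl])
  fix x assume x: "x \<in> \<Omega>M"
  have *: "snd (\<Theta> S' x) j \<in> {-1, 1}" for j
    using S'[OF fst_\<Omega>M(1)[OF x], of j] sign_cases[OF x] by fastforce
  then have "snd (\<Theta> S' x) \<in> space coins"
    by (auto simp: space_coins)
  then show "snd x (the (S' k (fst x))) \<in> D \<longleftrightarrow>
      fst x \<in> \<Omega>\<^sub>0 \<and> snd (\<Theta> S' x) \<in> {b \<in> space coins. b k \<in> D \<inter> {-1, 1}}"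
    using *[of k] fst_\<Omega>M[OF x] by auto
qed

lemma sign_event:
  fixes S' :: enumeration
  assumes m: "\<And>k. S' k \<in> W \<rightarrow>\<^sub>M borel_dagger"
    and S': "\<And>\<omega>. \<omega> \<in> \<Omega>\<^sub>1 \<Longrightarrow> inj (\<lambda>k. S' k \<omega>)" "\<And>\<omega> k. \<omega> \<in> \<Omega>\<^sub>1 \<Longrightarrow> S' k \<omega> \<in> Some ` M \<omega>"
  shows "{x \<in> \<Omega>M. snd x (the (S' k (fst x))) \<in> D} \<in> sets Q"
proof -
  have "{x \<in> \<Omega>M. fst x \<in> space W \<and> snd (\<Theta> S' x) \<in> {b \<in> space coins. b k \<in> D \<inter> {-1, 1}}} \<in> sets Q"
    by (rule law_rectangle(1)[OF m S' sets.top coin_event])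
  also have "{x \<in> \<Omega>M. fst x \<in> space W \<and> snd (\<Theta> S' x) \<in> {b \<in> space coins. b k \<in> D \<inter> {-1, 1}}} =
      {x \<in> \<Omega>M. snd x (the (S' k (fst x))) \<in> D}"
    unfolding space_W by (rule sign_event_eq[OF S'(2), symmetric])
  finally show ?thesis .
qed

lemma fst_event: "A \<in> sets W \<Longrightarrow> {x \<in> \<Omega>M. fst x \<in> A} \<in> sets Q"
  using measurable_sets[OF fst_measurable, of A] by (simp add: vimage_def Int_def conj_commute)

lemma N_generator_Q:
  assumes st: "s < t" shows "N_generator s t \<subseteq> sets Q"
proof
  fix D assume "D \<in> N_generator s t"
  then consider u v A where "D = {x \<in> \<Omega>M. fst x v - fst x u \<in> A}" "A \<in> sets borel"
    | k C where "D = {x \<in> \<Omega>M. snd x (the (R s t k (fst x))) \<in> C}" | "D \<in> null_sets Q"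
    unfolding N_generator_def by blast
  then show "D \<in> sets Q"
  proof cases
    case 1
    have "{\<omega> \<in> space W. \<omega> v - \<omega> u \<in> A} \<in> sets W"
      using 1(2) by measurable
    from fst_event[OF this] show ?thesis
      unfolding 1 by (rule back_subst[of "\<lambda>D. D \<in> sets Q"]) (use fst_\<Omega>M in auto)
  next
    case 2
    have sub: "R s t k \<omega> \<in> Some ` M \<omega>" if "\<omega> \<in> \<Omega>\<^sub>1" for k \<omega>
      using R_local(4)[OF st that, of k] by auto
    show ?thesis
      unfolding 2 by (rule sign_event[OF R_local(2)[OF st] R_local(3)[OF st] sub])
  qed auto
qed

lemma N_Q: "s < t \<Longrightarrow> N s t \<subseteq> sets Q"
  unfolding N_eq using sets.sigma_sets_subset[OF N_generator_Q, of s t] by simp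

lemma null_in_N: "D \<in> null_sets Q \<Longrightarrow> D \<in> N s t"
  by (auto simp: N_eq N_generator_def)

lemma N_AE:
  assumes A: "A \<in> N s t" and D: "D \<subseteq> \<Omega>M" and ae: "AE x in Q. x \<in> A \<longleftrightarrow> x \<in> D"
  shows "D \<in> N s t"
proof -
  interpret N: sigma_algebra \<Omega>M "N s t"
    by (rule N_sigma_algebra)
  have "{x \<in> space Q. \<not> (x \<in> A \<longleftrightarrow> x \<in> D)} \<in> null_sets Q"
    using ae by (rule iffD1[OF Q.AE_iff_null_sets])
  then have n: "A - D \<in> null_sets Q" "D - A \<in> null_sets Q"
    using N.sets_into_space[OF A] D by (auto elim!: Q.complete2[rotated])
  have "(A - (A - D)) \<union> (D - A) \<in> N s t"
    by (rule N.Un[OF N.Diff[OF A null_in_N[OF n(1)]] null_in_N[OF n(2)]])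
  also have "(A - (A - D)) \<union> (D - A) = D"
    by auto
  finally show ?thesis .
qed

section \<open>Flipping a single sign\<close>

text \<open>
  The sign of the \<open>k\<close>-th point is left alone if that point lies in \<open>I\<close>. This makes everything that
  is local to \<open>I\<close> invariant under \<open>flip k I\<close>, while the law is still preserved.
\<close>
definition flip :: "nat \<Rightarrow> real set \<Rightarrow> sample \<Rightarrow> sample" where
  "flip k I x = (if the (S k (fst x)) \<in> I then x
     else (fst x, (snd x)(the (S k (fst x)) := - snd x (the (S k (fst x))))))"

lemma fst_flip [simp]: "fst (flip k I x) = fst x"
  by (simp add: flip_def)

lemma flip_in:
  assumes x: "x \<in> \<Omega>M" shows "flip k I x \<in> \<Omega>M"
proof -
  let ?r = "the (S k (fst x))"
  have r: "?r \<in> M (fst x)"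
    using S_in_M[OF fst_\<Omega>M(1)[OF x]] .
  have "snd x ?r = -1 \<or> snd x ?r = 1"
    by (rule sign_cases[OF x r])
  then show ?thesis
    using x r by (auto simp: flip_def \<Omega>M_iff PiE_iff extensional_def)
qed

lemma snd_flip_coin:
  assumes x: "x \<in> \<Omega>M"
  shows "snd (flip k I x) (the (S j (fst x))) =
    (if j = k \<and> the (S k (fst x)) \<notin> I then - snd x (the (S j (fst x))) else snd x (the (S j (fst x))))"
proof -
  have "the (S j (fst x)) = the (S k (fst x)) \<longleftrightarrow> j = k"
    using Some_S[OF fst_\<Omega>M(1)[OF x]] inj_eq[OF S_inj[OF fst_\<Omega>M(1)[OF x]], of j k] by metis
  then show ?thesis
    by (auto simp: flip_def)
qed

text \<open>In terms of the coins the map is either the identity or the flip of coordinate k, and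
  the path alone decides which. Both preserve the law of the coins, so the fibrewise criterion
  applies.\<close>

lemma flip_Q:
  assumes I: "I \<in> sets borel"
  shows "flip k I \<in> Q \<rightarrow>\<^sub>M Q" and "distr Q Q (flip k I) = Q"
proof -
  define u where "u = (\<lambda>\<omega> b. if the (S k \<omega>) \<in> I then b else b(k := - b k :: int))"
  have th: "(\<lambda>\<omega>. the (S k \<omega>)) \<in> borel_measurable (restrict_space W \<Omega>\<^sub>1)"
    by (intro measurable_restrict_space1 borel_daggerD(3) S_meas)
  have u: "(\<lambda>(\<omega>, b). u \<omega> b) \<in> restrict_space W \<Omega>\<^sub>1 \<Otimes>\<^sub>M coins \<rightarrow>\<^sub>M coins"
    unfolding u_def case_prod_beta'
  proof (rule measurable_If)
    show "(\<lambda>x. (snd x)(k := - snd x k)) \<in> restrict_space W \<Omega>\<^sub>1 \<Otimes>\<^sub>M coins \<rightarrow>\<^sub>M coins"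
      by (rule measurable_compose[OF measurable_snd flip_coin_measurable])
    have "(\<lambda>z. the (S k (fst z))) \<in> borel_measurable (restrict_space W \<Omega>\<^sub>1 \<Otimes>\<^sub>M coins)"
      by (rule measurable_compose[OF measurable_fst th])
    from measurable_sets[OF this I]
    show "{z \<in> space (restrict_space W \<Omega>\<^sub>1 \<Otimes>\<^sub>M coins). the (S k (fst z)) \<in> I} \<in> sets (restrict_space W \<Omega>\<^sub>1 \<Otimes>\<^sub>M coins)"
      by (simp add: vimage_def Int_def conj_commute)
  qed simp
  have d: "distr coins coins (u \<omega>) = coins" for \<omega>
    by (cases "the (S k \<omega>) \<in> I") (simp_all add: u_def distr_flip_coin)
  note fib = distr_pair_fibrewise[OF R.sigma_finite_measure_axioms C.sigma_finite_measure_axioms u d, folded B_eq]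
  have eq: "\<Theta> S (flip k I x) = (case \<Theta> S x of (\<omega>, b) \<Rightarrow> (\<omega>, u \<omega> b))" if "x \<in> space Q" for x
  proof -
    have "snd (\<Theta> S (flip k I x)) = u (fst x) (snd (\<Theta> S x))"
    proof
      fix j
      show "snd (\<Theta> S (flip k I x)) j = u (fst x) (snd (\<Theta> S x)) j"
        using that snd_flip_coin[of x k I j] by (auto simp: u_def)
    qed
    then show ?thesis
      by (simp add: split_beta prod_eq_iff del: snd_\<Theta>)
  qed
  have m: "(\<lambda>x. case \<Theta> S x of (\<omega>, b) \<Rightarrow> (\<omega>, u \<omega> b)) \<in> Q \<rightarrow>\<^sub>M B"
    by (rule measurable_compose[OF \<Theta>_measurable fib(1)])
  have m': "(\<lambda>x. \<Theta> S (flip k I x)) \<in> Q \<rightarrow>\<^sub>M B"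
    using m by (subst measurable_cong[OF eq])
  have "distr Q B (\<lambda>x. \<Theta> S (flip k I x)) = distr Q B (\<lambda>x. case \<Theta> S x of (\<omega>, b) \<Rightarrow> (\<omega>, u \<omega> b))"
    by (rule distr_cong[OF refl refl eq])
  also have "\<dots> = distr (distr Q B (\<Theta> S)) B (\<lambda>(\<omega>, b). (\<omega>, u \<omega> b))"
    by (subst distr_distr[OF fib(1) \<Theta>_measurable]) (simp add: comp_def)
  finally have d': "distr Q B (\<lambda>x. \<Theta> S (flip k I x)) = B"
    by (simp add: distr_\<Theta> fib(2))
  show "flip k I \<in> Q \<rightarrow>\<^sub>M Q" and "distr Q Q (flip k I) = Q"
    by (rule measure_preserving_Q[OF Q.complete_measure_axioms _ m' d'], simp add: flip_in)+
qed

lemma AE_flip: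
  assumes "I \<in> sets borel" "AE x in Q. T x" shows "AE x in Q. T (flip k I x)"
  by (rule AE_distrD[OF flip_Q(1)[OF assms(1)]]) (simp only: flip_Q(2)[OF assms(1)] assms(2))

definition NS :: "ereal \<Rightarrow> ereal \<Rightarrow> sample measure" where
  "NS s t = sigma \<Omega>M (N_generator s t)"

lemma N_generator_Pow: "N_generator s t \<subseteq> Pow \<Omega>M"
  using sets.sets_into_space[of _ Q] by (auto simp: N_generator_def null_sets_def)

lemma space_NS [simp]: "space (NS s t) = \<Omega>M" and sets_NS: "sets (NS s t) = N s t"
  using N_generator_Pow by (simp_all add: NS_def N_eq sets_measure_of space_measure_of)

lemma NS_Q: "s < t \<Longrightarrow> f \<in> NS s t \<rightarrow>\<^sub>M L \<Longrightarrow> f \<in> Q \<rightarrow>\<^sub>M L"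
  using N_Q[of s t] by (auto simp: measurable_def sets_NS)

lemma N_open_increment:
  assumes "s < ereal u" "u \<le> v" "ereal v < t"
  shows "(\<lambda>x. fst x v - fst x u) \<in> borel_measurable (NS s t)"
proof (rule measurableI)
  fix A :: "real set" assume "A \<in> sets borel"
  then have "{x \<in> \<Omega>M. fst x v - fst x u \<in> A} \<in> N_generator s t"
    using assms unfolding N_generator_def by blast
  then show "(\<lambda>x. fst x v - fst x u) -` A \<inter> space (NS s t) \<in> sets (NS s t)"
    by (auto simp: sets_NS N_eq vimage_def Int_def conj_commute intro: sigma_sets.Basic)
qed simp

text \<open>The generators of \<open>N_M\<close> use only times strictly inside the interval; the
  end points are reached by shrinking the increment slightly and using continuity of the
  paths.\<close>

lemma N_increment:
  assumes uv: "s \<le> ereal u" "u \<le> v" "ereal v \<le> t"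
  shows "(\<lambda>x. fst x v - fst x u) \<in> borel_measurable (NS s t)"
proof (cases "u = v")
  case False
  then have "u < v"
    using uv by simp
  \<comment> \<open>The offset 3 keeps the shrunken end points in order for every n, including
    0.\<close>
  define d where "d n = (v - u) / real (n + 3)" for n
  have d: "0 < d n" "2 * d n \<le> v - u" for n
  proof -
    have "(v - u) * 2 \<le> (v - u) * real (n + 3)"
      using \<open>u < v\<close> by (intro mult_left_mono) auto
    then show "2 * d n \<le> v - u"
      by (simp add: d_def pos_divide_le_eq mult.commute)
  qed (use \<open>u < v\<close> in \<open>simp add: d_def\<close>)
  have d0: "d \<longlonglongrightarrow> 0"
    unfolding d_def using LIMSEQ_ignore_initial_segment[OF lim_const_over_n[of "v - u"], of 3] .
  show ?thesis
  proof (rule borel_measurable_LIMSEQ_real)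
    fix n
    have "s < ereal (u + d n)"
      by (rule le_less_trans[OF uv(1)]) (simp add: d(1))
    moreover have "ereal (v - d n) < t"
      by (rule less_le_trans[OF _ uv(3)]) (simp add: d(1))
    moreover have "u + d n \<le> v - d n"
      using d(2)[of n] by simp
    ultimately show "(\<lambda>x. fst x (v - d n) - fst x (u + d n)) \<in> borel_measurable (NS s t)"
      by (intro N_open_increment)
  next
    fix x assume "x \<in> space (NS s t)"
    then have "fst x \<in> \<Omega>\<^sub>0"
      using fst_\<Omega>M by simp
    then have c: "isCont (fst x) r" for r
      by (simp add: \<Omega>\<^sub>0_def continuous_on_eq_continuous_at)
    have "(\<lambda>n. v - d n) \<longlonglongrightarrow> v - 0" "(\<lambda>n. u + d n) \<longlonglongrightarrow> u + 0"
      by (intro tendsto_intros d0)+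
    then show "(\<lambda>n. fst x (v - d n) - fst x (u + d n)) \<longlonglongrightarrow> fst x v - fst x u"
      by (intro tendsto_diff isCont_tendsto_compose[OF c]) simp_all
  qed
qed simp

lemma N_fst:
  assumes st: "s < t" and A: "A \<in> sets (\<F> W s t)"
  shows "{x \<in> \<Omega>M. fst x \<in> A} \<in> N s t"
proof -
  interpret N: sigma_algebra \<Omega>M "N s t"
    by (rule N_sigma_algebra)
  have null: "{x \<in> \<Omega>M. fst x \<in> A} \<in> N s t" if "A \<in> null_sets W" for A
  proof (rule null_in_N)
    have "AE x in Q. fst x \<notin> A"
      by (rule AE_Q_fst[OF AE_not_in[OF that]])
    from iffD1[OF Q.AE_iff_null_sets this] show "{x \<in> \<Omega>M. fst x \<in> A} \<in> null_sets Q"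
      by simp
  qed
  from A show ?thesis
    unfolding sets_\<F>
  proof (induction rule: sigma_sets.induct)
    case (Basic a)
    then show ?case
    proof
      assume "a \<in> increment_generator s t"
      then obtain u v A where a: "a = {\<omega> \<in> \<Omega>\<^sub>0. \<omega> v - \<omega> u \<in> A}" "s \<le> ereal u" "u \<le> v" "ereal v \<le> t"
        and [measurable]: "A \<in> sets borel"
        by blast
      have "(\<lambda>x. fst x v - fst x u) -` A \<inter> space (NS s t) \<in> sets (NS s t)"
        by (rule measurable_sets[OF N_increment[OF a(2-4)]]) measurable
      also have "(\<lambda>x. fst x v - fst x u) -` A \<inter> space (NS s t) = {x \<in> \<Omega>M. fst x \<in> a}"
        unfolding a(1) using fst_\<Omega>M by auto
      finally show ?case
        by (simp add: sets_NS)
    next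
      assume a: "a \<in> {A \<in> sets W. measure W A = 0 \<or> measure W A = 1}"
      then have aW: "a \<in> sets W" and "measure W a = 0 \<or> measure W a = 1"
        by simp_all
      from this(2) show ?case
      proof
        assume "measure W a = 0"
        with aW have "a \<in> null_sets W"
          by (simp add: null_sets_def W.emeasure_eq_measure)
        then show ?case
          by (rule null)
      next
        assume "measure W a = 1"
        note 2 = aW this
        have "measure W (space W - a) = 0"
          using W.prob_compl[OF 2(1)] 2(2) by simp
        then have "space W - a \<in> null_sets W"
          using sets.compl_sets[OF aW] by (simp add: null_sets_def W.emeasure_eq_measure)
        from N.compl_sets[OF null[OF this]]
        show ?thesis
          by (rule back_subst[of "\<lambda>D. D \<in> N s t"]) (use fst_\<Omega>M in auto)
      qed
    qed
  next
    case (Compl a)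
    from N.compl_sets[OF Compl.IH] show ?case
      by (rule back_subst[of "\<lambda>D. D \<in> N s t"]) (use fst_\<Omega>M in auto)
  next
    case (Union a)
    have "(\<Union>i. {x \<in> \<Omega>M. fst x \<in> a i}) \<in> N s t"
      using Union.IH by (intro N.countable_UN) auto
    also have "(\<Union>i. {x \<in> \<Omega>M. fst x \<in> a i}) = {x \<in> \<Omega>M. fst x \<in> \<Union> (range a)}"
      by auto
    finally show ?case .
  qed simp
qed

lemma N_sign_R: "{x \<in> \<Omega>M. snd x (the (R s t k (fst x))) \<in> D} \<in> N s t"
  unfolding N_eq by (rule sigma_sets.Basic) (auto simp: N_generator_def)

text \<open>Almost surely \<open>R'\<close> agrees with some member of the chosen local enumeration.
  Splitting by its index j gives countably many pieces, each the intersection of a local path event,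
  where \<open>R'\<close> is the j-th member, with a generating sign event.\<close>

lemma N_sign:
  assumes st: "s < t" and m: "R' \<in> \<F> W s t \<rightarrow>\<^sub>M borel_dagger"
    and ae: "AE \<omega> in W. R' \<omega> \<in> Some ` (M \<omega> \<inter> ereal_interval s t)"
  shows "{x \<in> \<Omega>M. snd x (the (R' (fst x))) \<in> D} \<in> N s t"
proof -
  interpret N: sigma_algebra \<Omega>M "N s t"
    by (rule N_sigma_algebra)
  let ?A = "\<Union>j. {x \<in> \<Omega>M. fst x \<in> {\<omega> \<in> space (\<F> W s t). R' \<omega> = R s t j \<omega>}} \<inter> {x \<in> \<Omega>M. snd x (the (R s t j (fst x))) \<in> D}"
  have A: "?A \<in> N s t"
    by (rule N.countable_nat_UN) (use N.Int[OF N_fst[OF st borel_dagger_eq[OF m R_local(1)[OF st]]] N_sign_R] in blast)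
  have "AE x in Q. x \<in> ?A \<longleftrightarrow> x \<in> {x \<in> \<Omega>M. snd x (the (R' (fst x))) \<in> D}"
    using AE_Q_fst[OF ae] AE_Q_\<Omega>M
  proof eventually_elim
    case (elim x)
    then obtain r where r: "r \<in> M (fst x)" "r \<in> ereal_interval s t" "R' (fst x) = Some r"
      by blast
    then obtain j where "R s t j (fst x) = R' (fst x)"
      using R_local(5)[OF st fst_\<Omega>M(1)[OF elim(2)]] by metis
    then show ?case
      using elim(2) fst_\<Omega>M(2)[OF elim(2)] by (auto intro!: exI[of _ j])
  qed
  then show ?thesis
    by (rule N_AE[OF A, rotated]) auto
qed

text \<open>Path increments do not see the flip, and the signs of points inside the interval are
  left alone by construction. The null sets among the generators are the reason for an almost sure
  statement; they are handled by invariance of the law.\<close>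

lemma N_flip:
  assumes st: "s < t" and D: "D \<in> N s t"
  shows "AE x in Q. x \<in> D \<longleftrightarrow> flip k (ereal_interval s t) x \<in> D"
  using D unfolding N_eq
proof (induction rule: sigma_sets.induct)
  case (Basic a)
  then consider u v A where "a = {x \<in> \<Omega>M. fst x v - fst x u \<in> A}" "A \<in> sets borel"
    | j C where "a = {x \<in> \<Omega>M. snd x (the (R s t j (fst x))) \<in> C}" | "a \<in> null_sets Q"
    unfolding N_generator_def by blast
  then show ?case
  proof cases
    case 1
    show ?thesis
      using AE_Q_\<Omega>M by eventually_elim (simp add: 1 flip_in)
  next
    case 2
    show ?thesis
      using AE_Q_\<Omega>M
    proof eventually_elim
      case (elim x)
      then have "the (R s t j (fst x)) \<in> ereal_interval s t"
        using R_in[OF st fst_\<Omega>M(1)] by blast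
      then have "snd (flip k (ereal_interval s t) x) (the (R s t j (fst x))) = snd x (the (R s t j (fst x)))"
        by (auto simp: flip_def)
      then show ?case
        using elim by (simp add: 2 flip_in)
    qed
  next
    case 3
    show ?thesis
      using AE_not_in[OF 3] AE_flip[OF ereal_interval_sets AE_not_in[OF 3]] by eventually_elim simp
  qed
next
  case (Compl a)
  from Compl.IH AE_Q_\<Omega>M show ?case
    by eventually_elim (simp add: flip_in)
next
  case (Union a)
  then have "AE x in Q. \<forall>i. x \<in> a i \<longleftrightarrow> flip k (ereal_interval s t) x \<in> a i"
    by (simp add: AE_all_countable)
  then show ?case
    by eventually_elim simp
qed simp

text \<open>A real number is determined by the rationals above it, so countably many applications of
  \<open>N_flip\<close> to level sets suffice.\<close>

lemma N_flip_fun: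
  fixes G :: "sample \<Rightarrow> real"
  assumes st: "s < t" and G: "G \<in> borel_measurable (NS s t)"
  shows "AE x in Q. G (flip k (ereal_interval s t) x) = G x"
proof -
  have "AE x in Q. x \<in> {x \<in> \<Omega>M. G x < of_rat q} \<longleftrightarrow>
      flip k (ereal_interval s t) x \<in> {x \<in> \<Omega>M. G x < of_rat q}" for q
  proof (rule N_flip[OF st])
    have "{x \<in> space (NS s t). G x < of_rat q} \<in> sets (NS s t)"
      using G by measurable
    then show "{x \<in> \<Omega>M. G x < of_rat q} \<in> N s t"
      by (simp add: sets_NS)
  qed
  then have "AE x in Q. \<forall>q::rat. x \<in> {x \<in> \<Omega>M. G x < of_rat q} \<longleftrightarrow>
      flip k (ereal_interval s t) x \<in> {x \<in> \<Omega>M. G x < of_rat q}"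
    unfolding AE_all_countable by (rule allI)
  then show ?thesis
    using AE_Q_\<Omega>M
  proof eventually_elim
    case (elim x)
    then have *: "G x < of_rat q \<longleftrightarrow> G (flip k (ereal_interval s t) x) < of_rat q" for q
      by (simp add: flip_in)
    show ?case
      using *  of_rat_dense[of "G x" "G (flip k (ereal_interval s t) x)"]
        of_rat_dense[of "G (flip k (ereal_interval s t) x)" "G x"]
      by (meson less_asym linorder_neqE_linordered_idom)
  qed
qed

text \<open>The path before s and after t, each seen relative to its own end point; no increment
  across (s,t) is included.\<close>

abbreviation outside :: "real \<Rightarrow> real \<Rightarrow> (real \<Rightarrow> real) measure" where
  "outside s t \<equiv> increment_field (\<lambda>u. if u \<le> s then s else t) (- {s<..<t})"

text \<open>Call a rectangle the product of an inside path event and an event of the coins along the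
  local enumeration. Intersecting it with an outside path event only changes its path side, so the
  product formula follows from the independence of coins and path together with that of the inside
  and outside path. Rectangles are intersection-stable.\<close>

lemma N_indep_outside:
  assumes st: "s < t"
  shows "Q.indep_set (N s t) {{x \<in> \<Omega>M. fst x \<in> H} | H. H \<in> sets (outside s t)}"
proof -
  let ?In = "increment_field (\<lambda>_. s) {s..t}" and ?R = "R (ereal s) (ereal t)"
  have st': "ereal s < ereal t"
    using st by simp
  have sub: "?R k \<omega> \<in> Some ` M \<omega>" if "\<omega> \<in> \<Omega>\<^sub>1" for k \<omega>
    using R_local(4)[OF st' that, of k] by auto
  note law = law_rectangle[OF R_local(2)[OF st'] R_local(3)[OF st'] sub]
  define rect where "rect A c = {x \<in> \<Omega>M. fst x \<in> A \<and> snd (\<Theta> ?R x) \<in> c}" for A c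
  let ?A = "{rect A c | A c. A \<in> sets ?In \<and> c \<in> sets coins}"
  let ?B = "{{x \<in> \<Omega>M. fst x \<in> H} | H. H \<in> sets (outside s t)}"
  have PW: "A \<in> sets (increment_field p I) \<Longrightarrow> A \<in> sets W" for A p I
    using sets_increment_field_subset sets_P_subset by blast
  have indep: "measure W (A \<inter> H) = measure W A * measure W H" if "A \<in> sets ?In" "H \<in> sets (outside s t)" for A H
    using P.indep_setD[OF indep_inside_outside[OF st] that] that sets_increment_field_subset
    unfolding W_eq by (subst (1 2 3) measure_completion) auto
  have rect_Int: "rect A c \<inter> {x \<in> \<Omega>M. fst x \<in> H} = rect (A \<inter> H) c" for A c H
    by (auto simp: rect_def)
  have rect_Q: "rect A c \<in> sets Q" "measure Q (rect A c) = measure W A * measure coins c"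
    if "A \<in> sets W" "c \<in> sets coins" for A c
    unfolding rect_def by (rule law(1)[OF _ _ that], assumption+, rule law(2)[OF _ _ that], assumption+)
  have AB: "Q.indep_set ?A ?B"
  proof (rule Q.indep_setI)
    show "?A \<subseteq> sets Q"
      using rect_Q(1)[OF PW] by blast
    show "?B \<subseteq> sets Q"
      using fst_event[OF PW] by blast
    fix a b assume "a \<in> ?A" "b \<in> ?B"
    then obtain A c H where a: "a = rect A c" "A \<in> sets ?In" "c \<in> sets coins"
      and b: "b = {x \<in> \<Omega>M. fst x \<in> H}" "H \<in> sets (outside s t)"
      by blast
    have "measure Q b = measure W H"
      using measure_distr[OF fst_measurable PW[OF b(2)]] by (simp add: distr_fst b vimage_def Int_def conj_commute)
    moreover have "measure Q a = measure W A * measure coins c"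
      unfolding a(1) by (rule rect_Q(2)[OF PW[OF a(2)] a(3)])
    moreover have "measure Q (a \<inter> b) = measure W (A \<inter> H) * measure coins c"
      unfolding a(1) b(1) rect_Int by (rule rect_Q(2)[OF sets.Int[OF PW[OF a(2)] PW[OF b(2)]] a(3)])
    ultimately show "measure Q (a \<inter> b) = measure Q a * measure Q b"
      using indep[OF a(2) b(2)] by simp
  qed
  have stA: "Int_stable ?A"
  proof (rule Int_stableI)
    fix a b assume "a \<in> ?A" "b \<in> ?A"
    then obtain A c A' c' where "a = rect A c" "A \<in> sets ?In" "c \<in> sets coins"
      "b = rect A' c'" "A' \<in> sets ?In" "c' \<in> sets coins"
      by blast
    then have "a \<inter> b = rect (A \<inter> A') (c \<inter> c')" "A \<inter> A' \<in> sets ?In" "c \<inter> c' \<in> sets coins"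
      by (auto simp: rect_def)
    then show "a \<inter> b \<in> ?A"
      by blast
  qed
  have stB: "Int_stable ?B"
  proof (rule Int_stableI)
    fix a b assume "a \<in> ?B" "b \<in> ?B"
    then obtain H H' where "a = {x \<in> \<Omega>M. fst x \<in> H}" "H \<in> sets (outside s t)"
      "b = {x \<in> \<Omega>M. fst x \<in> H'}" "H' \<in> sets (outside s t)"
      by blast
    then have "a \<inter> b = {x \<in> \<Omega>M. fst x \<in> H \<inter> H'}" "H \<inter> H' \<in> sets (outside s t)"
      by auto
    then show "a \<inter> b \<in> ?B"
      by blast
  qed
  have sAB: "Q.indep_set (sigma_sets \<Omega>M ?A) (sigma_sets \<Omega>M ?B)"
    using Q.indep_set_sigma_sets[OF AB stA stB] by simp
  have Asub: "?A \<subseteq> Pow \<Omega>M"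
    by (auto simp: rect_def)
  interpret A: sigma_algebra \<Omega>M "sigma_sets \<Omega>M ?A"
    by (rule sigma_algebra_sigma_sets[OF Asub])
  \<comment> \<open>\<open>N s t\<close> contains all null sets, which rectangles do not generate;
    so its events are compared with generated ones up to null sets.\<close>
  have approx: "\<exists>D'\<in>sigma_sets \<Omega>M ?A. AE x in Q. x \<in> D \<longleftrightarrow> x \<in> D'" if "D \<in> N s t" for D
    using that unfolding N_eq
  proof (induction rule: sigma_sets.induct)
    case (Basic a)
    then consider u v A where "a = {x \<in> \<Omega>M. fst x v - fst x u \<in> A}" "A \<in> sets borel" "s < u" "u \<le> v" "v < t"
      | k C where "a = {x \<in> \<Omega>M. snd x (the (?R k (fst x))) \<in> C}" | "a \<in> null_sets Q"
      unfolding N_generator_def by auto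
    then show ?case
    proof cases
      case 1
      have "(\<lambda>\<omega>. (\<omega> v - \<omega> s) - (\<omega> u - \<omega> s)) \<in> borel_measurable ?In"
        using 1 by (intro borel_measurable_diff increment_measurable[where p="\<lambda>_. s"]) auto
      from measurable_sets[OF this 1(2)] have "{\<omega> \<in> \<Omega>\<^sub>0. \<omega> v - \<omega> u \<in> A} \<in> sets ?In"
        by (simp add: vimage_def Int_def conj_commute)
      then have "rect {\<omega> \<in> \<Omega>\<^sub>0. \<omega> v - \<omega> u \<in> A} (space coins) \<in> ?A"
        by blast
      moreover have "AE x in Q. x \<in> a \<longleftrightarrow> x \<in> rect {\<omega> \<in> \<Omega>\<^sub>0. \<omega> v - \<omega> u \<in> A} (space coins)"
        using AE_Q_\<Omega>M
      proof eventually_elim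
        case (elim x)
        have "snd (\<Theta> ?R x) \<in> space coins"
          using R_in[OF st' fst_\<Omega>M(1)[OF elim]] sign_cases[OF elim] by (auto simp: space_coins)
        then show ?case
          using elim fst_\<Omega>M(2)[OF elim] by (auto simp: 1 rect_def)
      qed
      ultimately show ?thesis
        using sigma_sets.Basic by blast
    next
      case 2
      have "\<Omega>\<^sub>0 \<in> sets ?In"
        using sets.top[of ?In] by simp
      then have "rect \<Omega>\<^sub>0 {b \<in> space coins. b k \<in> C \<inter> {-1, 1}} \<in> ?A"
        using coin_event[of k C] by blast
      moreover have "a = rect \<Omega>\<^sub>0 {b \<in> space coins. b k \<in> C \<inter> {-1, 1}}"
        unfolding 2 rect_def by (rule sign_event_eq[OF sub])
      ultimately show ?thesis
        by (intro bexI[of _ a]) (auto intro: sigma_sets.Basic)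
    next
      case 3
      show ?thesis
        using AE_not_in[OF 3] by (intro bexI[of _ "{}"]) (auto intro: sigma_sets.Empty)
    qed
  next
    case (Compl a)
    then obtain D' where D': "D' \<in> sigma_sets \<Omega>M ?A" "AE x in Q. x \<in> a \<longleftrightarrow> x \<in> D'"
      by blast
    have "AE x in Q. x \<in> \<Omega>M - a \<longleftrightarrow> x \<in> \<Omega>M - D'"
      using D'(2) by eventually_elim simp
    then show ?case
      using sigma_sets.Compl[OF D'(1)] by blast
  next
    case (Union a)
    have "\<forall>i. \<exists>D'. D' \<in> sigma_sets \<Omega>M ?A \<and> (AE x in Q. x \<in> a i \<longleftrightarrow> x \<in> D')"
    proof
      fix i show "\<exists>D'. D' \<in> sigma_sets \<Omega>M ?A \<and> (AE x in Q. x \<in> a i \<longleftrightarrow> x \<in> D')"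
        using Union.IH[of i] by (simp only: Bex_def)
    qed
    from choice[OF this] obtain D' where "\<forall>i. D' i \<in> sigma_sets \<Omega>M ?A \<and> (AE x in Q. x \<in> a i \<longleftrightarrow> x \<in> D' i)"
      by (rule exE)
    then have D': "D' i \<in> sigma_sets \<Omega>M ?A" "AE x in Q. x \<in> a i \<longleftrightarrow> x \<in> D' i" for i
      by simp_all
    have "AE x in Q. \<forall>i. x \<in> a i \<longleftrightarrow> x \<in> D' i"
      unfolding AE_all_countable using D'(2) by (rule allI)
    then have "AE x in Q. x \<in> (\<Union>i. a i) \<longleftrightarrow> x \<in> (\<Union>i. D' i)"
      by eventually_elim simp
    then show ?case
      by (rule bexI) (rule sigma_sets.Union[OF D'(1)])
  qed (auto intro: sigma_sets.Empty)
  show ?thesis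
  proof (rule Q.indep_setI)
    show "N s t \<subseteq> sets Q"
      by (rule N_Q[OF st'])
    show "?B \<subseteq> sets Q"
      by (rule Q.indep_setD_ev2[OF AB])
    fix D b assume D: "D \<in> N s t" and b: "b \<in> ?B"
    obtain D' where D': "D' \<in> sigma_sets \<Omega>M ?A" and eq: "AE x in Q. x \<in> D \<longleftrightarrow> x \<in> D'"
      using approx[OF D] by blast
    have m: "D \<in> sets Q" "D' \<in> sets Q" "b \<in> sets Q"
      by (rule subsetD[OF N_Q[OF st'] D], rule subsetD[OF Q.indep_setD_ev1[OF sAB] D'],
          rule subsetD[OF Q.indep_setD_ev2[OF AB] b])
    have "measure Q (D \<inter> b) = measure Q (D' \<inter> b)" "measure Q D = measure Q D'"
      by (rule Q.finite_measure_eq_AE; use eq m in \<open>(auto elim!: eventually_mono; fail)?\<close>)+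
    then show "measure Q (D \<inter> b) = measure Q D * measure Q b"
      using Q.indep_setD[OF sAB D' sigma_sets.Basic[OF b]] by simp
  qed
qed

end

section \<open>Vanishing of a function through its integrals over events\<close>

lemma (in finite_measure) AE_eq_0_if_set_integrals_0:
  fixes g :: "'a \<Rightarrow> real"
  assumes g: "integrable M g" and z: "\<And>D. D \<in> sets M \<Longrightarrow> (LINT x:D|M. g x) = 0"
  shows "AE x in M. g x = 0"
proof -
  have *: "AE x in M. \<not> h x > 0" if h: "integrable M h" "\<And>D. D \<in> sets M \<Longrightarrow> (LINT x:D|M. h x) = 0" for h :: "'a \<Rightarrow> real"
  proof -
    have [measurable]: "h \<in> borel_measurable M"
      using h by auto
    let ?D = "{x \<in> space M. h x > 0}"
    have D: "?D \<in> sets M"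
      by measurable
    have i0: "(\<integral>x. indicator ?D x * h x \<partial>M) = 0"
      using h(2)[OF D] by (simp add: set_lebesgue_integral_def)
    have i1: "integrable M (\<lambda>x. indicator ?D x * h x)"
      using integrable_mult_indicator[OF D h(1)] by simp
    have "AE x in M. indicator ?D x * h x = 0"
      using i0 by (subst (asm) integral_nonneg_eq_0_iff_AE[OF i1]) (auto simp: indicator_def)
    then show ?thesis
      using AE_space by eventually_elim (auto simp: indicator_def split: if_splits)
  qed
  have "AE x in M. \<not> - g x > 0"
    by (rule *) (use g z in \<open>auto simp: set_lebesgue_integral_def\<close>)
  moreover have "AE x in M. \<not> g x > 0"
    by (rule *[OF g]) (rule z)
  ultimately show ?thesis
    by eventually_elim auto
qed

lemma (in finite_measure) set_integral_eq_0_sigma_sets: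
  fixes g :: "'a \<Rightarrow> real"
  assumes g: "integrable M g" and G: "Int_stable G" "G \<subseteq> sets M"
    and z: "\<And>D. D \<in> G \<Longrightarrow> (LINT x:D|M. g x) = 0" and tot: "(\<integral>x. g x \<partial>M) = 0"
    and D: "D \<in> sigma_sets (space M) G"
  shows "(LINT x:D|M. g x) = 0"
proof -
  have GP: "G \<subseteq> Pow (space M)"
    using G(2) sets.sets_into_space by auto
  have GQ: "sigma_sets (space M) G \<subseteq> sets M"
    by (rule sets.sigma_sets_subset[OF G(2)])
  have si: "set_integrable M D g" if "D \<in> sets M" for D
    unfolding set_integrable_def by (rule integrable_mult_indicator[OF that g])
  have tot': "(LINT x:space M|M. g x) = 0"
    using tot by (simp add: set_lebesgue_integral_def cong: Bochner_Integration.integral_cong)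
  show ?thesis
    using G(1) GP D
  proof (induction rule: sigma_sets_induct_disjoint)
    case (basic D)
    then show ?case
      by (rule z)
  next
    case empty
    show ?case
      by (simp add: set_lebesgue_integral_def)
  next
    case (compl D)
    then have D: "D \<in> sets M" "D \<subseteq> space M"
      using GQ sets.sets_into_space[of D M] by auto
    have "(LINT x:D \<union> (space M - D)|M. g x) = (LINT x:D|M. g x) + (LINT x:space M - D|M. g x)"
      by (rule set_integral_Un[OF _ si[OF D(1)] si[OF sets.compl_sets[OF D(1)]]]) auto
    moreover have "D \<union> (space M - D) = space M"
      using D by auto
    ultimately show ?case
      using tot' compl by simp
  next
    case (union D)
    have DQ: "D i \<in> sets M" for i
      using union GQ by auto
    have "(LINT x:(\<Union>i. D i)|M. g x) = (\<Sum>i. LINT x:D i|M. g x)"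
    proof (rule lebesgue_integral_countable_add[OF DQ])
      show "set_integrable M (\<Union>i. D i) g"
        by (rule si) (use DQ in auto)
    qed (use union in \<open>auto simp: disjoint_family_on_def\<close>)
    then show ?case
      using union by simp
  qed
qed

section \<open>Cylinders and Walsh coefficients\<close>

context triplet
begin

definition coin :: "nat \<Rightarrow> sample \<Rightarrow> int" where
  "coin k x = snd x (the (S k (fst x)))"

lemma coin_cases: "x \<in> \<Omega>M \<Longrightarrow> coin k x = -1 \<or> coin k x = 1"
  unfolding coin_def by (rule sign_cases) (simp_all add: S_in_M fst_\<Omega>M)

lemma coin_flip: "x \<in> \<Omega>M \<Longrightarrow> coin j (flip k I x) = (if j = k \<and> the (S k (fst x)) \<notin> I then - coin j x else coin j x)"
  using snd_flip_coin[of x k I j] by (simp add: coin_def)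

lemma S_M: "\<omega> \<in> \<Omega>\<^sub>1 \<Longrightarrow> S k \<omega> \<in> Some ` M \<omega>"
  using S_in_M[of \<omega> k] Some_S[of \<omega> k] by force

text \<open>Only the value 1 is prescribed. As a sign has two values, these events still generate,
  and prescribing one value makes them intersection-stable without a case distinction.\<close>

definition cylinder :: "(real \<Rightarrow> real) set \<Rightarrow> nat set \<Rightarrow> sample set" where
  "cylinder H A = {x \<in> \<Omega>M. fst x \<in> H \<and> (\<forall>k\<in>A. coin k x = 1)}"

lemma coin_sets: "{x \<in> \<Omega>M. coin k x \<in> D} \<in> sets Q"
  unfolding coin_def by (rule sign_event[OF S_meas S_inj S_M])

lemma coin_measurable: "coin k \<in> Q \<rightarrow>\<^sub>M count_space UNIV"
proof (rule measurableI)
  fix D :: "int set"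
  show "coin k -` D \<inter> space Q \<in> sets Q"
    using coin_sets[of k D] by (simp add: vimage_def Int_def conj_commute)
qed simp

lemma real_coin_measurable [measurable]: "(\<lambda>x. real_of_int (coin k x)) \<in> borel_measurable Q"
  by (rule measurable_compose[OF coin_measurable]) simp

lemma cylinder_sets:
  assumes H: "H \<in> sets W" and A: "finite A"
  shows "cylinder H A \<in> sets Q"
proof -
  have [measurable]: "Measurable.pred Q (\<lambda>x. coin k x = 1)" for k
    using coin_sets[of k "{1}"] by (simp add: pred_def)
  have [measurable]: "Measurable.pred Q (\<lambda>x. fst x \<in> H)"
    using fst_event[OF H] by (simp add: pred_def)
  have "{x \<in> space Q. fst x \<in> H \<and> (\<forall>k\<in>A. coin k x = 1)} \<in> sets Q"
    using A by measurable
  then show ?thesis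
    by (simp add: cylinder_def)
qed

definition cylinders :: "sample set set" where
  "cylinders = {cylinder H A | H A. H \<in> sets W \<and> finite A}"

lemma cylindersI: "H \<in> sets W \<Longrightarrow> finite A \<Longrightarrow> cylinder H A \<in> cylinders"
  unfolding cylinders_def by blast

lemma cylindersE:
  assumes "a \<in> cylinders" obtains H A where "a = cylinder H A" "H \<in> sets W" "finite A"
  using assms unfolding cylinders_def by blast

lemma cylinders_Q: "cylinders \<subseteq> sets Q"
  by (auto elim!: cylindersE intro: cylinder_sets)

lemma Int_stable_cylinders: "Int_stable cylinders"
proof (rule Int_stableI)
  fix a b assume a: "a \<in> cylinders" and b: "b \<in> cylinders"
  obtain H A where a: "a = cylinder H A" "H \<in> sets W" "finite A"
    using a by (rule cylindersE)
  obtain H' A' where b: "b = cylinder H' A'" "H' \<in> sets W" "finite A'"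
    using b by (rule cylindersE)
  have "a \<inter> b = cylinder (H \<inter> H') (A \<union> A')"
    by (auto simp: cylinder_def a b)
  then show "a \<inter> b \<in> cylinders"
    using a b by (simp add: cylindersI)
qed

lemma sets_E_cylinders: "sets E \<subseteq> sigma_sets \<Omega>M cylinders"
proof
  let ?L = "sigma \<Omega>M cylinders"
  have G: "cylinders \<subseteq> Pow \<Omega>M"
    by (auto elim!: cylindersE simp: cylinder_def)
  have L: "space ?L = \<Omega>M" "sets ?L = sigma_sets \<Omega>M cylinders"
    using G by (simp_all add: space_measure_of sets_measure_of)
  have cyl: "H \<in> sets W \<Longrightarrow> finite A \<Longrightarrow> cylinder H A \<in> sets ?L" for H A
    unfolding L by (rule sigma_sets.Basic[OF cylindersI])
  have f: "fst \<in> ?L \<rightarrow>\<^sub>M W"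
  proof (rule measurableI)
    fix H assume "H \<in> sets W"
    then have "cylinder H {} \<in> sets ?L"
      by (rule cyl) simp
    then show "fst -` H \<inter> space ?L \<in> sets ?L"
      by (simp add: cylinder_def L(1) vimage_def Int_def conj_commute)
  qed (use fst_\<Omega>M in \<open>simp add: L(1)\<close>)
  have 1: "{x \<in> \<Omega>M. coin k x = 1} \<in> sets ?L" for k
  proof -
    have "cylinder (space W) {k} \<in> sets ?L"
      by (rule cyl[OF sets.top]) simp
    also have "cylinder (space W) {k} = {x \<in> \<Omega>M. coin k x = 1}"
      using fst_\<Omega>M by (auto simp: cylinder_def)
    finally show ?thesis .
  qed
  have c: "(\<lambda>x. coin k x) \<in> ?L \<rightarrow>\<^sub>M uniform_count_measure {-1, 1}" for k
  proof (rule measurableI)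
    fix D :: "int set"
    have "coin k -` D \<inter> space ?L =
        (if 1 \<in> D then {x \<in> \<Omega>M. coin k x = 1} else {}) \<union> (if -1 \<in> D then \<Omega>M - {x \<in> \<Omega>M. coin k x = 1} else {})"
    proof (rule set_eqI)
      fix x
      show "x \<in> coin k -` D \<inter> space ?L \<longleftrightarrow> x \<in> (if 1 \<in> D then {x \<in> \<Omega>M. coin k x = 1} else {}) \<union>
          (if -1 \<in> D then \<Omega>M - {x \<in> \<Omega>M. coin k x = 1} else {})"
        using coin_cases[of x k] by (cases "x \<in> \<Omega>M") (auto simp: L(1))
    qed
    moreover have "\<Omega>M - {x \<in> \<Omega>M. coin k x = 1} \<in> sets ?L"
      using sets.compl_sets[OF 1[of k]] by (simp add: L(1))
    ultimately show "coin k -` D \<inter> space ?L \<in> sets ?L"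
      using 1[of k] by auto
  qed (use coin_cases in \<open>auto simp: L(1) space_uniform_count_measure\<close>)
  have "(\<lambda>x. (fst x, \<lambda>k. coin k x)) \<in> ?L \<rightarrow>\<^sub>M B"
    unfolding B_eq
  proof (rule measurable_Pair)
    show "fst \<in> ?L \<rightarrow>\<^sub>M restrict_space W \<Omega>\<^sub>1"
      using f fst_\<Omega>M by (intro measurable_restrict_space2) (auto simp: L(1))
    show "(\<lambda>x. \<lambda>k. coin k x) \<in> ?L \<rightarrow>\<^sub>M coins"
    proof (rule measurable_PiM_single')
      show "(\<lambda>x k. coin k x) \<in> space ?L \<rightarrow> (\<Pi>\<^sub>E i\<in>UNIV. space (uniform_count_measure {-1, 1}))"
        unfolding space_uniform_count_measure PiE_UNIV_domain L(1)
        by (intro Pi_I) (use coin_cases in blast)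
    qed (rule c)
  qed
  moreover have "(\<lambda>x. (fst x, \<lambda>k. coin k x)) = \<Theta> S"
    by (rule ext, rule prod_eqI) (simp_all add: fun_eq_iff coin_def)
  ultimately have \<Theta>: "\<Theta> S \<in> ?L \<rightarrow>\<^sub>M B"
    by simp
  fix D assume "D \<in> sets E"
  then obtain D' where D': "D' \<in> sets B" "D = \<Theta> S -` D' \<inter> \<Omega>M"
    using sets_E by blast
  show "D \<in> sigma_sets \<Omega>M cylinders"
    using measurable_sets[OF \<Theta> D'(1)] unfolding L D'(2) .
qed

lemma AE_eq_0_cylinders:
  fixes g :: "sample \<Rightarrow> real"
  assumes g: "integrable Q g"
    and z: "\<And>H A. H \<in> sets W \<Longrightarrow> finite A \<Longrightarrow> (LINT x:cylinder H A|Q. g x) = 0"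
  shows "AE x in Q. g x = 0"
proof (rule Q.AE_eq_0_if_set_integrals_0[OF g])
  have si: "set_integrable Q D g" if "D \<in> sets Q" for D
    unfolding set_integrable_def by (rule integrable_mult_indicator[OF that g])
  have "cylinder (space W) {} = space Q"
    using fst_\<Omega>M by (auto simp: cylinder_def)
  then have "(LINT x:space Q|Q. g x) = 0"
    using z[OF sets.top, of "{}"] by (simp only: finite.emptyI)
  then have tot: "(\<integral>x. g x \<partial>Q) = 0"
    unfolding set_integral_space[OF g] .
  have E: "(LINT x:D|Q. g x) = 0" if "D \<in> sigma_sets \<Omega>M cylinders" for D
  proof (rule Q.set_integral_eq_0_sigma_sets[OF g Int_stable_cylinders cylinders_Q _ tot])
    show "(LINT x:C|Q. g x) = 0" if "C \<in> cylinders" for C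
      using that by (rule cylindersE) (simp only: z)
    show "D \<in> sigma_sets (space Q) cylinders"
      using that by simp
  qed
  fix D assume D: "D \<in> sets Q"
  then have Dc: "D \<in> sets (completion E)"
    by (simp add: Q_eq)
  \<comment> \<open>Cylinders generate the uncompleted field only; an event of the completion is
    replaced by an almost surely equal one.\<close>
  let ?D = "main_part E D"
  have mE: "?D \<in> sets E"
    by (rule main_part_sets[OF Dc])
  have "(LINT x:D|Q. g x) = (LINT x:?D|Q. g x)"
    unfolding set_lebesgue_integral_def
  proof (rule integral_cong_AE)
    have mQ: "?D \<in> sets Q"
      using mE by (simp add: Q_eq)
    show "(\<lambda>x. indicator D x *\<^sub>R g x) \<in> borel_measurable Q" "(\<lambda>x. indicator ?D x *\<^sub>R g x) \<in> borel_measurable Q"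
      using si[OF D] si[OF mQ] by (auto simp: set_integrable_def)
    have "AE x in Q. x \<in> ?D \<longleftrightarrow> x \<in> D"
      by (subst Q_eq) (rule AE_completion[OF AE_in_main_part[OF Dc]])
    then show "AE x in Q. indicator D x *\<^sub>R g x = indicator ?D x *\<^sub>R g x"
      by eventually_elim (auto simp: indicator_def)
  qed
  also have "\<dots> = 0"
    by (rule E[OF subsetD[OF sets_E_cylinders mE]])
  finally show "(LINT x:D|Q. g x) = 0" .
qed

text \<open>The flip preserves the law, fixes \<open>f\<close> almost surely and the cylinder (as k
  is not in \<open>A\<close>), and reverses coin k on it (as the point lies outside \<open>I\<close>
  there). So the integral equals its own negative.\<close>

lemma set_integral_flip_0:
  fixes f :: "sample \<Rightarrow> real"
  assumes I: "I \<in> sets borel" and f: "integrable Q f" and inv: "AE x in Q. f (flip k I x) = f x"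
    and H: "H \<in> sets W" "\<And>\<omega>. \<omega> \<in> H \<Longrightarrow> the (S k \<omega>) \<notin> I" and A: "finite A" "k \<notin> A"
  shows "(LINT x:cylinder H A|Q. f x * coin k x) = 0"
proof -
  let ?h = "\<lambda>x. indicator (cylinder H A) x *\<^sub>R (f x * coin k x)"
  have [measurable]: "f \<in> borel_measurable Q" "cylinder H A \<in> sets Q"
    using f cylinder_sets[OF H(1) A(1)] by auto
  have h: "?h \<in> borel_measurable Q"
    by measurable
  have "(\<integral>x. ?h x \<partial>Q) = (\<integral>x. ?h x \<partial>distr Q Q (flip k I))"
    by (simp only: flip_Q(2)[OF I])
  also have "\<dots> = (\<integral>x. ?h (flip k I x) \<partial>Q)"
    by (rule integral_distr[OF flip_Q(1)[OF I] h])
  also have "\<dots> = (\<integral>x. - ?h x \<partial>Q)"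
  proof (rule integral_cong_AE)
    show "(\<lambda>x. ?h (flip k I x)) \<in> borel_measurable Q"
      by (rule measurable_compose[OF flip_Q(1)[OF I] h])
    show "(\<lambda>x. - ?h x) \<in> borel_measurable Q"
      using h by (rule borel_measurable_uminus)
    show "AE x in Q. ?h (flip k I x) = - ?h x"
      using inv AE_Q_\<Omega>M
    proof eventually_elim
      case (elim x)
      have "coin j (flip k I x) = coin j x" if "j \<in> A" for j
        using that A(2) by (auto simp: coin_flip[OF elim(2)])
      then have c: "flip k I x \<in> cylinder H A \<longleftrightarrow> x \<in> cylinder H A"
        using elim(2) flip_in[OF elim(2)] by (auto simp: cylinder_def)
      show ?case
      proof (cases "x \<in> cylinder H A")
        case True
        then have "the (S k (fst x)) \<notin> I"
          using H(2) by (auto simp: cylinder_def)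
        then show ?thesis
          using c elim True by (simp add: coin_flip)
      qed (simp add: c)
    qed
  qed
  also have "\<dots> = - (\<integral>x. ?h x \<partial>Q)"
    by (rule Bochner_Integration.integral_minus)
  finally show ?thesis
    by (simp add: set_lebesgue_integral_def)
qed

lemma integrable_coin:
  fixes g :: "sample \<Rightarrow> real"
  assumes g: "integrable Q g" shows "integrable Q (\<lambda>x. g x * coin k x)"
proof (rule Bochner_Integration.integrable_bound[OF g])
  show "(\<lambda>x. g x * coin k x) \<in> borel_measurable Q"
    using g by measurable
  show "AE x in Q. norm (g x * coin k x) \<le> norm (g x)"
    using AE_Q_\<Omega>M
  proof eventually_elim
    case (elim x)
    then show ?case
      using coin_cases[OF elim, of k] by (auto simp: abs_mult)
  qed
qed

text \<open>The indicator of \<open>coin k = 1\<close> is (1 + \<open>coin k\<close>) / 2. Adding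
  one sign condition at a time thus reduces all cylinders to the path events and to integrals with a
  factor \<open>coin k\<close>.\<close>

lemma AE_eq_0_coins:
  fixes g :: "sample \<Rightarrow> real"
  assumes g: "integrable Q g"
    and z: "\<And>H. H \<in> sets W \<Longrightarrow> (LINT x:cylinder H {}|Q. g x) = 0"
    and s: "\<And>H A k. H \<in> sets W \<Longrightarrow> finite A \<Longrightarrow> k \<notin> A \<Longrightarrow> (LINT x:cylinder H A|Q. g x * coin k x) = 0"
  shows "AE x in Q. g x = 0"
proof (rule AE_eq_0_cylinders[OF g])
  fix H and A :: "nat set" assume H: "H \<in> sets W" and "finite A"
  from this(2) show "(LINT x:cylinder H A|Q. g x) = 0"
  proof (induction A)
    case empty
    show ?case
      by (rule z[OF H])
  next
    case (insert k A)
    note gc = integrable_coin[OF g, of k]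
    have c: "cylinder H A \<in> sets Q"
      by (rule cylinder_sets[OF H insert.hyps(1)])
    have si: "set_integrable Q (cylinder H A) (\<lambda>x. g x / 2)"
      "set_integrable Q (cylinder H A) (\<lambda>x. g x * coin k x / 2)"
      unfolding set_integrable_def by (rule integrable_mult_indicator[OF c], use g gc in simp)+
    have "(LINT x:cylinder H (insert k A)|Q. g x) = (LINT x:cylinder H A|Q. g x / 2 + g x * coin k x / 2)"
      unfolding set_lebesgue_integral_def
    proof (rule Bochner_Integration.integral_cong[OF refl])
      fix x assume "x \<in> space Q"
      then have "coin k x = -1 \<or> coin k x = 1"
        using coin_cases[of x k] by simp
      then show "indicator (cylinder H (insert k A)) x *\<^sub>R g x =
          indicator (cylinder H A) x *\<^sub>R (g x / 2 + g x * coin k x / 2)"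
        by (auto simp: cylinder_def indicator_def)
    qed
    also have "\<dots> = (LINT x:cylinder H A|Q. g x / 2) + (LINT x:cylinder H A|Q. g x * coin k x / 2)"
      by (rule set_integral_add(2)[OF si])
    also have "\<dots> = (LINT x:cylinder H A|Q. g x) / 2 + (LINT x:cylinder H A|Q. g x * coin k x) / 2"
      by simp
    also have "\<dots> = 0"
      using insert.IH s[OF H insert.hyps] by simp
    finally show ?case .
  qed
qed

text \<open>A product measure is determined by its rectangles. With \<open>law_rectangle\<close>
  supplying their values, this yields invariance under the shift and, later, under scaling of
  paths.\<close>

lemma measure_preserving_rectangles:
  assumes L: "complete_measure L" "prob_space L" and \<phi>: "\<And>x. x \<in> space L \<Longrightarrow> \<phi> x \<in> \<Omega>M"
    and m: "\<And>A c. A \<in> sets W \<Longrightarrow> c \<in> sets coins \<Longrightarrow> {x \<in> space L. fst (\<phi> x) \<in> A \<and> snd (\<Theta> S (\<phi> x)) \<in> c} \<in> sets L"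
    and d: "\<And>A c. A \<in> sets W \<Longrightarrow> c \<in> sets coins \<Longrightarrow>
      measure L {x \<in> space L. fst (\<phi> x) \<in> A \<and> snd (\<Theta> S (\<phi> x)) \<in> c} = measure W A * measure coins c"
  shows "\<phi> \<in> L \<rightarrow>\<^sub>M Q" and "distr L Q \<phi> = Q"
proof -
  interpret L: prob_space L by fact
  have sp: "snd (\<Theta> S (\<phi> x)) \<in> space coins" if "x \<in> space L" for x
  proof -
    have "snd (\<Theta> S (\<phi> x)) k = -1 \<or> snd (\<Theta> S (\<phi> x)) k = 1" for k
      using coin_cases[OF \<phi>[OF that], of k] by (simp add: coin_def)
    then show ?thesis
      unfolding space_coins by blast
  qed
  have fo: "fst (\<phi> x) \<in> \<Omega>\<^sub>0" "fst (\<phi> x) \<in> \<Omega>\<^sub>1" if "x \<in> space L" for x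
    using fst_\<Omega>M[OF \<phi>[OF that]] by simp_all
  have \<Theta>m: "(\<lambda>x. \<Theta> S (\<phi> x)) \<in> L \<rightarrow>\<^sub>M B"
    unfolding B_eq
  proof (rule measurable_pair)
    have "(\<lambda>x. fst (\<phi> x)) \<in> L \<rightarrow>\<^sub>M W"
    proof (rule measurableI)
      fix A assume "A \<in> sets W"
      from m[OF this sets.top] show "(\<lambda>x. fst (\<phi> x)) -` A \<inter> space L \<in> sets L"
        by (rule back_subst[of "\<lambda>D. D \<in> sets L"]) (use sp in auto)
    qed (use fo in simp)
    then show "fst \<circ> (\<lambda>x. \<Theta> S (\<phi> x)) \<in> L \<rightarrow>\<^sub>M restrict_space W \<Omega>\<^sub>1"
      using fo by (intro measurable_restrict_space2) (auto simp: comp_def)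
    show "snd \<circ> (\<lambda>x. \<Theta> S (\<phi> x)) \<in> L \<rightarrow>\<^sub>M coins"
      unfolding comp_def
    proof (rule measurableI)
      fix c assume "c \<in> sets coins"
      from m[OF sets.top this] show "(\<lambda>x. snd (\<Theta> S (\<phi> x))) -` c \<inter> space L \<in> sets L"
        by (rule back_subst[of "\<lambda>D. D \<in> sets L"]) (use fo in auto)
    qed (rule sp)
  qed
  have "B = distr L B (\<lambda>x. \<Theta> S (\<phi> x))"
    unfolding B_eq
  proof (rule pair_measure_eqI[OF R.sigma_finite_measure_axioms C.sigma_finite_measure_axioms])
    fix A c assume A: "A \<in> sets (restrict_space W \<Omega>\<^sub>1)" and c: "c \<in> sets coins"
    have AW: "A \<in> sets W" "A \<subseteq> \<Omega>\<^sub>1"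
      using A \<Omega>\<^sub>1_sets \<Omega>\<^sub>1_subset by (auto simp: sets_restrict_space_iff Int_absorb2)
    have "emeasure (restrict_space W \<Omega>\<^sub>1) A * emeasure coins c = emeasure W A * emeasure coins c"
      using AW \<Omega>\<^sub>1_sets \<Omega>\<^sub>1_subset by (simp add: emeasure_restrict_space Int_absorb2)
    also have "\<dots> = emeasure L {x \<in> space L. fst (\<phi> x) \<in> A \<and> snd (\<Theta> S (\<phi> x)) \<in> c}"
      using d[OF AW(1) c] by (simp add: W.emeasure_eq_measure L.emeasure_eq_measure C.emeasure_eq_measure ennreal_mult)
    also have "{x \<in> space L. fst (\<phi> x) \<in> A \<and> snd (\<Theta> S (\<phi> x)) \<in> c} = (\<lambda>x. \<Theta> S (\<phi> x)) -` (A \<times> c) \<inter> space L"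
      by (rule set_eqI) (simp only: mem_Collect_eq vimage_eq Int_iff mem_Times_iff fst_\<Theta>, blast)
    also have "emeasure L \<dots> = emeasure (distr L B (\<lambda>x. \<Theta> S (\<phi> x))) (A \<times> c)"
      using A c by (intro emeasure_distr[symmetric] \<Theta>m) (auto simp: B_eq)
    finally show "emeasure (restrict_space W \<Omega>\<^sub>1) A * emeasure coins c =
        emeasure (distr L (restrict_space W \<Omega>\<^sub>1 \<Otimes>\<^sub>M coins) (\<lambda>x. \<Theta> S (\<phi> x))) (A \<times> c)"
      by (simp add: B_eq)
  qed simp
  from measure_preserving_Q[OF L(1) \<phi> \<Theta>m this[symmetric]]
  show "\<phi> \<in> L \<rightarrow>\<^sub>M Q" and "distr L Q \<phi> = Q"
    by auto
qed

lemma M_shift: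
  assumes "\<omega> \<in> \<Omega>\<^sub>0" shows "r \<in> M (\<Delta> h \<omega>) \<longleftrightarrow> r + h \<in> M \<omega>"
proof -
  have "M \<omega> = (\<lambda>x. h + x) ` M (\<Delta> h \<omega>)"
    using M_stationary assms by (simp add: perfectly_stationary_def)
  then show ?thesis
    by (auto simp: add.commute)
qed

lemma fst_shift_M [simp]: "fst (shift_M h x) = \<Delta> h (fst x)" and snd_shift_M [simp]: "snd (shift_M h x) r = snd x (r + h)"
  by (simp_all add: shift_M_def split_beta)

text \<open>Shifted signs are the original signs read along \<open>S'\<close>, the points listed for
  the shifted path and moved back by h. By stationarity these are points of the original set, so
  this is another injective list and \<open>law_rectangle\<close> applies.\<close>

lemma shift_Q: "shift_M h \<in> Q \<rightarrow>\<^sub>M Q" "distr Q Q (shift_M h) = Q"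
proof -
  define S' where "S' k \<omega> = Some (the (S k (\<Delta> h \<omega>)) + h)" for k \<omega>
  have m: "S' k \<in> W \<rightarrow>\<^sub>M borel_dagger" for k
  proof -
    have "(\<lambda>\<omega>. the (S k (\<Delta> h \<omega>))) \<in> borel_measurable W"
      by (rule measurable_compose[OF \<Delta>_W(1) borel_daggerD(3)[OF S_meas]])
    then show ?thesis
      unfolding S'_def by (intro Some_measurable borel_measurable_add) simp_all
  qed
  have \<Delta>1: "\<Delta> h \<omega> \<in> \<Omega>\<^sub>1" if "\<omega> \<in> \<Omega>\<^sub>1" for \<omega>
    using that \<Omega>\<^sub>1_shift \<Omega>\<^sub>1_subset by auto
  have inj: "inj (\<lambda>k. S' k \<omega>)" if "\<omega> \<in> \<Omega>\<^sub>1" for \<omega>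
  proof (rule injI)
    fix j k assume "S' j \<omega> = S' k \<omega>"
    then have "Some (the (S j (\<Delta> h \<omega>))) = Some (the (S k (\<Delta> h \<omega>)))"
      by (simp add: S'_def)
    then have "S j (\<Delta> h \<omega>) = S k (\<Delta> h \<omega>)"
      unfolding Some_S[OF \<Delta>1[OF that]] .
    then show "j = k"
      by (rule injD[OF S_inj[OF \<Delta>1[OF that]]])
  qed
  have sub: "S' k \<omega> \<in> Some ` M \<omega>" if "\<omega> \<in> \<Omega>\<^sub>1" for k \<omega>
    using S_in_M[OF \<Delta>1[OF that], of k] M_shift[of \<omega> _ h] that \<Omega>\<^sub>1_subset by (auto simp: S'_def)
  have eq: "{x \<in> space Q. fst (shift_M h x) \<in> A \<and> snd (\<Theta> S (shift_M h x)) \<in> c} =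
      {x \<in> \<Omega>M. fst x \<in> \<Delta> h -` A \<inter> space W \<and> snd (\<Theta> S' x) \<in> c}" for A c
  proof -
    have "snd (\<Theta> S (shift_M h x)) = snd (\<Theta> S' x)" for x
      by (rule ext) (simp add: S'_def)
    then show ?thesis
      using fst_\<Omega>M by auto
  qed
  have in\<Omega>: "shift_M h x \<in> \<Omega>M" if "x \<in> space Q" for x
    using that \<Delta>1[of "fst x"] M_shift[of "fst x" _ h] fst_\<Omega>M[of x]
    by (auto simp: \<Omega>M_iff PiE_iff extensional_def)
  have pre: "\<Delta> h -` A \<inter> space W \<in> sets W" "measure W (\<Delta> h -` A \<inter> space W) = measure W A" if "A \<in> sets W" for A
    using measurable_sets[OF \<Delta>_W(1) that, of h] measure_distr[OF \<Delta>_W(1) that, of h] by (simp_all add: \<Delta>_W(2))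
  have rect: "{x \<in> space Q. fst (shift_M h x) \<in> A \<and> snd (\<Theta> S (shift_M h x)) \<in> c} \<in> sets Q"
    "measure Q {x \<in> space Q. fst (shift_M h x) \<in> A \<and> snd (\<Theta> S (shift_M h x)) \<in> c} = measure W A * measure coins c"
    if "A \<in> sets W" "c \<in> sets coins" for A c
    unfolding eq pre(2)[OF that(1), symmetric]
    by (rule law_rectangle(1)[OF m inj sub pre(1)[OF that(1)] that(2)], assumption+,
        rule law_rectangle(2)[OF m inj sub pre(1)[OF that(1)] that(2)], assumption+)
  note mp = measure_preserving_rectangles[OF Q.complete_measure_axioms Q.prob_space_axioms]
  show "shift_M h \<in> Q \<rightarrow>\<^sub>M Q"
    by (rule mp(1)) (erule in\<Omega> | rule rect, assumption+)+
  show "distr Q Q (shift_M h) = Q"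
    by (rule mp(2)) (erule in\<Omega> | rule rect, assumption+)+
qed

end

section \<open>Brownian copies inside the noise\<close>

text \<open>The deviation f x - x * f 1 is the same, up to sign, for x and for the distance from x
  to the next integer, hence at most 2 everywhere. At x = n * a it is n times the deviation at a,
  which must be 0.\<close>

lemma additive_bounded_imp_linear:
  fixes f :: "real \<Rightarrow> real"
  assumes add: "\<And>a b. 0 < a \<Longrightarrow> 0 < b \<Longrightarrow> f (a + b) = f a + f b"
    and bound: "\<And>a. 0 < a \<Longrightarrow> \<bar>f a\<bar> \<le> a" and a: "0 < a"
  shows "f a = a * f 1"
proof -
  have mult: "f (real (Suc n) * b) = real (Suc n) * f b" if "0 < b" for n b
  proof (induction n)
    case (Suc n)
    have "real (Suc (Suc n)) * b = real (Suc n) * b + b"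
      by (simp add: algebra_simps)
    moreover have "0 < real (Suc n) * b"
      using that by simp
    ultimately have "f (real (Suc (Suc n)) * b) = f (real (Suc n) * b) + f b"
      using add[of "real (Suc n) * b" b] that by simp
    then show ?case
      using Suc by (simp add: algebra_simps)
  qed simp
  have *: "real (Suc n) * \<bar>f a - a * f 1\<bar> \<le> 2" for n
  proof -
    let ?x = "real (Suc n) * a"
    define m where "m = nat \<lfloor>?x\<rfloor>"
    have x: "0 < ?x"
      using a by simp
    have m: "real m \<le> ?x" "?x < real (Suc m)"
      unfolding m_def using x by linarith+
    \<comment> \<open>Measured to the integer strictly above, so that \<open>r\<close> is positive
      even if \<open>?x\<close> is an integer; additivity is known for positive arguments
      only.\<close>
    define r where "r = real (Suc m) - ?x"
    have r: "0 < r" "r \<le> 1"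
      using m by (auto simp: r_def)
    have "real (Suc m) * f 1 = f ?x + f r"
      using add[OF x r(1)] mult[of 1 m] by (simp add: r_def)
    then have "?x * f 1 - f ?x = f r - r * f 1"
      by (simp add: r_def algebra_simps)
    moreover have "\<bar>f r\<bar> \<le> 1" "\<bar>r * f 1\<bar> \<le> 1"
      using bound[OF r(1)] bound[of 1] r mult_mono[of r 1 "\<bar>f 1\<bar>" 1] by (auto simp: abs_mult)
    ultimately have "\<bar>?x * f 1 - f ?x\<bar> \<le> 2"
      by linarith
    moreover have "?x * f 1 - f ?x = - (real (Suc n) * (f a - a * f 1))"
      using mult[OF a, of n] by (simp add: algebra_simps)
    ultimately show ?thesis
      by (simp only: abs_minus_cancel abs_mult abs_of_nat)
  qed
  have "\<bar>f a - a * f 1\<bar> \<le> 0"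
  proof (rule ccontr)
    assume "\<not> \<bar>f a - a * f 1\<bar> \<le> 0"
    then obtain n where "2 < real n * \<bar>f a - a * f 1\<bar>"
      using reals_Archimedean3[of "\<bar>f a - a * f 1\<bar>"] by auto
    moreover have "real n * \<bar>f a - a * f 1\<bar> \<le> real (Suc n) * \<bar>f a - a * f 1\<bar>"
      by (intro mult_right_mono) auto
    ultimately show False
      using *[of n] by linarith
  qed
  then show ?thesis
    by simp
qed

text \<open>The inequality (x + y)^2 <= 2 (x^2 + y^2) is used twice, the first time squared, whence
  the constant 4 * 2.\<close>

lemma pow4_sub_le:
  fixes a b c :: real
  assumes "\<bar>c\<bar> \<le> 1"
  shows "(a - c * b) ^ 4 \<le> 8 * (a ^ 4 + b ^ 4)"
proof -
  have sq: "(x - y)\<^sup>2 \<le> 2 * (x\<^sup>2 + y\<^sup>2)" for x y :: real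
    using zero_le_power2[of "x + y"] by (simp add: power2_eq_square algebra_simps)
  have sq': "(x + y)\<^sup>2 \<le> 2 * (x\<^sup>2 + y\<^sup>2)" for x y :: real
    using zero_le_power2[of "x - y"] by (simp add: power2_eq_square algebra_simps)
  have "(c * b)\<^sup>2 \<le> b\<^sup>2"
    using mult_right_mono[of "c\<^sup>2" 1 "b\<^sup>2"] assms by (simp add: power_mult_distrib abs_square_le_1)
  then have "(a - c * b)\<^sup>2 \<le> 2 * (a\<^sup>2 + b\<^sup>2)"
    using sq[of a "c * b"] by simp
  then have "((a - c * b)\<^sup>2)\<^sup>2 \<le> (2 * (a\<^sup>2 + b\<^sup>2))\<^sup>2"
    by (intro power_mono) auto
  also have "(2 * (a\<^sup>2 + b\<^sup>2))\<^sup>2 = 4 * (a\<^sup>2 + b\<^sup>2)\<^sup>2"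
    by (simp only: power_mult_distrib) simp
  also have "\<dots> \<le> 8 * ((a\<^sup>2)\<^sup>2 + (b\<^sup>2)\<^sup>2)"
    using sq'[of "a\<^sup>2" "b\<^sup>2"] by linarith
  finally show ?thesis
    by (simp flip: power_mult)
qed

lemma iexp_taylor1: "cmod (iexp x - 1 - \<i> * x) \<le> x\<^sup>2 / 2"
  using iexp_approx1[of x 1] by (simp add: power2_eq_square fact_numeral diff_diff_eq)

lemma Int_stable_vimage: "Int_stable {f -` a \<inter> \<Omega> | a. a \<in> sets L}"
proof (rule Int_stableI)
  fix a b assume "a \<in> {f -` a \<inter> \<Omega> | a. a \<in> sets L}" "b \<in> {f -` a \<inter> \<Omega> | a. a \<in> sets L}"
  then obtain a' b' where "a = f -` a' \<inter> \<Omega>" "a' \<in> sets L" "b = f -` b' \<inter> \<Omega>" "b' \<in> sets L"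
    by blast
  then have "a \<inter> b = f -` (a' \<inter> b') \<inter> \<Omega>" "a' \<inter> b' \<in> sets L"
    by auto
  then show "a \<inter> b \<in> {f -` a \<inter> \<Omega> | a. a \<in> sets L}"
    by blast
qed

context triplet
begin

lemma outside_increment:
  assumes "s < t" "(u \<le> s \<and> v \<le> s) \<or> (t \<le> u \<and> t \<le> v)"
  shows "(\<lambda>\<omega>. \<omega> v - \<omega> u) \<in> borel_measurable (outside s t)"
proof -
  let ?p = "\<lambda>u. if u \<le> s then s else t"
  have "(\<lambda>\<omega>. (\<omega> v - \<omega> (?p v)) - (\<omega> u - \<omega> (?p u))) \<in> borel_measurable (outside s t)"
    using assms by (intro borel_measurable_diff increment_measurable[where p="?p"]) auto
  moreover have "?p v = ?p u"
    using assms by auto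
  ultimately show ?thesis
    by simp
qed

lemma outside_W:
  assumes g: "g \<in> outside s t \<rightarrow>\<^sub>M C" shows "g \<in> W \<rightarrow>\<^sub>M C"
proof (rule measurableI)
  fix A assume "A \<in> sets C"
  from sets_P_subset[OF subsetD[OF sets_increment_field_subset measurable_sets[OF g this]]]
  show "g -` A \<inter> space W \<in> sets W"
    by simp
qed (use measurable_space[OF g] in simp)

lemma N_indep_var:
  assumes st: "s < t" and f: "f \<in> NS (ereal s) (ereal t) \<rightarrow>\<^sub>M A" and g: "g \<in> outside s t \<rightarrow>\<^sub>M C"
  shows "Q.indep_var A f C (\<lambda>x. g (fst x))"
proof -
  have gf: "(\<lambda>x. g (fst x)) -` c \<inter> space Q = {x \<in> \<Omega>M. fst x \<in> g -` c \<inter> space (outside s t)}" for c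
    using fst_\<Omega>M by auto
  have fQ: "f \<in> Q \<rightarrow>\<^sub>M A"
    by (rule NS_Q[OF _ f]) (use st in simp)
  have gQ: "(\<lambda>x. g (fst x)) \<in> Q \<rightarrow>\<^sub>M C"
    by (rule measurable_compose[OF fst_measurable outside_W[OF g]])
  have "Q.indep_set {f -` a \<inter> space Q |a. a \<in> sets A} {(\<lambda>x. g (fst x)) -` c \<inter> space Q |c. c \<in> sets C}"
  proof (rule Q.indep_setI)
    show "{f -` a \<inter> space Q |a. a \<in> sets A} \<subseteq> sets Q"
      using measurable_sets[OF fQ] by blast
    show "{(\<lambda>x. g (fst x)) -` c \<inter> space Q |c. c \<in> sets C} \<subseteq> sets Q"
      using measurable_sets[OF gQ] by blast
    fix a b assume "a \<in> {f -` a \<inter> space Q |a. a \<in> sets A}"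
      and "b \<in> {(\<lambda>x. g (fst x)) -` c \<inter> space Q |c. c \<in> sets C}"
    then obtain a' c where a: "a = f -` a' \<inter> space Q" "a' \<in> sets A"
      and b: "b = (\<lambda>x. g (fst x)) -` c \<inter> space Q" "c \<in> sets C"
      by blast
    have "a \<in> N s t"
      using measurable_sets[OF f a(2)] by (simp add: a sets_NS)
    moreover have "b \<in> {{x \<in> \<Omega>M. fst x \<in> H} | H. H \<in> sets (outside s t)}"
      unfolding b(1) gf using measurable_sets[OF g b(2)] by blast
    ultimately show "measure Q (a \<inter> b) = measure Q a * measure Q b"
      by (rule Q.indep_setD[OF N_indep_outside[OF st]])
  qed
  from Q.indep_set_sigma_sets[OF this Int_stable_vimage Int_stable_vimage] fQ gQ
  show ?thesis
    unfolding Q.indep_var_eq by (intro conjI)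
qed

lemma distributed_copy:
  assumes f: "f \<in> Q \<rightarrow>\<^sub>M W" "distr Q W f = W" and st: "s < t"
  shows "distributed Q lborel (\<lambda>x. f x t - f x s) (normal_density 0 (sqrt (t - s)))"
proof -
  have m: "(\<lambda>\<omega>. \<omega> t - \<omega> s) \<in> borel_measurable W"
    by measurable
  have "distr Q lborel (\<lambda>x. f x t - f x s) = distr (distr Q W f) lborel (\<lambda>\<omega>. \<omega> t - \<omega> s)"
    using f m by (subst distr_distr) (auto simp: comp_def)
  then show ?thesis
    using distributed_increment_W[OF st] measurable_compose[OF f(1) m] f(2)
    by (simp add: distributed_def)
qed

end

section \<open>Covariance of a local copy with the path\<close>

locale brownian_copy = triplet +
  fixes \<xi> :: "sample \<Rightarrow> real \<Rightarrow> real"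
  assumes \<xi>_measurable: "\<xi> \<in> Q \<rightarrow>\<^sub>M W" and distr_\<xi>: "distr Q W \<xi> = W"
    and \<xi>_local: "\<And>s t. s < t \<Longrightarrow> (\<lambda>x. \<xi> x t - \<xi> x s) \<in> borel_measurable (NS (ereal s) (ereal t))"
    and \<xi>_shift: "\<And>h. AE x in Q. \<xi> (shift_M h x) = \<Delta> h (\<xi> x)"
begin

definition w :: "real \<Rightarrow> real \<Rightarrow> sample \<Rightarrow> real" where
  "w s t x = fst x t - fst x s"

definition z :: "real \<Rightarrow> real \<Rightarrow> sample \<Rightarrow> real" where
  "z s t x = \<xi> x t - \<xi> x s"

definition c :: real where
  "c = (\<integral>x. z 0 1 x * w 0 1 x \<partial>Q)"

text \<open>
  The part of the increments of \<open>\<xi>\<close> that is uncorrelated with the path; the aim is \<open>v = 0\<close>.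
\<close>
definition v :: "real \<Rightarrow> real \<Rightarrow> sample \<Rightarrow> real" where
  "v s t x = z s t x - c * w s t x"

lemma w_N: "s < t \<Longrightarrow> w s t \<in> borel_measurable (NS (ereal s) (ereal t))"
  unfolding w_def[abs_def] by (rule N_increment) auto

lemma z_N: "s < t \<Longrightarrow> z s t \<in> borel_measurable (NS (ereal s) (ereal t))"
  unfolding z_def[abs_def] by (rule \<xi>_local)

lemma v_N: "s < t \<Longrightarrow> v s t \<in> borel_measurable (NS (ereal s) (ereal t))"
  unfolding v_def[abs_def] by (intro borel_measurable_diff borel_measurable_times z_N w_N) auto

lemma fst_eval [measurable]: "(\<lambda>x. fst x t) \<in> borel_measurable Q"
  by (rule measurable_compose[OF fst_measurable eval_measurable_W])

lemma \<xi>_eval [measurable]: "(\<lambda>x. \<xi> x t) \<in> borel_measurable Q"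
  by (rule measurable_compose[OF \<xi>_measurable eval_measurable_W])

lemma w_Q [measurable]: "w s t \<in> borel_measurable Q" and z_Q [measurable]: "z s t \<in> borel_measurable Q"
  and v_Q [measurable]: "v s t \<in> borel_measurable Q"
  unfolding w_def[abs_def] z_def[abs_def] v_def[abs_def] by measurable

lemma copy_moments:
  assumes f: "f \<in> Q \<rightarrow>\<^sub>M W" "distr Q W f = W" and st: "s < t"
  shows "integrable Q (\<lambda>x. (f x t - f x s) ^ k)" and "(\<integral>x. f x t - f x s \<partial>Q) = 0"
    and "(\<integral>x. (f x t - f x s) ^ 2 \<partial>Q) = t - s" and "(\<integral>x. (f x t - f x s) ^ 4 \<partial>Q) = 3 * (t - s) ^ 2"
proof -
  have "sqrt (t - s) ^ 4 = (sqrt (t - s) ^ 2) ^ 2"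
    by (simp flip: power_mult)
  then have q: "sqrt (t - s) ^ 4 = (t - s) ^ 2"
    using st by simp
  note m = Q.normal_moments[OF distributed_copy[OF f st]]
  have pos: "0 < sqrt (t - s)"
    using st by simp
  show "integrable Q (\<lambda>x. (f x t - f x s) ^ k)" "(\<integral>x. f x t - f x s \<partial>Q) = 0"
    "(\<integral>x. (f x t - f x s) ^ 2 \<partial>Q) = t - s" "(\<integral>x. (f x t - f x s) ^ 4 \<partial>Q) = 3 * (t - s) ^ 2"
    using m[OF pos] st by (simp_all add: q)
qed

lemma w_moments:
  assumes "s < t"
  shows "integrable Q (\<lambda>x. w s t x ^ k)" "integrable Q (w s t)" "(\<integral>x. w s t x \<partial>Q) = 0"
    "(\<integral>x. w s t x ^ 2 \<partial>Q) = t - s" "(\<integral>x. w s t x ^ 4 \<partial>Q) = 3 * (t - s) ^ 2"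
  using copy_moments[OF fst_measurable distr_fst assms] copy_moments(1)[OF fst_measurable distr_fst assms, of 1]
  unfolding w_def[abs_def] by simp_all

lemma z_moments:
  assumes "s < t"
  shows "integrable Q (\<lambda>x. z s t x ^ k)" "integrable Q (z s t)" "(\<integral>x. z s t x \<partial>Q) = 0"
    "(\<integral>x. z s t x ^ 2 \<partial>Q) = t - s" "(\<integral>x. z s t x ^ 4 \<partial>Q) = 3 * (t - s) ^ 2"
  using copy_moments[OF \<xi>_measurable distr_\<xi> assms] copy_moments(1)[OF \<xi>_measurable distr_\<xi> assms, of 1]
  unfolding z_def[abs_def] by simp_all

lemma abs_mult_le_squares: "\<bar>a * b\<bar> \<le> (a\<^sup>2 + b\<^sup>2) / (2::real)"
  using sum_squares_bound[of "\<bar>a\<bar>" "\<bar>b\<bar>"] by (simp add: abs_mult)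

lemma zw_integrable:
  assumes "s < t" "s' < t'"
  shows "integrable Q (\<lambda>x. z s t x * w s' t' x)"
proof (rule Bochner_Integration.integrable_bound)
  show "integrable Q (\<lambda>x. (z s t x ^ 2 + w s' t' x ^ 2) / 2)"
    using z_moments(1)[OF assms(1), of 2] w_moments(1)[OF assms(2), of 2] by simp
  show "AE x in Q. norm (z s t x * w s' t' x) \<le> norm ((z s t x ^ 2 + w s' t' x ^ 2) / 2)"
    using abs_mult_le_squares by auto
qed measurable

lemma N_outside_integral:
  fixes f :: "sample \<Rightarrow> 'b::{real_normed_field, banach, second_countable_topology}"
  assumes "s < t" "f \<in> borel_measurable (NS (ereal s) (ereal t))" "g \<in> borel_measurable (outside s t)"
    and "integrable Q f" "integrable Q (\<lambda>x. g (fst x))"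
  shows "(\<integral>x. f x * g (fst x) \<partial>Q) = (\<integral>x. f x \<partial>Q) * (\<integral>x. g (fst x) \<partial>Q)"
  using Q.indep_var_lebesgue_integral[OF N_indep_var[OF assms(1-3)] assms(4-5)] .

lemma zw_shift:
  assumes a: "0 < a"
  shows "(\<integral>x. z h (h + a) x * w h (h + a) x \<partial>Q) = (\<integral>x. z 0 a x * w 0 a x \<partial>Q)"
proof -
  have m: "(\<lambda>x. z 0 a x * w 0 a x) \<in> borel_measurable Q"
    by measurable
  have "(\<integral>x. z 0 a x * w 0 a x \<partial>Q) = (\<integral>x. z 0 a x * w 0 a x \<partial>distr Q Q (shift_M h))"
    by (simp only: shift_Q)
  also have "\<dots> = (\<integral>x. z 0 a (shift_M h x) * w 0 a (shift_M h x) \<partial>Q)"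
    by (rule integral_distr[OF shift_Q(1) m])
  also have "\<dots> = (\<integral>x. z h (h + a) x * w h (h + a) x \<partial>Q)"
  proof (rule integral_cong_AE)
    show "(\<lambda>x. z 0 a (shift_M h x) * w 0 a (shift_M h x)) \<in> borel_measurable Q"
      by (rule measurable_compose[OF shift_Q(1) m])
    show "AE x in Q. z 0 a (shift_M h x) * w 0 a (shift_M h x) = z h (h + a) x * w h (h + a) x"
      using \<xi>_shift[of h] by eventually_elim (simp add: z_def w_def \<Delta>_def)
  qed measurable
  finally show ?thesis ..
qed

text \<open>On adjacent intervals the increment of \<xi> is local to the one and the path increment
  lies outside it; so they are independent, and both are centred.\<close>

lemma cross_0:
  assumes "s < t" "t < u"
  shows "(\<integral>x. z s t x * w t u x \<partial>Q) = 0" "(\<integral>x. z t u x * w s t x \<partial>Q) = 0"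
proof -
  have "(\<integral>x. z s t x * (fst x u - fst x t) \<partial>Q) = (\<integral>x. z s t x \<partial>Q) * (\<integral>x. fst x u - fst x t \<partial>Q)"
    using w_moments(2)[OF assms(2)]
    by (intro N_outside_integral[where g="\<lambda>\<omega>. \<omega> u - \<omega> t", OF assms(1) z_N[OF assms(1)]] outside_increment z_moments)
       (use assms in \<open>auto simp: w_def[abs_def]\<close>)
  then show "(\<integral>x. z s t x * w t u x \<partial>Q) = 0"
    by (simp add: w_def[abs_def] z_moments[OF assms(1)])
  have "(\<integral>x. z t u x * (fst x t - fst x s) \<partial>Q) = (\<integral>x. z t u x \<partial>Q) * (\<integral>x. fst x t - fst x s \<partial>Q)"
    using w_moments(2)[OF assms(1)]
    by (intro N_outside_integral[where g="\<lambda>\<omega>. \<omega> t - \<omega> s", OF assms(2) z_N[OF assms(2)]] outside_increment z_moments)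
       (use assms in \<open>auto simp: w_def[abs_def]\<close>)
  then show "(\<integral>x. z t u x * w s t x \<partial>Q) = 0"
    by (simp add: w_def[abs_def] z_moments[OF assms(2)])
qed

lemma zw_bound:
  assumes "s < t" shows "\<bar>\<integral>x. z s t x * w s t x \<partial>Q\<bar> \<le> t - s"
proof -
  have "\<bar>\<integral>x. z s t x * w s t x \<partial>Q\<bar> \<le> (\<integral>x. \<bar>z s t x * w s t x\<bar> \<partial>Q)"
    by (rule integral_abs_bound)
  also have "\<dots> \<le> (\<integral>x. (z s t x ^ 2 + w s t x ^ 2) / 2 \<partial>Q)"
    using zw_integrable[OF assms assms] z_moments(1)[OF assms, of 2] w_moments(1)[OF assms, of 2]
    by (intro integral_mono abs_mult_le_squares) auto
  also have "\<dots> = t - s"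
    using z_moments[OF assms] w_moments[OF assms] by simp
  finally show ?thesis .
qed

text \<open>The covariance depends on the length only, by stationarity; it is additive in the length
  because the cross terms vanish, and bounded by the length. Such a function is linear.\<close>

lemma zw_integral:
  assumes st: "s < t" shows "(\<integral>x. z s t x * w s t x \<partial>Q) = (t - s) * c"
proof -
  let ?K = "\<lambda>a. \<integral>x. z 0 a x * w 0 a x \<partial>Q"
  have "?K (t - s) = (t - s) * ?K 1"
  proof (rule additive_bounded_imp_linear[of ?K])
    fix a b :: real assume a: "0 < a" and b: "0 < b"
    have ab: "a < a + b" "0 < a + b"
      using a b by auto
    have "?K (a + b) = (\<integral>x. (z 0 a x * w 0 a x + z 0 a x * w a (a + b) x) +
        (z a (a + b) x * w 0 a x + z a (a + b) x * w a (a + b) x) \<partial>Q)"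
      by (rule Bochner_Integration.integral_cong[OF refl]) (simp add: z_def w_def algebra_simps)
    also have "\<dots> = ((\<integral>x. z 0 a x * w 0 a x \<partial>Q) + (\<integral>x. z 0 a x * w a (a + b) x \<partial>Q)) +
        ((\<integral>x. z a (a + b) x * w 0 a x \<partial>Q) + (\<integral>x. z a (a + b) x * w a (a + b) x \<partial>Q))"
      using zw_integrable[OF a a] zw_integrable[OF a ab(1)] zw_integrable[OF ab(1) a] zw_integrable[OF ab(1) ab(1)]
      by simp
    also have "\<dots> = ?K a + ?K b"
      using cross_0[OF a ab(1)] zw_shift[OF b, of a] by simp
    finally show "?K (a + b) = ?K a + ?K b" .
  next
    fix a :: real assume "0 < a"
    then show "\<bar>?K a\<bar> \<le> a"
      using zw_bound[of 0 a] by simp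
  qed (use st in simp)
  then show ?thesis
    using zw_shift[of "t - s" s] st by (simp add: c_def)
qed

lemma c_bound: "\<bar>c\<bar> \<le> 1"
  using zw_bound[of 0 1] by (simp add: c_def)

text \<open>The constants come from the moments t - s and 3 (t - s)^2 of the two normal increments:
  4 is 2 * (1 + 1) and 48 is 8 * (3 + 3). The last claim is the purpose of subtracting c times the
  path.\<close>

lemma v_moments:
  assumes st: "s < t"
  shows "integrable Q (\<lambda>x. v s t x ^ 2)" "integrable Q (\<lambda>x. v s t x ^ 4)" "integrable Q (v s t)"
    and "(\<integral>x. v s t x \<partial>Q) = 0" "(\<integral>x. v s t x ^ 2 \<partial>Q) \<le> 4 * (t - s)"
    and "(\<integral>x. v s t x ^ 4 \<partial>Q) \<le> 48 * (t - s) ^ 2"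
    and "integrable Q (\<lambda>x. v s t x * w s t x)" "(\<integral>x. v s t x * w s t x \<partial>Q) = 0"
proof -
  note zm = z_moments[OF st] and wm = w_moments[OF st] and zw = zw_integrable[OF st st]
  have v2: "v s t x ^ 2 \<le> 2 * (z s t x ^ 2 + w s t x ^ 2)" for x
  proof -
    have "(c * w s t x)\<^sup>2 \<le> (w s t x)\<^sup>2"
      using mult_right_mono[of "c\<^sup>2" 1 "(w s t x)\<^sup>2"] c_bound by (simp add: power_mult_distrib abs_square_le_1)
    moreover have "(z s t x - c * w s t x)\<^sup>2 \<le> 2 * ((z s t x)\<^sup>2 + (c * w s t x)\<^sup>2)"
      using zero_le_power2[of "z s t x + c * w s t x"] by (simp add: power2_eq_square algebra_simps)
    ultimately show ?thesis
      by (simp add: v_def)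
  qed
  have v4: "v s t x ^ 4 \<le> 8 * (z s t x ^ 4 + w s t x ^ 4)" for x
    unfolding v_def by (rule pow4_sub_le[OF c_bound])
  have i2: "integrable Q (\<lambda>x. 2 * (z s t x ^ 2 + w s t x ^ 2))" and i4: "integrable Q (\<lambda>x. 8 * (z s t x ^ 4 + w s t x ^ 4))"
    using zm(1) wm(1) by auto
  show I2: "integrable Q (\<lambda>x. v s t x ^ 2)"
    by (rule Bochner_Integration.integrable_bound[OF i2]) (use v2 in auto)
  show I4: "integrable Q (\<lambda>x. v s t x ^ 4)"
  proof (rule Bochner_Integration.integrable_bound[OF i4])
    show "AE x in Q. norm (v s t x ^ 4) \<le> norm (8 * (z s t x ^ 4 + w s t x ^ 4))"
      using v4 by (intro AE_I2) (simp add: abs_le_iff order_trans[OF _ v4])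
  qed measurable
  have "(\<integral>x. v s t x ^ 2 \<partial>Q) \<le> (\<integral>x. 2 * (z s t x ^ 2 + w s t x ^ 2) \<partial>Q)"
    by (rule integral_mono[OF I2 i2 v2])
  then show "(\<integral>x. v s t x ^ 2 \<partial>Q) \<le> 4 * (t - s)"
    using zm wm by simp
  have "(\<integral>x. v s t x ^ 4 \<partial>Q) \<le> (\<integral>x. 8 * (z s t x ^ 4 + w s t x ^ 4) \<partial>Q)"
    by (rule integral_mono[OF I4 i4 v4])
  then show "(\<integral>x. v s t x ^ 4 \<partial>Q) \<le> 48 * (t - s) ^ 2"
    using zm wm by simp
  show "integrable Q (v s t)" "(\<integral>x. v s t x \<partial>Q) = 0"
    unfolding v_def[abs_def] using zm wm by simp_all
  have eq: "v s t x * w s t x = z s t x * w s t x - c * w s t x ^ 2" for x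
    by (simp add: v_def power2_eq_square algebra_simps)
  show "integrable Q (\<lambda>x. v s t x * w s t x)"
    unfolding eq using zw wm(1)[of 2] by simp
  show "(\<integral>x. v s t x * w s t x \<partial>Q) = 0"
    unfolding eq using zw wm(1)[of 2] wm(4) zw_integral[OF st] by simp
qed

section \<open>The uncorrelated part is centred given the path\<close>

definition grid :: "real \<Rightarrow> real \<Rightarrow> nat \<Rightarrow> nat \<Rightarrow> real" where
  "grid s t n i = s + real i * ((t - s) / real n)"

lemma grid:
  assumes "s < t" "0 < n"
  shows "grid s t n i < grid s t n (Suc i)" "grid s t n (Suc i) - grid s t n i = (t - s) / real n"
    "s \<le> grid s t n i" "i < n \<Longrightarrow> grid s t n (Suc i) \<le> t" "i \<le> j \<Longrightarrow> grid s t n i \<le> grid s t n j"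
    "grid s t n 0 = s" "grid s t n n = t"
proof -
  have d: "0 < (t - s) / real n"
    using assms by simp
  show s: "grid s t n (Suc i) - grid s t n i = (t - s) / real n"
    unfolding grid_def of_nat_Suc by (simp only: distrib_right)
  then show "grid s t n i < grid s t n (Suc i)"
    using d by linarith
  show "s \<le> grid s t n i"
    using mult_nonneg_nonneg[of "real i" "(t - s) / real n"] d by (simp add: grid_def)
  show mono: "grid s t n i \<le> grid s t n j" if "i \<le> j" for i j
    unfolding grid_def using d that by (intro add_left_mono mult_right_mono) auto
  show "grid s t n 0 = s" and n: "grid s t n n = t"
    using assms by (simp_all add: grid_def)
  show "i < n \<Longrightarrow> grid s t n (Suc i) \<le> t"
    using mono[of "Suc i" n] n by simp
qed

lemma v_sum:
  assumes "s < t" "0 < n"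
  shows "v s t x = (\<Sum>i<n. v (grid s t n i) (grid s t n (Suc i)) x)"
proof -
  define F where "F i = \<xi> x (grid s t n i) - c * fst x (grid s t n i)" for i
  have "v (grid s t n i) (grid s t n (Suc i)) x = F (Suc i) - F i" for i
    by (simp add: v_def z_def w_def F_def algebra_simps)
  then have "(\<Sum>i<n. v (grid s t n i) (grid s t n (Suc i)) x) = F n - F 0"
    by (simp add: sum_lessThan_telescope)
  also have "\<dots> = v s t x"
    by (simp add: F_def grid[OF assms] v_def z_def w_def algebra_simps)
  finally show ?thesis ..
qed

text \<open>
  The terms of order 0 and 1 in \<open>l\<close> vanish because \<open>v\<close> is centred and uncorrelated with \<open>w\<close>. The
  remainder is of order 3/2 in the length of the interval, so it sums to 0 over fine partitions.
\<close>
lemma v_small_char: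
  assumes ab: "a < b"
  shows "integrable Q (\<lambda>x. of_real (v a b x) * iexp (l * w a b x))"
    and "cmod (\<integral>x. of_real (v a b x) * iexp (l * w a b x) \<partial>Q) \<le> 2 * l\<^sup>2 * (b - a) * sqrt (b - a)"
proof -
  \<comment> \<open>The weight in |v| w^2 <= (q v^2 + w^4 / q) / 2. With this choice both terms have
    expectation of order (b - a) * q.\<close>
  define q where "q = sqrt (b - a)"
  have q: "0 < q" "q * q = b - a"
    using ab by (auto simp: q_def)
  note vm = v_moments[OF ab] and wm = w_moments[OF ab]
  have m: "(\<lambda>x. of_real (v a b x) * iexp (l * w a b x)) \<in> borel_measurable Q"
    by measurable
  show i1: "integrable Q (\<lambda>x. of_real (v a b x) * iexp (l * w a b x))"
    by (rule Bochner_Integration.integrable_bound[OF vm(3) m]) (simp add: norm_mult)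
  have i2: "integrable Q (\<lambda>x. complex_of_real (v a b x))"
    using vm(3) by simp
  have i3: "integrable Q (\<lambda>x. \<i> * of_real l * complex_of_real (v a b x * w a b x))"
    using vm(7) by (intro integrable_mult_right integrable_of_real) auto
  have eq: "of_real (v a b x) * (iexp (l * w a b x) - 1 - \<i> * of_real (l * w a b x)) =
      of_real (v a b x) * iexp (l * w a b x) - of_real (v a b x) - \<i> * of_real l * complex_of_real (v a b x * w a b x)" for x
    by (simp add: algebra_simps)
  have "(\<integral>x. of_real (v a b x) * (iexp (l * w a b x) - 1 - \<i> * of_real (l * w a b x)) \<partial>Q) =
      (\<integral>x. of_real (v a b x) * iexp (l * w a b x) \<partial>Q) - (\<integral>x. complex_of_real (v a b x) \<partial>Q)
       - (\<integral>x. \<i> * of_real l * complex_of_real (v a b x * w a b x) \<partial>Q)"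
    unfolding eq using i1 i2 i3 by (simp only: Bochner_Integration.integral_diff Bochner_Integration.integrable_diff)
  also have "(\<integral>x. complex_of_real (v a b x) \<partial>Q) = 0"
    using vm(4) by simp
  also have "(\<integral>x. \<i> * of_real l * complex_of_real (v a b x * w a b x) \<partial>Q) = 0"
    by (simp only: integral_mult_right_zero integral_complex_of_real vm(8)) simp
  finally have I_eq: "(\<integral>x. of_real (v a b x) * iexp (l * w a b x) \<partial>Q) =
      (\<integral>x. of_real (v a b x) * (iexp (l * w a b x) - 1 - \<i> * of_real (l * w a b x)) \<partial>Q)"
    by simp
  have "cmod (\<integral>x. of_real (v a b x) * iexp (l * w a b x) \<partial>Q) \<le> (\<integral>x. l\<^sup>2 / 4 * (q * v a b x ^ 2 + w a b x ^ 4 / q) \<partial>Q)"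
    unfolding I_eq
  proof (rule order_trans[OF Bochner_Integration.integral_norm_bound integral_mono])
    show "integrable Q (\<lambda>x. cmod (of_real (v a b x) * (iexp (l * w a b x) - 1 - \<i> * of_real (l * w a b x))))"
      unfolding eq using i1 i2 i3 by (intro integrable_norm Bochner_Integration.integrable_diff)
    show "integrable Q (\<lambda>x. l\<^sup>2 / 4 * (q * v a b x ^ 2 + w a b x ^ 4 / q))"
      using vm(1) wm(1)[of 4] by (intro integrable_mult_right Bochner_Integration.integrable_add) simp_all
    fix x
    let ?v = "v a b x" and ?w = "w a b x"
    have "cmod (of_real ?v * (iexp (l * ?w) - 1 - \<i> * of_real (l * ?w))) \<le> \<bar>?v\<bar> * ((l * ?w)\<^sup>2 / 2)"
      unfolding norm_mult norm_of_real using iexp_taylor1[of "l * ?w"] by (intro mult_left_mono) auto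
    also have "\<dots> = l\<^sup>2 / 2 * (\<bar>?v\<bar> * ?w\<^sup>2)"
      by (simp add: power_mult_distrib)
    also have "\<bar>?v\<bar> * ?w\<^sup>2 \<le> (q * ?v\<^sup>2 + ?w ^ 4 / q) / 2"
    proof -
      have "0 \<le> (q * \<bar>?v\<bar> - ?w\<^sup>2)\<^sup>2"
        by simp
      then have "2 * q * (\<bar>?v\<bar> * ?w\<^sup>2) \<le> q * q * ?v\<^sup>2 + ?w ^ 4"
        by (simp add: power2_diff power_mult_distrib flip: power_mult) (simp add: power2_eq_square)
      then have "\<bar>?v\<bar> * ?w\<^sup>2 \<le> (q * q * ?v\<^sup>2 + ?w ^ 4) / (2 * q)"
        using q(1) by (simp add: pos_le_divide_eq mult.commute)
      also have "\<dots> = (q * ?v\<^sup>2 + ?w ^ 4 / q) / 2"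
      proof -
        have "(r * r * y + u) / (2 * r) = (r * y + u / r) / 2" if "0 < r" for r y u :: real
          using that by (simp add: field_simps)
        from this[OF q(1)] show ?thesis .
      qed
      finally show ?thesis .
    qed
    finally show "cmod (of_real ?v * (iexp (l * ?w) - 1 - \<i> * of_real (l * ?w))) \<le> l\<^sup>2 / 4 * (q * ?v\<^sup>2 + ?w ^ 4 / q)"
      by (simp add: mult_left_mono)
  qed
  also have "\<dots> = l\<^sup>2 / 4 * (q * (\<integral>x. v a b x ^ 2 \<partial>Q) + 3 * (b - a) ^ 2 / q)"
  proof -
    have "(\<integral>x. q * v a b x ^ 2 + w a b x ^ 4 / q \<partial>Q) = (\<integral>x. q * v a b x ^ 2 \<partial>Q) + (\<integral>x. w a b x ^ 4 / q \<partial>Q)"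
      by (rule Bochner_Integration.integral_add) (use vm(1) wm(1)[of 4] in simp_all)
    then show ?thesis
      by (simp add: wm(5))
  qed
  also have "\<dots> = l\<^sup>2 / 4 * (q * (\<integral>x. v a b x ^ 2 \<partial>Q) + 3 * ((b - a) * q))"
  proof -
    have "3 * (b - a) ^ 2 / q = 3 * ((b - a) * (q * q)) / q"
      by (simp only: q(2) power2_eq_square)
    then show ?thesis
      using q(1) by simp
  qed
  also have "l\<^sup>2 / 4 * (q * (\<integral>x. v a b x ^ 2 \<partial>Q) + 3 * ((b - a) * q)) \<le> l\<^sup>2 / 4 * (q * (4 * (b - a)) + 3 * ((b - a) * q))"
    using vm(5) q(1) by (intro mult_left_mono add_right_mono) auto
  \<comment> \<open>The second moment of v contributes 4 and the fourth moment of w contributes 3;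
    the factor 7 / 4 is then rounded up to 2.\<close>
  also have "\<dots> = 7 / 4 * (l\<^sup>2 * ((b - a) * q))"
    by (simp add: algebra_simps)
  also have "\<dots> \<le> 2 * (l\<^sup>2 * ((b - a) * q))"
    using ab q(1) by (intro mult_right_mono) auto
  finally show "cmod (\<integral>x. of_real (v a b x) * iexp (l * w a b x) \<partial>Q) \<le> 2 * l\<^sup>2 * (b - a) * sqrt (b - a)"
    by (simp add: mult.assoc q_def)
qed

text \<open>Write v as the sum of its pieces over n equal intervals. In each term the exponential
  splits into the factor of that interval, covered by \<open>v_small_char\<close>, and a factor of
  modulus 1 that depends on the path outside. By independence each term is of order n to the power
  -3/2, and there are n of them.\<close>

lemma v_char:
  assumes st: "s < t"
  shows "(\<integral>x. of_real (v s t x) * iexp (l * w s t x) \<partial>Q) = 0"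
proof -
  let ?d = "\<lambda>n. (t - s) / real n"
  have bound: "cmod (\<integral>x. of_real (v s t x) * iexp (l * w s t x) \<partial>Q) \<le> 2 * l\<^sup>2 * (t - s) * sqrt (?d n)" if n: "0 < n" for n
  proof -
    let ?a = "grid s t n"
    note g = grid[OF st n]
    let ?f = "\<lambda>i x. of_real (v (?a i) (?a (Suc i)) x) * iexp (l * w (?a i) (?a (Suc i)) x)"
    let ?g = "\<lambda>i \<omega>. iexp (l * ((\<omega> (?a i) - \<omega> s) + (\<omega> t - \<omega> (?a (Suc i)))))"
    have split: "of_real (v s t x) * iexp (l * w s t x) = (\<Sum>i<n. ?f i x * ?g i (fst x))" for x
    proof -
      have "iexp (l * w s t x) = iexp (l * w (?a i) (?a (Suc i)) x) * ?g i (fst x)" for i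
        by (simp add: w_def algebra_simps flip: exp_add)
      then show ?thesis
        unfolding v_sum[OF st n] of_real_sum sum_distrib_right by (simp only: mult.assoc)
    qed
    have gm: "?g i \<in> borel_measurable (outside (?a i) (?a (Suc i)))" if "i < n" for i
    proof -
      have [measurable]: "(\<lambda>\<omega>. \<omega> (?a i) - \<omega> s) \<in> borel_measurable (outside (?a i) (?a (Suc i)))"
        "(\<lambda>\<omega>. \<omega> t - \<omega> (?a (Suc i))) \<in> borel_measurable (outside (?a i) (?a (Suc i)))"
        using g that by (intro outside_increment; simp)+
      show ?thesis
        by measurable
    qed
    have gi: "integrable Q (\<lambda>x. ?g i (fst x))" and gn: "cmod (\<integral>x. ?g i (fst x) \<partial>Q) \<le> 1" for i
    proof -
      have "(\<lambda>x. ?g i (fst x)) \<in> borel_measurable Q"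
        by measurable
      then show i: "integrable Q (\<lambda>x. ?g i (fst x))"
        by (intro Q.integrable_const_bound[where B=1]) auto
      have "cmod (\<integral>x. ?g i (fst x) \<partial>Q) \<le> (\<integral>x. cmod (?g i (fst x)) \<partial>Q)"
        by (rule Bochner_Integration.integral_norm_bound)
      then show "cmod (\<integral>x. ?g i (fst x) \<partial>Q) \<le> 1"
        using Q.prob_space by simp
    qed
    have fN: "?f i \<in> borel_measurable (NS (ereal (?a i)) (ereal (?a (Suc i))))" for i
      using v_N[OF g(1)[of i]] w_N[OF g(1)[of i]] by measurable
    note fi = v_small_char[OF g(1)]
    have prod: "(\<integral>x. ?f i x * ?g i (fst x) \<partial>Q) = (\<integral>x. ?f i x \<partial>Q) * (\<integral>x. ?g i (fst x) \<partial>Q)" if "i < n" for i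
      by (rule N_outside_integral[OF g(1) fN gm[OF that] fi(1) gi])
    have pi: "integrable Q (\<lambda>x. ?f i x * ?g i (fst x))" for i
    proof (rule Bochner_Integration.integrable_bound[OF fi(1)[of i]])
      show "(\<lambda>x. ?f i x * ?g i (fst x)) \<in> borel_measurable Q"
        by measurable
    qed (simp add: norm_mult)
    have "cmod (\<integral>x. of_real (v s t x) * iexp (l * w s t x) \<partial>Q) = cmod (\<Sum>i<n. \<integral>x. ?f i x * ?g i (fst x) \<partial>Q)"
      unfolding split by (subst Bochner_Integration.integral_sum[OF pi]) (rule refl)
    also have "\<dots> \<le> (\<Sum>i<n. cmod (\<integral>x. ?f i x * ?g i (fst x) \<partial>Q))"
      by (rule norm_sum)
    also have "\<dots> \<le> (\<Sum>i<n. 2 * l\<^sup>2 * ?d n * sqrt (?d n))"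
    proof (rule sum_mono)
      fix i assume i: "i \<in> {..<n}"
      have "cmod (\<integral>x. ?f i x * ?g i (fst x) \<partial>Q) = cmod (\<integral>x. ?f i x \<partial>Q) * cmod (\<integral>x. ?g i (fst x) \<partial>Q)"
        using prod[of i] i by (simp add: norm_mult)
      also have "\<dots> \<le> cmod (\<integral>x. ?f i x \<partial>Q) * 1"
        by (rule mult_left_mono[OF gn]) simp
      also have "\<dots> \<le> 2 * l\<^sup>2 * ?d n * sqrt (?d n)"
        using fi(2)[of i l] by (simp add: g(2))
      finally show "cmod (\<integral>x. ?f i x * ?g i (fst x) \<partial>Q) \<le> 2 * l\<^sup>2 * ?d n * sqrt (?d n)" .
    qed
    also have "\<dots> = 2 * l\<^sup>2 * (t - s) * sqrt (?d n)"
      using n by simp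
    finally show ?thesis .
  qed
  have "(\<lambda>n. 2 * l\<^sup>2 * (t - s) * sqrt (?d n)) \<longlonglongrightarrow> 2 * l\<^sup>2 * (t - s) * sqrt 0"
    by (intro tendsto_intros lim_const_over_n)
  then have "cmod (\<integral>x. of_real (v s t x) * iexp (l * w s t x) \<partial>Q) \<le> 2 * l\<^sup>2 * (t - s) * sqrt 0"
  proof (rule LIMSEQ_le_const)
    show "\<exists>N. \<forall>n\<ge>N. cmod (\<integral>x. of_real (v s t x) * iexp (l * w s t x) \<partial>Q) \<le> 2 * l\<^sup>2 * (t - s) * sqrt (?d n)"
      using bound by (intro exI[of _ 1]) auto
  qed
  then show ?thesis
    by simp
qed

text \<open>The positive and negative parts of v have the same mass because v is centred. Used as
  densities, they give w laws whose characteristic functions agree by \<open>v_char\<close>, so the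
  laws agree by Levy uniqueness.\<close>

lemma v_w_event:
  assumes st: "s < t" and A: "A \<in> sets borel"
  shows "(\<integral>x. v s t x * indicator A (w s t x) \<partial>Q) = 0"
proof -
  let ?p = "\<lambda>x. max 0 (v s t x)" and ?m = "\<lambda>x. max 0 (- v s t x)"
  have vi: "integrable Q (v s t)"
    by (rule v_moments(3)[OF st])
  have pi: "integrable Q ?p" and mi: "integrable Q ?m"
    using vi by auto
  define K where "K = (\<integral>x. ?p x \<partial>Q)"
  have "(\<integral>x. ?p x - ?m x \<partial>Q) = (\<integral>x. v s t x \<partial>Q)"
    by (rule Bochner_Integration.integral_cong) auto
  then have Km: "(\<integral>x. ?m x \<partial>Q) = K"
    using v_moments(4)[OF st] pi mi by (simp add: K_def)
  have K0: "0 \<le> K"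
    by (simp add: K_def)
  have diff: "(\<integral>x. v s t x * indicator A (w s t x) \<partial>Q) =
      (\<integral>x. ?p x * indicator A (w s t x) \<partial>Q) - (\<integral>x. ?m x * indicator A (w s t x) \<partial>Q)"
  proof -
    have ind: "integrable Q (\<lambda>x. f x * indicator A (w s t x))" if "integrable Q f" for f :: "sample \<Rightarrow> real"
    proof (rule Bochner_Integration.integrable_bound[OF that])
      show "(\<lambda>x. f x * indicator A (w s t x)) \<in> borel_measurable Q"
        using A that by measurable
    qed (auto simp: indicator_def)
    have "(\<integral>x. v s t x * indicator A (w s t x) \<partial>Q) = (\<integral>x. ?p x * indicator A (w s t x) - ?m x * indicator A (w s t x) \<partial>Q)"
      by (rule Bochner_Integration.integral_cong) (auto simp: indicator_def)
    also have "\<dots> = (\<integral>x. ?p x * indicator A (w s t x) \<partial>Q) - (\<integral>x. ?m x * indicator A (w s t x) \<partial>Q)"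
      by (rule Bochner_Integration.integral_diff[OF ind[OF pi] ind[OF mi]])
    finally show ?thesis .
  qed
  show ?thesis
  \<comment> \<open>The densities can be normalised only if their common mass is not 0; otherwise v
    itself vanishes almost surely.\<close>
  proof (cases "K = 0")
    case True
    then have "AE x in Q. ?p x = 0" "AE x in Q. ?m x = 0"
      using Km integral_nonneg_eq_0_iff_AE[OF pi] integral_nonneg_eq_0_iff_AE[OF mi] by (auto simp: K_def)
    then have "AE x in Q. v s t x * indicator A (w s t x) = 0"
      by eventually_elim (auto simp: max_def split: if_splits)
    then show ?thesis
      by (rule integral_eq_zero_AE)
  next
    case False
    with K0 have K: "0 < K"
      by simp
    define \<mu> where "\<mu> f = distr (density Q (\<lambda>x. ennreal (f x / K))) borel (w s t)" for f
    have fin: "real_distribution (\<mu> f) \<and> char (\<mu> f) l = (\<integral>x. of_real (f x) * iexp (l * w s t x) \<partial>Q) / K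
        \<and> measure (\<mu> f) A = (\<integral>x. f x * indicator A (w s t x) \<partial>Q) / K"
      if f: "integrable Q f" "\<And>x. 0 \<le> f x" "(\<integral>x. f x \<partial>Q) = K" for f l
    proof -
      have [measurable]: "f \<in> borel_measurable Q"
        using f by auto
      have n: "\<And>x. 0 \<le> f x / K"
        using f(2) K by simp
      have "(\<integral>\<^sup>+x. ennreal (f x / K) \<partial>Q) = ennreal (\<integral>x. f x / K \<partial>Q)"
        using f n by (intro nn_integral_eq_integral) auto
      then have "(\<integral>\<^sup>+x. ennreal (f x / K) \<partial>Q) = 1"
        using f(3) K by simp
      moreover have "emeasure (density Q (\<lambda>x. ennreal (f x / K))) (space Q) =
          (\<integral>\<^sup>+x. ennreal (f x / K) * indicator (space Q) x \<partial>Q)"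
        by (rule emeasure_density[OF _ sets.top]) simp
      moreover have "\<dots> = (\<integral>\<^sup>+x. ennreal (f x / K) \<partial>Q)"
        by (rule nn_integral_cong) simp
      ultimately have "emeasure (density Q (\<lambda>x. ennreal (f x / K))) (space Q) = 1"
        by simp
      then interpret D: prob_space "density Q (\<lambda>x. ennreal (f x / K))"
        by (intro prob_spaceI) simp
      have wm: "w s t \<in> borel_measurable (density Q (\<lambda>x. ennreal (f x / K)))"
        by simp
      interpret L: prob_space "\<mu> f"
        unfolding \<mu>_def by (rule D.prob_space_distr[OF wm])
      have 1: "real_distribution (\<mu> f)"
        by (rule real_distribution.intro[OF L.prob_space_axioms]) (simp add: real_distribution_axioms_def \<mu>_def)
      have "char (\<mu> f) l = (\<integral>x. iexp (l * w s t x) \<partial>density Q (\<lambda>x. ennreal (f x / K)))"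
        unfolding char_def \<mu>_def by (rule integral_distr[OF wm]) measurable
      also have "\<dots> = (\<integral>x. (f x / K) *\<^sub>R iexp (l * w s t x) \<partial>Q)"
        using n by (intro integral_density) auto
      also have "\<dots> = (\<integral>x. of_real (f x) * iexp (l * w s t x) / K \<partial>Q)"
        by (rule Bochner_Integration.integral_cong) (simp_all add: scaleR_conv_of_real)
      also have "\<dots> = (\<integral>x. of_real (f x) * iexp (l * w s t x) \<partial>Q) / K"
        by simp
      finally have 2: "char (\<mu> f) l = (\<integral>x. of_real (f x) * iexp (l * w s t x) \<partial>Q) / K" .
      have "measure (\<mu> f) A = (\<integral>y. indicator A y \<partial>\<mu> f)"
        using A by (simp add: \<mu>_def)
      also have "\<dots> = (\<integral>x. indicator A (w s t x) \<partial>density Q (\<lambda>x. ennreal (f x / K)))"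
        unfolding \<mu>_def by (rule integral_distr[OF wm borel_measurable_indicator[OF A]])
      also have "\<dots> = (\<integral>x. (f x / K) *\<^sub>R indicator A (w s t x) \<partial>Q)"
        using n A by (intro integral_density) auto
      also have "\<dots> = (\<integral>x. f x * indicator A (w s t x) \<partial>Q) / K"
        by simp
      finally show ?thesis
        using 1 2 by blast
    qed
    have p: "\<And>x. 0 \<le> ?p x" "\<And>x. 0 \<le> ?m x"
      by auto
    note P = fin[OF pi p(1) K_def[symmetric]] and M = fin[OF mi p(2) Km]
    have "char (\<mu> ?p) l = char (\<mu> ?m) l" for l
    proof -
      have ei: "integrable Q (\<lambda>x. of_real (f x) * iexp (l * w s t x))" if f: "integrable Q f" for f :: "sample \<Rightarrow> real"
      proof (rule Bochner_Integration.integrable_bound[OF f])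
        have [measurable]: "f \<in> borel_measurable Q"
          using f by auto
        show "(\<lambda>x. of_real (f x) * iexp (l * w s t x)) \<in> borel_measurable Q"
          by measurable
      qed (simp add: norm_mult)
      have "(\<integral>x. of_real (?p x) * iexp (l * w s t x) \<partial>Q) - (\<integral>x. of_real (?m x) * iexp (l * w s t x) \<partial>Q) =
          (\<integral>x. of_real (?p x) * iexp (l * w s t x) - of_real (?m x) * iexp (l * w s t x) \<partial>Q)"
        by (rule Bochner_Integration.integral_diff[OF ei[OF pi] ei[OF mi], symmetric])
      also have "\<dots> = (\<integral>x. of_real (v s t x) * iexp (l * w s t x) \<partial>Q)"
        by (rule Bochner_Integration.integral_cong) (auto simp: max_def)
      also have "\<dots> = 0"
        by (rule v_char[OF st])
      finally show ?thesis
        using P[of l] M[of l] by simp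
    qed
    then have "char (\<mu> ?p) = char (\<mu> ?m)"
      by (rule ext)
    then have "\<mu> ?p = \<mu> ?m"
      by (intro Levy_uniqueness) (use P[of 0] M[of 0] in simp_all)
    then have "(\<integral>x. ?p x * indicator A (w s t x) \<partial>Q) / K = (\<integral>x. ?m x * indicator A (w s t x) \<partial>Q) / K"
      by (simp only: conjunct2[OF conjunct2[OF P[of 0]], symmetric] conjunct2[OF conjunct2[OF M[of 0]], symmetric])
    then show ?thesis
      unfolding diff using K by simp
  qed
qed

lemma grid_steps:
  assumes J: "finite J" "s \<in> J" "t \<in> J" and st: "s < t"
  shows "v s t x = (\<Sum>w\<in>{w\<in>J. s \<le> w \<and> w < t}. v w (next_in J w) x)"
  using diff_eq_sum_steps[of J s t "\<lambda>r. \<xi> x r - c * fst x r"] assms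
  by (simp add: v_def z_def w_def algebra_simps)

text \<open>Split v along the steps of \<open>J\<close>. In the term of step r the box separates
  into a condition on the path increment of that step and conditions on the path outside it; the
  latter factor out, and \<open>v_w_event\<close> annihilates the former.\<close>

lemma v_box:
  assumes J: "finite J" "s \<in> J" "t \<in> J" and st: "s < t"
    and A: "\<And>w. A w \<in> sets (borel :: real measure)"
  shows "(LINT x:{x \<in> \<Omega>M. \<forall>r\<in>steps J. fst x (next_in J r) - fst x r \<in> A r}|Q. v s t x) = 0"
proof -
  define Bx where "Bx = {x \<in> \<Omega>M. \<forall>r\<in>steps J. fst x (next_in J r) - fst x r \<in> A r}"
  define I where "I = {r \<in> J. s \<le> r \<and> r < t}"
  have I: "r \<in> I \<Longrightarrow> r \<in> steps J" for r
    using J by (auto simp: I_def steps_def)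
  note nx = next_in[OF J(1)]
  have term_zero: "(\<integral>x. indicator Bx x * v r (next_in J r) x \<partial>Q) = 0"
    and term_int: "integrable Q (\<lambda>x. indicator Bx x * v r (next_in J r) x)" if r: "r \<in> I" for r
  proof -
    let ?b = "next_in J r"
    have rb: "r < ?b"
      using nx[OF I[OF r]] by simp
    let ?f = "\<lambda>x. v r ?b x * indicator (A r) (w r ?b x)"
    let ?H = "{\<omega> \<in> space (outside r ?b). \<forall>r'\<in>steps J - {r}. \<omega> (next_in J r') - \<omega> r' \<in> A r'}"
    have H: "?H \<in> sets (outside r ?b)"
    proof (rule sets.sets_Collect_finite_All)
      show "finite (steps J - {r})"
        using finite_steps[OF J(1)] by simp
      fix r' assume r': "r' \<in> steps J - {r}"
      then have rJ: "r' \<in> J" "r \<in> J"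
        using I[OF r] by (auto simp: steps_def)
      have "(r' \<le> r \<and> next_in J r' \<le> r) \<or> (?b \<le> r' \<and> ?b \<le> next_in J r')"
      proof (cases "r' < r")
        case True
        then show ?thesis
          using nx(3)[of r' r] r' rJ by auto
      next
        case False
        then have "r < r'"
          using r' by auto
        then have "?b \<le> r'"
          using nx(3)[OF I[OF r]] rJ by auto
        then show ?thesis
          using nx(2)[of r'] r' by auto
      qed
      then have "(\<lambda>\<omega>. \<omega> (next_in J r') - \<omega> r') \<in> borel_measurable (outside r ?b)"
        by (intro outside_increment[OF rb]) auto
      from measurable_sets[OF this A[of r']]
      show "{\<omega> \<in> space (outside r ?b). \<omega> (next_in J r') - \<omega> r' \<in> A r'} \<in> sets (outside r ?b)"
        by (simp add: vimage_def Int_def conj_commute)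
    qed
    have eq: "indicator Bx x * v r ?b x = ?f x * indicator ?H (fst x)" if "x \<in> space Q" for x
    proof -
      have "x \<in> \<Omega>M" "fst x \<in> \<Omega>\<^sub>0"
        using that fst_\<Omega>M by auto
      moreover have "steps J = insert r (steps J - {r})"
        using I[OF r] by auto
      then have "(\<forall>r'\<in>steps J. fst x (next_in J r') - fst x r' \<in> A r') \<longleftrightarrow>
          w r ?b x \<in> A r \<and> (\<forall>r'\<in>steps J - {r}. fst x (next_in J r') - fst x r' \<in> A r')"
        unfolding w_def by (metis insert_iff)
      ultimately have "x \<in> Bx \<longleftrightarrow> w r ?b x \<in> A r \<and> fst x \<in> ?H"
        unfolding Bx_def by auto
      then show ?thesis
        unfolding indicator_def by simp
    qed
    have fN: "?f \<in> borel_measurable (NS (ereal r) (ereal ?b))"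
      using borel_measurable_indicator[OF A[of r]]
      by (intro borel_measurable_times v_N[OF rb] measurable_compose[OF w_N[OF rb]])
    have fQ: "?f \<in> borel_measurable Q"
      using borel_measurable_indicator[OF A[of r]]
      by (intro borel_measurable_times v_Q measurable_compose[OF w_Q])
    have fi: "integrable Q ?f"
      by (rule Bochner_Integration.integrable_bound[OF v_moments(3)[OF rb] fQ]) (auto simp: indicator_def)
    have gm: "(\<lambda>\<omega>. indicator ?H \<omega> :: real) \<in> borel_measurable (outside r ?b)"
      by (rule borel_measurable_indicator[OF H])
    have gQ: "(\<lambda>x. indicator ?H (fst x) :: real) \<in> borel_measurable Q"
      by (rule measurable_compose[OF fst_measurable outside_W[OF gm]])
    have gi: "integrable Q (\<lambda>x. indicator ?H (fst x) :: real)"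
      by (rule Q.integrable_const_bound[where B=1, OF _ gQ]) (auto simp: indicator_def)
    have "(\<integral>x. indicator Bx x * v r ?b x \<partial>Q) = (\<integral>x. ?f x * indicator ?H (fst x) \<partial>Q)"
      by (rule Bochner_Integration.integral_cong[OF refl eq])
    also have "\<dots> = (\<integral>x. ?f x \<partial>Q) * (\<integral>x. indicator ?H (fst x) \<partial>Q)"
      by (rule N_outside_integral[OF rb fN gm fi gi])
    also have "\<dots> = 0"
      by (simp only: v_w_event[OF rb A] mult_zero_left)
    finally show "(\<integral>x. indicator Bx x * v r ?b x \<partial>Q) = 0" .
    have "integrable Q (\<lambda>x. ?f x * indicator ?H (fst x))"
      by (rule Bochner_Integration.integrable_bound[OF fi borel_measurable_times[OF fQ gQ]])
         (auto simp: indicator_def)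
    then show "integrable Q (\<lambda>x. indicator Bx x * v r ?b x)"
      by (subst Bochner_Integration.integrable_cong[OF refl eq])
  qed
  have "(LINT x:Bx|Q. v s t x) = (\<integral>x. (\<Sum>r\<in>I. indicator Bx x * v r (next_in J r) x) \<partial>Q)"
    unfolding set_lebesgue_integral_def grid_steps[OF J st] I_def real_scaleR_def sum_distrib_left ..
  also have "\<dots> = (\<Sum>r\<in>I. \<integral>x. indicator Bx x * v r (next_in J r) x \<partial>Q)"
    by (rule Bochner_Integration.integral_sum[OF term_int])
  also have "\<dots> = 0"
    by (rule sum.neutral) (simp add: term_zero)
  finally show ?thesis
    by (simp add: Bx_def)
qed

lemma v_increment_event:
  assumes st: "s < t" and a: "a \<in> increment_events (\<lambda>_. 0) UNIV"
  shows "(LINT x:{x \<in> \<Omega>M. fst x \<in> a}|Q. v s t x) = 0"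
proof -
  obtain J A where a: "a = {\<omega> \<in> \<Omega>\<^sub>0. \<forall>u\<in>J. \<omega> u - \<omega> 0 \<in> A u}" "finite J" "\<And>u. A u \<in> sets (borel :: real measure)"
    by (rule increment_eventsE[OF a]) (rule that)
  \<comment> \<open>The times s and t are needed for splitting v, and 0 is the base point of the
    event; \<open>K\<close> is then fine enough for \<open>v_box\<close>.\<close>
  define K where "K = J \<union> {0, s, t}"
  have K: "finite K" "0 \<in> K" "s \<in> K" "t \<in> K" "J \<subseteq> K"
    using a(2) by (auto simp: K_def)
  define box where "box A = {x \<in> \<Omega>M. \<forall>r\<in>steps K. fst x (next_in K r) - fst x r \<in> A r}" for A
  define G where "G = {box A | A. \<forall>r. A r \<in> sets (borel :: real measure)}"
  have boxG: "(\<And>r. A r \<in> sets borel) \<Longrightarrow> box A \<in> G" for A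
    unfolding G_def by blast
  have GQ: "G \<subseteq> sets Q"
  proof
    fix b assume "b \<in> G"
    then obtain A where b: "b = box A" "\<And>r. A r \<in> sets borel"
      unfolding G_def by blast
    have "{x \<in> space Q. \<forall>r\<in>steps K. fst x (next_in K r) - fst x r \<in> A r} \<in> sets Q"
    proof (rule sets.sets_Collect_finite_All[OF _ finite_steps[OF K(1)]])
      fix r
      have "(\<lambda>x. fst x (next_in K r) - fst x r) \<in> borel_measurable Q"
        by measurable
      from measurable_sets[OF this b(2)[of r]]
      show "{x \<in> space Q. fst x (next_in K r) - fst x r \<in> A r} \<in> sets Q"
        by (simp add: vimage_def Int_def conj_commute)
    qed
    then show "b \<in> sets Q"
      by (simp add: b box_def)
  qed
  have st_G: "Int_stable G"
  proof (rule Int_stableI)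
    fix b b' assume "b \<in> G" "b' \<in> G"
    then obtain A A' where b: "b = box A" "\<And>r. A r \<in> sets borel" "b' = box A'" "\<And>r. A' r \<in> sets borel"
      unfolding G_def by blast
    have "b \<inter> b' = box (\<lambda>r. A r \<inter> A' r)"
      unfolding b box_def by auto
    then show "b \<inter> b' \<in> G"
      using boxG[of "\<lambda>r. A r \<inter> A' r"] b by auto
  qed
  have z: "(LINT x:b|Q. v s t x) = 0" if bG: "b \<in> G" for b
  proof -
    obtain A where b: "b = box A" "\<And>r. A r \<in> sets borel"
      using bG unfolding G_def by blast
    show ?thesis
      unfolding b(1) box_def by (rule v_box[OF K(1,3,4) st b(2)])
  qed
  let ?L = "sigma \<Omega>M G"
  have GP: "G \<subseteq> Pow \<Omega>M"
    by (auto simp: G_def box_def)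
  have L: "space ?L = \<Omega>M" "sets ?L = sigma_sets \<Omega>M G"
    using GP by (simp_all add: space_measure_of sets_measure_of)
  have step: "(\<lambda>x. fst x (next_in K r) - fst x r) \<in> borel_measurable ?L" if r: "r \<in> steps K" for r
  proof (rule measurableI)
    fix D :: "real set" assume D: "D \<in> sets borel"
    have "box (\<lambda>r'. if r' = r then D else UNIV) \<in> sets ?L"
      unfolding L by (rule sigma_sets.Basic, rule boxG) (use D in auto)
    also have "box (\<lambda>r'. if r' = r then D else UNIV) = (\<lambda>x. fst x (next_in K r) - fst x r) -` D \<inter> space ?L"
      using r by (auto simp: box_def L(1) split: if_splits)
    finally show "(\<lambda>x. fst x (next_in K r) - fst x r) -` D \<inter> space ?L \<in> sets ?L" .
  qed simp
  have incr: "(\<lambda>x. fst x v - fst x u) \<in> borel_measurable ?L" if "u \<in> K" "v \<in> K" for u v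
  proof -
    have le: "(\<lambda>x. fst x v - fst x u) \<in> borel_measurable ?L" if "u \<in> K" "v \<in> K" "u \<le> v" for u v
    proof -
      have "(\<lambda>x. \<Sum>r\<in>{r\<in>K. u \<le> r \<and> r < v}. fst x (next_in K r) - fst x r) \<in> borel_measurable ?L"
        by (rule borel_measurable_sum, rule step) (use that in \<open>auto simp: steps_def\<close>)
      also have "(\<lambda>x::sample. \<Sum>r\<in>{r\<in>K. u \<le> r \<and> r < v}. fst x (next_in K r) - fst x r) = (\<lambda>x. fst x v - fst x u)"
      proof
        fix x :: sample
        show "(\<Sum>r\<in>{r\<in>K. u \<le> r \<and> r < v}. fst x (next_in K r) - fst x r) = fst x v - fst x u"
          by (rule diff_eq_sum_steps[OF K(1) that, of "fst x", symmetric])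
      qed
      finally show ?thesis .
    qed
    show ?thesis
    proof (cases "u \<le> v")
      case False
      then have "(\<lambda>x. - (fst x u - fst x v)) \<in> borel_measurable ?L"
        using le[of v u] that by (intro borel_measurable_uminus) auto
      then show ?thesis
        by simp
    qed (use le that in auto)
  qed
  have "{x \<in> space ?L. \<forall>u\<in>J. fst x u - fst x 0 \<in> A u} \<in> sets ?L"
  proof (rule sets.sets_Collect_finite_All[OF _ a(2)])
    fix u assume "u \<in> J"
    then have "(\<lambda>x. fst x u - fst x 0) \<in> borel_measurable ?L"
      using K by (intro incr) auto
    from measurable_sets[OF this a(3)[of u]]
    show "{x \<in> space ?L. fst x u - fst x 0 \<in> A u} \<in> sets ?L"
      by (simp add: vimage_def Int_def conj_commute)
  qed
  also have "{x \<in> space ?L. \<forall>u\<in>J. fst x u - fst x 0 \<in> A u} = {x \<in> \<Omega>M. fst x \<in> a}"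
    unfolding a(1) L using fst_\<Omega>M by auto
  finally have "{x \<in> \<Omega>M. fst x \<in> a} \<in> sigma_sets (space Q) G"
    by (simp add: L)
  from Q.set_integral_eq_0_sigma_sets[OF v_moments(3)[OF st] st_G GQ z v_moments(4)[OF st] this]
  show ?thesis
    by simp
qed

text \<open>This expresses that v has conditional expectation 0 given the whole path. Events in
  finitely many times generate the field of \<open>P\<close>, and an event of \<open>W\<close>
  differs from one of \<open>P\<close> by a null set.\<close>

lemma v_fst_event:
  assumes st: "s < t" and H: "H \<in> sets W"
  shows "(LINT x:cylinder H {}|Q. v s t x) = 0"
proof -
  let ?G = "{{x \<in> \<Omega>M. fst x \<in> a} | a. a \<in> increment_events (\<lambda>_. 0) UNIV}"
  have GQ: "?G \<subseteq> sets Q"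
    using fst_event[OF sets_P_subset[OF increment_events_in_P]] by blast
  have st_G: "Int_stable ?G"
  proof (rule Int_stableI)
    fix b b' assume "b \<in> ?G" "b' \<in> ?G"
    then obtain a a' where b: "b = {x \<in> \<Omega>M. fst x \<in> a}" "a \<in> increment_events (\<lambda>_. 0) UNIV"
      "b' = {x \<in> \<Omega>M. fst x \<in> a'}" "a' \<in> increment_events (\<lambda>_. 0) UNIV"
      by blast
    have "b \<inter> b' = {x \<in> \<Omega>M. fst x \<in> a \<inter> a'}"
      unfolding b by auto
    then show "b \<inter> b' \<in> ?G"
      using Int_stableD[OF Int_stable_increment_events b(2,4)] by blast
  qed
  have z: "(LINT x:b|Q. v s t x) = 0" if "b \<in> ?G" for b
    using that v_increment_event[OF st] by blast
  have P: "{x \<in> \<Omega>M. fst x \<in> H} \<in> sigma_sets (space Q) ?G" if "H \<in> sets P" for H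
    using that unfolding sets_P_eq
  proof (induction rule: sigma_sets.induct)
    case (Basic a)
    then show ?case
      by (intro sigma_sets.Basic) blast
  next
    case Empty
    show ?case
      using sigma_sets.Empty by simp
  next
    case (Compl a)
    have "{x \<in> \<Omega>M. fst x \<in> \<Omega>\<^sub>0 - a} = space Q - {x \<in> \<Omega>M. fst x \<in> a}"
      using fst_\<Omega>M by auto
    then show ?case
      using sigma_sets.Compl[OF Compl.IH] by (simp only:)
  next
    case (Union a)
    have "{x \<in> \<Omega>M. fst x \<in> \<Union> (range a)} = (\<Union>i. {x \<in> \<Omega>M. fst x \<in> a i})"
      by auto
    then show ?case
      using sigma_sets.Union[of "\<lambda>i. {x \<in> \<Omega>M. fst x \<in> a i}", OF Union.IH] by (simp only:)
  qed
  have Hc: "H \<in> sets (completion P)"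
    using H by (simp add: W_eq)
  let ?H = "main_part P H"
  have HP: "?H \<in> sets P"
    by (rule main_part_sets[OF Hc])
  have "AE \<omega> in W. \<omega> \<in> ?H \<longleftrightarrow> \<omega> \<in> H"
    unfolding W_eq by (rule AE_completion[OF AE_in_main_part[OF Hc]])
  from AE_Q_fst[OF this] have ae: "AE x in Q. fst x \<in> ?H \<longleftrightarrow> fst x \<in> H" .
  have "(LINT x:cylinder H {}|Q. v s t x) = (LINT x:{x \<in> \<Omega>M. fst x \<in> ?H}|Q. v s t x)"
    unfolding set_lebesgue_integral_def
  proof (rule integral_cong_AE)
    show "AE x in Q. indicator (cylinder H {}) x *\<^sub>R v s t x = indicator {x \<in> \<Omega>M. fst x \<in> ?H} x *\<^sub>R v s t x"
      using ae by eventually_elim (auto simp: cylinder_def indicator_def)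
    have m: "cylinder H {} \<in> sets Q" "{x \<in> \<Omega>M. fst x \<in> ?H} \<in> sets Q"
      using cylinder_sets[OF H] fst_event[OF sets_P_subset[OF HP]] by auto
    show "(\<lambda>x. indicator (cylinder H {}) x *\<^sub>R v s t x) \<in> borel_measurable Q"
      by (rule borel_measurable_scaleR[OF borel_measurable_indicator[OF m(1)] v_Q])
    show "(\<lambda>x. indicator {x \<in> \<Omega>M. fst x \<in> ?H} x *\<^sub>R v s t x) \<in> borel_measurable Q"
      by (rule borel_measurable_scaleR[OF borel_measurable_indicator[OF m(2)] v_Q])
  qed
  also have "\<dots> = 0"
    by (rule Q.set_integral_eq_0_sigma_sets[OF v_moments(3)[OF st] st_G GQ z v_moments(4)[OF st] P[OF HP]])
  finally show ?thesis .
qed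

text \<open>
  The \<open>k\<close>-th sign sees only the interval of a partition that contains its point, and the
  increments of \<open>v\<close> over the intervals of a fine partition are uniformly small by their fourth moments.
\<close>
lemma v_coin:
  assumes st: "s < t" and H: "H \<in> sets W" and A: "finite A" "k \<notin> A"
  shows "(LINT x:cylinder H A|Q. v s t x * coin k x) = 0"
proof -
  let ?T = "(LINT x:cylinder H A|Q. v s t x * coin k x)"
  have bound: "\<bar>?T\<bar> \<le> e + 48 * (t - s) * ((t - s) / real n) / e ^ 3" if e: "0 < e" and n: "0 < n" for e n
  proof -
    let ?a = "grid s t n" and ?d = "(t - s) / real n"
    note g = grid[OF st n]
    define I where "I i = ereal_interval (ereal (?a i)) (ereal (?a (Suc i)))" for i
    let ?v = "\<lambda>i. v (?a i) (?a (Suc i))"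
    note vm = v_moments[OF g(1)]
    \<comment> \<open>The event that the point with index k falls into the i-th interval. On the
      rest of \<open>H\<close> the flip leaves the i-th piece of v alone, so that part of the term
      vanishes.\<close>
    define Hi where "Hi i = {\<omega> \<in> H. the (S k \<omega>) \<in> I i}" for i
    have HW: "H \<subseteq> space W"
      using sets.sets_into_space[OF H] .
    have HiW: "Hi i \<in> sets W" for i
    proof -
      have "(\<lambda>\<omega>. the (S k \<omega>)) -` I i \<inter> space W \<in> sets W"
        by (rule measurable_sets[OF borel_daggerD(3)[OF S_meas]]) (simp add: I_def)
      then have "H \<inter> ((\<lambda>\<omega>. the (S k \<omega>)) -` I i \<inter> space W) \<in> sets W"
        using H by (rule sets.Int[rotated])
      also have "H \<inter> ((\<lambda>\<omega>. the (S k \<omega>)) -` I i \<inter> space W) = Hi i"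
        using HW by (auto simp: Hi_def)
      finally show ?thesis .
    qed
    have gc: "integrable Q (\<lambda>x. ?v i x * coin k x)" for i
      by (rule integrable_coin[OF vm(3)])
    have si: "set_integrable Q D (\<lambda>x. ?v i x * coin k x)" if "D \<in> sets Q" for D i
      unfolding set_integrable_def by (rule integrable_mult_indicator[OF that gc])
    note cyl = cylinder_sets[OF _ A(1)]
    have "?T = (\<integral>x. (\<Sum>i<n. indicator (cylinder H A) x *\<^sub>R (?v i x * coin k x)) \<partial>Q)"
      unfolding set_lebesgue_integral_def v_sum[OF st n] sum_distrib_right scaleR_sum_right ..
    also have "\<dots> = (\<Sum>i<n. LINT x:cylinder H A|Q. ?v i x * coin k x)"
      unfolding set_lebesgue_integral_def
      by (rule Bochner_Integration.integral_sum) (rule si[OF cyl[OF H], unfolded set_integrable_def])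
    finally have T: "?T = (\<Sum>i<n. LINT x:cylinder H A|Q. ?v i x * coin k x)" .
    have ii: "integrable Q (\<lambda>x. indicator (cylinder (Hi i) {}) x :: real)" for i
      by (rule integrable_real_indicator[OF cylinder_sets[OF HiW]]) (auto simp: Q.emeasure_eq_measure)
    have each: "\<bar>LINT x:cylinder H A|Q. ?v i x * coin k x\<bar> \<le> e * measure Q (cylinder (Hi i) {}) + 48 * ?d ^ 2 / e ^ 3" for i
    proof -
      have "cylinder H A = cylinder (Hi i) A \<union> cylinder (H - Hi i) A"
        by (auto simp: cylinder_def Hi_def)
      then have "(LINT x:cylinder H A|Q. ?v i x * coin k x) =
          (LINT x:cylinder (Hi i) A|Q. ?v i x * coin k x) + (LINT x:cylinder (H - Hi i) A|Q. ?v i x * coin k x)"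
        using cyl[OF HiW[of i]] cyl[OF sets.Diff[OF H HiW[of i]]]
        by (simp only:) (rule set_integral_Un[OF _ si si], auto simp: cylinder_def)
      also have "(LINT x:cylinder (H - Hi i) A|Q. ?v i x * coin k x) = 0"
      proof (rule set_integral_flip_0[OF _ vm(3) _ _ _ A])
        show "I i \<in> sets borel"
          by (simp add: I_def)
        show "AE x in Q. ?v i (flip k (I i) x) = ?v i x"
          unfolding I_def by (rule N_flip_fun[OF _ v_N[OF g(1)]]) (use g(1)[of i] in simp)
        show "H - Hi i \<in> sets W"
          by (rule sets.Diff[OF H HiW])
        show "\<And>\<omega>. \<omega> \<in> H - Hi i \<Longrightarrow> the (S k \<omega>) \<notin> I i"
          by (auto simp: Hi_def)
      qed
      finally have "\<bar>LINT x:cylinder H A|Q. ?v i x * coin k x\<bar> = \<bar>LINT x:cylinder (Hi i) A|Q. ?v i x * coin k x\<bar>"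
        by simp
      also have "\<dots> \<le> (\<integral>x. e * indicator (cylinder (Hi i) {}) x + ?v i x ^ 4 / e ^ 3 \<partial>Q)"
        unfolding set_lebesgue_integral_def real_norm_def[symmetric]
      proof (rule order_trans[OF Bochner_Integration.integral_norm_bound integral_mono])
        show "integrable Q (\<lambda>x. norm (indicator (cylinder (Hi i) A) x *\<^sub>R (?v i x * coin k x)))"
          by (rule integrable_norm[OF si[OF cyl[OF HiW], unfolded set_integrable_def]])
        show "integrable Q (\<lambda>x. e * indicator (cylinder (Hi i) {}) x + ?v i x ^ 4 / e ^ 3)"
          using vm(2)[of i] ii[of i] by simp
        fix x assume "x \<in> space Q"
        then have c: "\<bar>real_of_int (coin k x)\<bar> = 1"
          using coin_cases[of x k] by auto
        \<comment> \<open>Either |y| is at most e, or |y| / e is at least 1 and may be raised to the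
          fourth power. The first term will be paid only on \<open>Hi i\<close>.\<close>
        have "\<bar>y\<bar> \<le> e + y ^ 4 / e ^ 3" for y :: real
        proof (cases "\<bar>y\<bar> \<le> e")
          case True
          have "0 \<le> y ^ 4 / e ^ 3"
            using e by simp
          with True show ?thesis
            by linarith
        next
          case False
          then have "e ^ 3 * \<bar>y\<bar> \<le> \<bar>y\<bar> ^ 3 * \<bar>y\<bar>"
            using e by (intro mult_right_mono power_mono) auto
          also have "\<bar>y\<bar> ^ 3 * \<bar>y\<bar> = y ^ 4"
            by (simp add: power_abs[symmetric] power4_eq_xxxx power3_eq_cube abs_mult[symmetric])
          finally have "\<bar>y\<bar> \<le> y ^ 4 / e ^ 3"
            using e by (simp add: pos_le_divide_eq mult.commute)
          then show ?thesis
            using e by simp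
        qed
        from this[of "?v i x"]
        show "norm (indicator (cylinder (Hi i) A) x *\<^sub>R (?v i x * coin k x)) \<le> e * indicator (cylinder (Hi i) {}) x + ?v i x ^ 4 / e ^ 3"
          using c e by (auto simp: indicator_def cylinder_def abs_mult)
      qed
      also have "\<dots> = e * measure Q (cylinder (Hi i) {}) + (\<integral>x. ?v i x ^ 4 \<partial>Q) / e ^ 3"
        using vm(2)[of i] ii[of i] sets.sets_into_space[OF cylinder_sets[OF HiW[of i], of "{}"]]
        by (simp add: Int_absorb2)
      also have "(\<integral>x. ?v i x ^ 4 \<partial>Q) / e ^ 3 \<le> 48 * ?d ^ 2 / e ^ 3"
        using vm(6)[of i] e by (intro divide_right_mono) (simp_all add: g(2))
      finally show ?thesis
        by simp
    qed
    \<comment> \<open>The point lies in at most one of the open intervals. Hence the probabilities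
      add up to at most 1, and the error e enters once rather than n times.\<close>
    have disj: "disjoint_family_on (\<lambda>i. cylinder (Hi i) {}) {..<n}"
    proof -
      have "cylinder (Hi i) {} \<inter> cylinder (Hi j) {} = {}" if "i < j" for i j
        using g(5)[of "Suc i" j] that by (auto simp: cylinder_def Hi_def I_def ereal_interval_def)
      then show ?thesis
        unfolding disjoint_family_on_def by (metis Int_commute nat_neq_iff)
    qed
    have cs: "cylinder (Hi i) {} \<in> sets Q" for i
      by (rule cylinder_sets[OF HiW]) simp
    have "(\<Sum>i<n. measure Q (cylinder (Hi i) {})) = measure Q (\<Union>i<n. cylinder (Hi i) {})"
      by (rule Q.finite_measure_finite_Union[symmetric]) (use cs disj in auto)
    then have le1: "(\<Sum>i<n. measure Q (cylinder (Hi i) {})) \<le> 1"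
      using Q.prob_le_1 by simp
    have "\<bar>?T\<bar> \<le> (\<Sum>i<n. \<bar>LINT x:cylinder H A|Q. ?v i x * coin k x\<bar>)"
      unfolding T by (rule sum_abs)
    also have "\<dots> \<le> (\<Sum>i<n. e * measure Q (cylinder (Hi i) {}) + 48 * ?d ^ 2 / e ^ 3)"
      by (rule sum_mono[OF each])
    also have "\<dots> = e * (\<Sum>i<n. measure Q (cylinder (Hi i) {})) + real n * (48 * ?d ^ 2 / e ^ 3)"
      by (simp add: sum.distrib sum_distrib_left)
    also have "\<dots> \<le> e * 1 + real n * (48 * ?d ^ 2 / e ^ 3)"
      using le1 e by (intro add_right_mono mult_left_mono) auto
    also have "real n * (48 * ?d ^ 2 / e ^ 3) = 48 * (t - s) * ?d / e ^ 3"
      using n by (simp add: power2_eq_square)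
    finally show ?thesis
      by simp
  qed
  have le: "\<bar>?T\<bar> \<le> e" if e: "0 < e" for e
  proof (rule LIMSEQ_le_const)
    have "(\<lambda>n. e + 48 * (t - s) * ((t - s) / real n) / e ^ 3) \<longlonglongrightarrow> e + 48 * (t - s) * 0 / e ^ 3"
      using e by (intro tendsto_intros lim_const_over_n) auto
    then show "(\<lambda>n. e + 48 * (t - s) * ((t - s) / real n) / e ^ 3) \<longlonglongrightarrow> e"
      by simp
    show "\<exists>N. \<forall>n\<ge>N. \<bar>?T\<bar> \<le> e + 48 * (t - s) * ((t - s) / real n) / e ^ 3"
      using bound[OF e] by (intro exI[of _ 1]) auto
  qed
  show ?thesis
  proof (rule ccontr)
    assume "?T \<noteq> 0"
    then have "0 < \<bar>?T\<bar> / 2"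
      by (simp only: half_gt_zero_iff zero_less_abs_iff not_False_eq_True)
    from le[OF this] this show False
      by linarith
  qed
qed

lemma AE_v_0: "s < t \<Longrightarrow> AE x in Q. v s t x = 0"
  by (rule AE_eq_0_coins[OF v_moments(3) v_fst_event v_coin])

text \<open>When v vanishes, z and c * w have equal second moments over the unit interval, which
  reads 1 = c^2.\<close>

lemma c_cases: "c = 1 \<or> c = -1"
proof -
  have "AE x in Q. z 0 1 x ^ 2 = c\<^sup>2 * w 0 1 x ^ 2"
    using AE_v_0[of 0 1] by (auto simp: v_def power_mult_distrib elim!: eventually_mono)
  then have "(\<integral>x. z 0 1 x ^ 2 \<partial>Q) = (\<integral>x. c\<^sup>2 * w 0 1 x ^ 2 \<partial>Q)"
    by (intro integral_cong_AE) measurable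
  then have "c\<^sup>2 = 1"
    using z_moments(4)[of 0 1] w_moments(4)[of 0 1] by simp
  then show ?thesis
    by (simp add: power2_eq_1_iff)
qed

text \<open>The increments from 0 agree at all rational times simultaneously outside one null set,
  and both sides are continuous paths starting at 0.\<close>

lemma AE_copy_eq: "AE x in Q. \<xi> x = (\<lambda>t. c * fst x t)"
proof -
  have ae: "AE x in Q. \<forall>q::rat. \<xi> x (of_rat q) - \<xi> x 0 = c * (fst x (of_rat q) - fst x 0)"
    unfolding AE_all_countable
  proof
    fix q :: rat
    consider "q = 0" | "(0::real) < of_rat q" | "of_rat q < (0::real)"
      by (cases q "0::rat" rule: linorder_cases) auto
    then show "AE x in Q. \<xi> x (of_rat q) - \<xi> x 0 = c * (fst x (of_rat q) - fst x 0)"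
    proof cases
      case 2
      from AE_v_0[OF 2] show ?thesis
        by eventually_elim (simp add: v_def z_def w_def)
    next
      case 3
      from AE_v_0[OF 3] show ?thesis
        by eventually_elim (simp add: v_def z_def w_def algebra_simps)
    qed simp
  qed
  show ?thesis
    using ae AE_space
  proof eventually_elim
    case (elim x)
    have o: "\<xi> x \<in> \<Omega>\<^sub>0" "fst x \<in> \<Omega>\<^sub>0"
      using measurable_space[OF \<xi>_measurable elim(2)] fst_\<Omega>M(2) elim(2) by simp_all
    have q: "\<xi> x (of_rat q) = c * fst x (of_rat q)" for q
      using elim(1) o by (simp add: \<Omega>\<^sub>0_def)
    have d: "closure (range (of_rat :: rat \<Rightarrow> real)) = UNIV"
      using Rats_closure_real by (simp add: Rats_def)
    show ?case
    proof (rule ext)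
      fix t
      let ?S = "range (of_rat :: rat \<Rightarrow> real)"
      have "\<xi> x t - c * fst x t = 0"
      proof (rule continuous_constant_on_closure[where S="?S" and f="\<lambda>t. \<xi> x t - c * fst x t"])
        show "continuous_on (closure ?S) (\<lambda>t. \<xi> x t - c * fst x t)"
          unfolding d using o by (auto simp: \<Omega>\<^sub>0_def intro!: continuous_intros)
        show "\<And>t. t \<in> ?S \<Longrightarrow> \<xi> x t - c * fst x t = 0"
          using q by auto
        show "t \<in> closure ?S"
          by (simp add: d)
      qed
      then show "\<xi> x t = c * fst x t"
        by simp
    qed
  qed
qed

end

section \<open>Homomorphisms of noises\<close>

text \<open>One half of an isomorphism, in the form of an everywhere defined map. An isomorphism
  provides one in each direction, and each accounts for one of the two inclusions between the sets
  of points.\<close>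

locale noise_hom =
  T1: triplet P W M1 \<Omega>1 S1 + T2: triplet P W M2 \<Omega>2 S2
  for P W M1 \<Omega>1 S1 M2 \<Omega>2 S2 +
  fixes \<phi> :: "sample \<Rightarrow> sample"
  assumes \<phi>_measurable: "\<phi> \<in> T1.Q \<rightarrow>\<^sub>M T2.Q" and distr_\<phi>: "distr T1.Q T2.Q \<phi> = T2.Q"
    and \<phi>_local: "\<And>s t D. s < t \<Longrightarrow> D \<in> T2.N s t \<Longrightarrow> \<phi> -` D \<inter> T1.\<Omega>M \<in> T1.N s t"
begin

lemma \<phi>_in: "x \<in> T1.\<Omega>M \<Longrightarrow> \<phi> x \<in> T2.\<Omega>M"
  using measurable_space[OF \<phi>_measurable] by simp

lemma AE_\<phi>: "AE y in T2.Q. R y \<Longrightarrow> AE x in T1.Q. R (\<phi> x)"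
  by (rule AE_distrD[OF \<phi>_measurable]) (simp only: distr_\<phi>)

lemma NS_\<phi>:
  assumes "s < t" shows "\<phi> \<in> T1.NS s t \<rightarrow>\<^sub>M T2.NS s t"
proof (rule measurableI)
  fix D assume "D \<in> sets (T2.NS s t)"
  then show "\<phi> -` D \<inter> space (T1.NS s t) \<in> sets (T1.NS s t)"
    using \<phi>_local[OF assms] by (simp add: T1.sets_NS T2.sets_NS)
qed (simp add: \<phi>_in)

lemma ex_sign:
  assumes shift: "\<And>h. AE x in T1.Q. \<phi> (shift_M h x) = shift_M h (\<phi> x)"
  shows "\<exists>c. (c = 1 \<or> c = -1) \<and> (AE x in T1.Q. fst (\<phi> x) = (\<lambda>t. c * fst x t))"
proof -
  interpret brownian_copy P W M1 \<Omega>1 S1 "\<lambda>x. fst (\<phi> x)"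
  proof
    show "(\<lambda>x. fst (\<phi> x)) \<in> T1.Q \<rightarrow>\<^sub>M W"
      by (rule measurable_compose[OF \<phi>_measurable T2.fst_measurable])
    have "distr T1.Q W (\<lambda>x. fst (\<phi> x)) = distr (distr T1.Q T2.Q \<phi>) W fst"
      by (subst distr_distr[OF T2.fst_measurable \<phi>_measurable]) (simp add: comp_def)
    then show "distr T1.Q W (\<lambda>x. fst (\<phi> x)) = W"
      by (simp only: distr_\<phi> T2.distr_fst)
    fix s t :: real assume "s < t"
    then show "(\<lambda>x. fst (\<phi> x) t - fst (\<phi> x) s) \<in> borel_measurable (T1.NS (ereal s) (ereal t))"
      by (intro measurable_compose[OF NS_\<phi> T2.N_increment]) auto
  next
    fix h
    show "AE x in T1.Q. fst (\<phi> (shift_M h x)) = \<Delta> h (fst (\<phi> x))"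
      using shift[of h] by eventually_elim (simp add: T1.fst_shift_M)
  qed
  show ?thesis
    using c_cases AE_copy_eq by blast
qed

text \<open>
  On the event \<open>F\<close> that the \<open>j\<close>-th point \<open>y\<close> of \<open>M2\<close> is not in \<open>M1\<close>, the image of its sign has
  vanishing Walsh coefficients: it is centred given the path, and the \<open>n\<close>-th point of \<open>M1\<close> is
  separated from \<open>y\<close> by a rational interval, so that flipping its sign changes nothing. This is
  impossible for a sign unless \<open>F\<close> is null.
\<close>
lemma points_subset:
  assumes c: "c = 1 \<or> c = (-1 :: real)" and ae: "AE x in T1.Q. fst (\<phi> x) = (\<lambda>t. c * fst x t)"
  shows "AE \<omega> in W. M2 (\<lambda>t. c * \<omega> t) \<subseteq> M1 \<omega>"
proof -
  define k where "k \<omega> = (\<lambda>t. c * \<omega> t)" for \<omega> :: "real \<Rightarrow> real"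
  have kk: "k (k \<omega>) = \<omega>" for \<omega>
    using c by (auto simp: k_def)
  have k\<Omega>: "\<omega> \<in> \<Omega>\<^sub>0 \<Longrightarrow> k \<omega> \<in> \<Omega>\<^sub>0" for \<omega>
    unfolding k_def by (rule scale_\<Omega>\<^sub>0)
  have kW: "k \<in> W \<rightarrow>\<^sub>M W" "distr W W k = W"
    using T1.scale_W[OF c] by (simp_all add: k_def[abs_def])
  have ae: "AE x in T1.Q. fst (\<phi> x) = k (fst x)"
    using ae by (simp add: k_def)
  have k2: "AE \<omega> in W. k \<omega> \<in> \<Omega>2"
    by (rule T1.AE_W_vimage[OF kW T2.AE_\<Omega>\<^sub>1])
  have point: "AE \<omega> in W. the (S2 j (k \<omega>)) \<in> M1 \<omega>" for j
  proof -
    define y where "y \<omega> = the (S2 j (k \<omega>))" for \<omega>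
    have ym: "y \<in> borel_measurable W"
      unfolding y_def by (rule measurable_compose[OF kW(1) borel_daggerD(3)[OF T2.S_meas]])
    define F where "F = {\<omega> \<in> space W. \<forall>i. S1 i \<omega> \<noteq> Some (y \<omega>)}"
    have FW: "F \<in> sets W"
    proof -
      have "{\<omega> \<in> space W. S1 i \<omega> = Some (y \<omega>)} \<in> sets W" for i
        by (rule borel_dagger_eq[OF T1.S_meas Some_measurable[OF ym]])
      then have [measurable]: "Measurable.pred W (\<lambda>\<omega>. S1 i \<omega> = Some (y \<omega>))" for i
        by (simp add: pred_def)
      show ?thesis
        unfolding F_def by measurable
    qed
    define f where "f x = real_of_int (T2.coin j (\<phi> x))" for x
    have fm: "f \<in> borel_measurable T1.Q"
      unfolding f_def by (rule measurable_compose[OF \<phi>_measurable T2.real_coin_measurable])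
    have f1: "\<bar>f x\<bar> = 1" if "x \<in> T1.\<Omega>M" for x
      using T2.coin_cases[OF \<phi>_in[OF that], of j] by (auto simp: f_def)
    have ind: "(\<lambda>x. indicator D (fst x) :: real) \<in> borel_measurable T1.Q" if "D \<in> sets W" for D
      by (rule measurable_compose[OF T1.fst_measurable borel_measurable_indicator[OF that]])
    have fi: "integrable T1.Q (\<lambda>x. f x * indicator D (fst x))" if "D \<in> sets W" for D
    proof (rule T1.Q.integrable_const_bound[where B=1])
      show "AE x in T1.Q. norm (f x * indicator D (fst x)) \<le> 1"
        using T1.AE_Q_\<Omega>M by eventually_elim (auto simp: indicator_def f1)
    qed (rule borel_measurable_times[OF fm ind[OF that]])
    define g where "g x = f x * indicator F (fst x)" for x
    have gi: "integrable T1.Q g"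
      unfolding g_def by (rule fi[OF FW])
    have "AE x in T1.Q. g x = 0"
    proof (rule T1.AE_eq_0_coins[OF gi])
      fix H assume H: "H \<in> sets W"
      \<comment> \<open>Since \<phi> acts on paths by \<open>k\<close>, a path event for the source
        becomes its image under the involution \<open>k\<close> for the target, where centring of
        the sign is immediate.\<close>
      define H' where "H' = k -` (H \<inter> F) \<inter> space W"
      have H'W: "H' \<in> sets W"
        unfolding H'_def by (rule measurable_sets[OF kW(1) sets.Int[OF H FW]])
      let ?h = "\<lambda>x. indicator (T2.cylinder H' {}) x *\<^sub>R ((1::real) * T2.coin j x)"
      have hm: "?h \<in> borel_measurable T2.Q"
        using T2.cylinder_sets[OF H'W, of "{}"] T2.real_coin_measurable[of j]
        by (intro borel_measurable_scaleR borel_measurable_indicator borel_measurable_times) auto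
      have "(LINT x:T1.cylinder H {}|T1.Q. g x) = (\<integral>x. ?h (\<phi> x) \<partial>T1.Q)"
        unfolding set_lebesgue_integral_def
      proof (rule integral_cong_AE)
        show "(\<lambda>x. indicator (T1.cylinder H {}) x *\<^sub>R g x) \<in> borel_measurable T1.Q"
          using T1.cylinder_sets[OF H, of "{}"] gi by (intro borel_measurable_scaleR borel_measurable_indicator) auto
        show "(\<lambda>x. ?h (\<phi> x)) \<in> borel_measurable T1.Q"
          by (rule measurable_compose[OF \<phi>_measurable hm])
        show "AE x in T1.Q. indicator (T1.cylinder H {}) x *\<^sub>R g x = ?h (\<phi> x)"
          using ae T1.AE_Q_\<Omega>M
        proof eventually_elim
          case (elim x)
          have "\<phi> x \<in> T2.cylinder H' {} \<longleftrightarrow> x \<in> T1.cylinder H {} \<and> fst x \<in> F"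
            using elim \<phi>_in[OF elim(2)] T1.fst_\<Omega>M(2)[OF elim(2)] k\<Omega>
            by (auto simp: T1.cylinder_def T2.cylinder_def H'_def kk)
          then show ?case
            by (simp add: g_def f_def indicator_def)
        qed
      qed
      also have "\<dots> = (\<integral>x. ?h x \<partial>distr T1.Q T2.Q \<phi>)"
        by (rule integral_distr[OF \<phi>_measurable hm, symmetric])
      also have "\<dots> = (LINT x:T2.cylinder H' {}|T2.Q. (1::real) * T2.coin j x)"
        by (simp only: distr_\<phi> set_lebesgue_integral_def)
      \<comment> \<open>With empty \<open>I\<close> the flip is unconditional, and the constant 1 is
        invariant under it.\<close>
      also have "\<dots> = 0"
        by (rule T2.set_integral_flip_0[where I="{}"]) (use H'W in auto)
      finally show "(LINT x:T1.cylinder H {}|T1.Q. g x) = 0" .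
    next
      fix H and A :: "nat set" and n :: nat assume H: "H \<in> sets W" and A: "finite A" "n \<notin> A"
      \<comment> \<open>The pairs (\<open>p i\<close>, \<open>q i\<close>) run through all pairs of
        rationals. On \<open>G i\<close> the interval contains y but not the n-th point of
        \<open>M1\<close>; off a null set these events cover \<open>H \<inter> F\<close>, because y
        differs from that point there.\<close>
      define p where "p i = real_of_rat (fst (from_nat i :: rat \<times> rat))" for i :: nat
      define q where "q i = real_of_rat (snd (from_nat i :: rat \<times> rat))" for i :: nat
      define I where "I i = ereal_interval (ereal (p i)) (ereal (q i))" for i
      define G where "G i = {\<omega> \<in> H \<inter> F. p i < q i \<and> y \<omega> \<in> I i \<and> the (S1 n \<omega>) \<notin> I i}" for i
      have Ib: "I i \<in> sets borel" for i
        by (simp add: I_def)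
      have HF: "H \<inter> F \<subseteq> space W"
        using sets.sets_into_space[OF H] by auto
      have GW: "G i \<in> sets W" for i
      proof -
        have "(H \<inter> F) \<inter> (y -` I i \<inter> space W) - ((\<lambda>\<omega>. the (S1 n \<omega>)) -` I i \<inter> space W) \<in> sets W"
          by (rule sets.Diff[OF sets.Int[OF sets.Int[OF H FW] measurable_sets[OF ym Ib]]
                measurable_sets[OF borel_daggerD(3)[OF T1.S_meas] Ib]])
        moreover have "G i = (if p i < q i then (H \<inter> F) \<inter> (y -` I i \<inter> space W) - ((\<lambda>\<omega>. the (S1 n \<omega>)) -` I i \<inter> space W) else {})"
          using HF by (auto simp: G_def)
        ultimately show ?thesis
          by simp
      qed
      have cover: "\<exists>i. \<omega> \<in> G i" if w: "\<omega> \<in> H \<inter> F" "\<omega> \<in> \<Omega>1" for \<omega>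
      proof -
        have ne: "the (S1 n \<omega>) \<noteq> y \<omega>"
          using w T1.Some_S[OF w(2), of n] by (auto simp: F_def)
        obtain a b where ab: "real_of_rat a < y \<omega>" "y \<omega> < real_of_rat b"
          "\<not> (real_of_rat a < the (S1 n \<omega>) \<and> the (S1 n \<omega>) < real_of_rat b)"
        proof (cases "the (S1 n \<omega>) < y \<omega>")
          case True
          obtain a where "the (S1 n \<omega>) < real_of_rat a" "real_of_rat a < y \<omega>"
            using of_rat_dense[OF True] by blast
          moreover obtain b where "y \<omega> < real_of_rat b" "real_of_rat b < y \<omega> + 1"
            using of_rat_dense[of "y \<omega>" "y \<omega> + 1"] by auto
          ultimately show ?thesis
            using that[of a b] by auto
        next
          case False
          then have "y \<omega> < the (S1 n \<omega>)"
            using ne by simp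
          then obtain b where "y \<omega> < real_of_rat b" "real_of_rat b < the (S1 n \<omega>)"
            using of_rat_dense by blast
          moreover obtain a where "y \<omega> - 1 < real_of_rat a" "real_of_rat a < y \<omega>"
            using of_rat_dense[of "y \<omega> - 1" "y \<omega>"] by auto
          ultimately show ?thesis
            using that[of a b] by auto
        qed
        define i where "i = to_nat (a, b)"
        have "p i = real_of_rat a" "q i = real_of_rat b"
          by (simp_all add: p_def q_def i_def)
        then have "\<omega> \<in> G i"
          using w ab by (auto simp: G_def I_def ereal_interval_def)
        then show ?thesis
          by blast
      qed
      \<comment> \<open>The cover is made disjoint, so that the integral becomes a sum over fixed
        intervals; flipping requires an interval that does not vary with the path.\<close>
      let ?D = "\<lambda>i. T1.cylinder (disjointed G i) A"
      have dW: "disjointed G i \<in> sets W" for i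
        using sets.range_disjointed_sets[of G W] GW by auto
      have DQ: "?D i \<in> sets T1.Q" for i
        by (rule T1.cylinder_sets[OF dW A(1)])
      have gc: "integrable T1.Q (\<lambda>x. g x * T1.coin n x)"
        by (rule T1.integrable_coin[OF gi])
      have UQ: "(\<Union>i. ?D i) \<in> sets T1.Q"
        using DQ by auto
      have "(LINT x:T1.cylinder H A|T1.Q. g x * T1.coin n x) = (LINT x:(\<Union>i. ?D i)|T1.Q. g x * T1.coin n x)"
        unfolding set_lebesgue_integral_def
      proof (rule Bochner_Integration.integral_cong[OF refl])
        fix x assume x: "x \<in> space T1.Q"
        have "fst x \<in> F \<Longrightarrow> x \<in> T1.cylinder H A \<longleftrightarrow> x \<in> (\<Union>i. ?D i)"
        proof -
          assume xF: "fst x \<in> F"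
          have "x \<in> (\<Union>i. ?D i) \<longleftrightarrow> x \<in> T1.\<Omega>M \<and> (\<forall>k\<in>A. T1.coin k x = 1) \<and> fst x \<in> (\<Union>i. disjointed G i)"
            by (auto simp: T1.cylinder_def)
          also have "fst x \<in> (\<Union>i. disjointed G i) \<longleftrightarrow> fst x \<in> H"
            unfolding UN_disjointed_eq using cover[of "fst x"] xF x T1.fst_\<Omega>M(1)[of x] by (auto simp: G_def)
          finally show ?thesis
            using x by (auto simp: T1.cylinder_def)
        qed
        then show "indicator (T1.cylinder H A) x *\<^sub>R (g x * T1.coin n x) = indicator (\<Union>i. ?D i) x *\<^sub>R (g x * T1.coin n x)"
          by (cases "fst x \<in> F") (simp_all add: indicator_def g_def)
      qed
      also have "\<dots> = (\<Sum>i. LINT x:?D i|T1.Q. g x * T1.coin n x)"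
      proof (rule lebesgue_integral_countable_add[OF DQ])
        show "set_integrable T1.Q (\<Union>i. ?D i) (\<lambda>x. g x * T1.coin n x)"
          unfolding set_integrable_def by (rule integrable_mult_indicator[OF UQ gc])
        fix i l :: nat assume "i \<noteq> l"
        then have "disjointed G i \<inter> disjointed G l = {}"
          using disjoint_family_disjointed[of G] by (auto simp: disjoint_family_on_def)
        then show "?D i \<inter> ?D l = {}"
          by (auto simp: T1.cylinder_def)
      qed
      finally have sums: "(LINT x:T1.cylinder H A|T1.Q. g x * T1.coin n x) = (\<Sum>i. LINT x:?D i|T1.Q. g x * T1.coin n x)" .
      have "(LINT x:?D i|T1.Q. g x * T1.coin n x) = 0" for i
      proof (cases "p i < q i")
        case False
        then have "disjointed G i = {}"
          using disjointed_subset[of G i] by (auto simp: G_def)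
        then show ?thesis
          by (simp add: T1.cylinder_def set_lebesgue_integral_def)
      next
        case True
        then have pq: "ereal (p i) < ereal (q i)"
          by simp
        \<comment> \<open>Off \<open>Y\<close> the point y may lie outside the interval and its
          image sign need not be invariant. On the cylinder in question nothing changes, since it
          lies over \<open>G i\<close>.\<close>
        define Y where "Y = y -` I i \<inter> space W"
        have YW: "Y \<in> sets W"
          unfolding Y_def by (rule measurable_sets[OF ym Ib])
        let ?f = "\<lambda>x. f x * indicator Y (fst x)"
        have sub: "disjointed G i \<subseteq> G i"
          by (rule disjointed_subset)
        have "(LINT x:?D i|T1.Q. g x * T1.coin n x) = (LINT x:?D i|T1.Q. ?f x * T1.coin n x)"
          unfolding set_lebesgue_integral_def
        proof (rule Bochner_Integration.integral_cong[OF refl])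
          fix x assume "x \<in> space T1.Q"
          have "x \<in> ?D i \<Longrightarrow> fst x \<in> F \<and> fst x \<in> Y"
            using sub HF by (auto simp: T1.cylinder_def G_def Y_def)
          then show "indicator (?D i) x *\<^sub>R (g x * T1.coin n x) = indicator (?D i) x *\<^sub>R (?f x * T1.coin n x)"
            by (auto simp: indicator_def g_def)
        qed
        also have "\<dots> = 0"
        proof (rule T1.set_integral_flip_0[OF Ib fi[OF YW] _ dW _ A])
          show "the (S1 n \<omega>) \<notin> I i" if "\<omega> \<in> disjointed G i" for \<omega>
            using that sub by (auto simp: G_def)
          let ?R = "T2.R (ereal (p i)) (ereal (q i))"
          \<comment> \<open>The image signs read along the local enumeration of \<open>M2\<close>.
            Each is a local function, hence invariant under the flip; on \<open>Y\<close> the sign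
            \<open>f\<close> is one of them, with an index that depends on the path only and so
            survives the flip.\<close>
          define L where "L l x = real_of_int (snd (\<phi> x) (the (?R l (fst (\<phi> x)))))" for l x
          have "L l \<in> borel_measurable (T1.NS (ereal (p i)) (ereal (q i)))" for l
            unfolding L_def
          proof (rule measurable_compose[OF NS_\<phi>[OF pq]], rule measurableI)
            fix D :: "real set"
            show "(\<lambda>x. real_of_int (snd x (the (?R l (fst x))))) -` D \<inter> space (T2.NS (ereal (p i)) (ereal (q i)))
                \<in> sets (T2.NS (ereal (p i)) (ereal (q i)))"
              using T2.N_sign_R[of "ereal (p i)" "ereal (q i)" l "real_of_int -` D"]
              by (simp add: T2.sets_NS vimage_def Int_def conj_commute)
          qed simp
          then have "AE x in T1.Q. \<forall>l. L l (T1.flip n (I i) x) = L l x"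
            unfolding AE_all_countable I_def using T1.N_flip_fun[OF pq] by blast
          moreover have "AE x in T1.Q. fst (\<phi> (T1.flip n (I i) x)) = k (fst (T1.flip n (I i) x))"
            by (rule T1.AE_flip[OF Ib ae])
          ultimately show "AE x in T1.Q. ?f (T1.flip n (I i) x) = ?f x"
            using ae T1.AE_Q_\<Omega>M
          proof eventually_elim
            case (elim x)
            show ?case
            proof (cases "fst x \<in> Y")
              case True
              have x2: "k (fst x) \<in> \<Omega>2"
                using T2.fst_\<Omega>M(1)[OF \<phi>_in[OF elim(4)]] elim(3) by simp
              have "y (fst x) \<in> M2 (k (fst x))" "y (fst x) \<in> I i"
                using True T2.S_in_M[OF x2] by (auto simp: Y_def y_def)
              then obtain l where "?R l (k (fst x)) = Some (y (fst x))"
                using T2.R_local(5)[OF pq x2] unfolding I_def by blast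
              then have "f x = L l x" "f (T1.flip n (I i) x) = L l (T1.flip n (I i) x)"
                using elim(2,3) by (simp_all add: f_def L_def T2.coin_def y_def)
              then show ?thesis
                using elim(1) by simp
            qed simp
          qed
        qed
        finally show ?thesis .
      qed
      then show "(LINT x:T1.cylinder H A|T1.Q. g x * T1.coin n x) = 0"
        unfolding sums by simp
    qed
    then have "AE x in T1.Q. fst x \<notin> F"
      using T1.AE_Q_\<Omega>M
    proof eventually_elim
      case (elim x)
      then show ?case
        using f1[of x] by (auto simp: g_def indicator_def)
    qed
    moreover have "{\<omega> \<in> \<Omega>\<^sub>0. \<omega> \<notin> F} \<in> sets W"
    proof -
      have "space W - F \<in> sets W"
        by (rule sets.compl_sets[OF FW])
      also have "space W - F = {\<omega> \<in> \<Omega>\<^sub>0. \<omega> \<notin> F}"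
        by auto
      finally show ?thesis .
    qed
    ultimately have "AE \<omega> in W. \<omega> \<notin> F"
      by (rule T1.AE_Q_fstD)
    then show ?thesis
      using T1.AE_\<Omega>\<^sub>1 AE_space
    proof eventually_elim
      case (elim \<omega>)
      then obtain i where "S1 i \<omega> = Some (y \<omega>)"
        by (auto simp: F_def)
      then show ?case
        using T1.S_in_M[OF elim(2), of i] by (simp add: y_def)
    qed
  qed
  then have "AE \<omega> in W. \<forall>j. the (S2 j (k \<omega>)) \<in> M1 \<omega>"
    by (simp add: AE_all_countable)
  then show ?thesis
    using k2
  proof eventually_elim
    case (elim \<omega>)
    have "M2 (k \<omega>) \<subseteq> M1 \<omega>"
    proof
      fix r assume "r \<in> M2 (k \<omega>)"
      then obtain j where "S2 j (k \<omega>) = Some r"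
        using T2.M_eq[OF elim(2)] by (auto simp: real_values_def)
      then show "r \<in> M1 \<omega>"
        using elim(1)[rule_format, of j] by simp
    qed
    then show ?case
      by (simp add: k_def)
  qed
qed

end

section \<open>Isomorphisms modulo null sets and homomorphisms\<close>

lemma mod0_isomorphism_sym:
  assumes "mod0_isomorphism P Q X Y \<psi>"
  shows "mod0_isomorphism Q P Y X (the_inv_into (space P - X) \<psi>)"
proof -
  let ?P = "restrict_space P (space P - X)" and ?Q = "restrict_space Q (space Q - Y)"
  let ?i = "the_inv_into (space P - X) \<psi>"
  have X: "X \<in> null_sets P" "Y \<in> null_sets Q" and b: "bij_betw \<psi> (space P - X) (space Q - Y)"
    and m: "\<psi> \<in> ?P \<rightarrow>\<^sub>M ?Q" "?i \<in> ?Q \<rightarrow>\<^sub>M ?P" and d: "distr ?P ?Q \<psi> = ?Q"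
    using assms by (auto simp: mod0_isomorphism_def)
  have sP: "space ?P = space P - X" and sQ: "space ?Q = space Q - Y"
    by (auto simp: space_restrict_space)
  have inj: "inj_on \<psi> (space P - X)" and im: "\<psi> ` (space P - X) = space Q - Y"
    using b by (auto simp: bij_betw_def)
  have bi: "bij_betw ?i (space Q - Y) (space P - X)"
    by (rule bij_betw_the_inv_into[OF b])
  have ii: "the_inv_into (space Q - Y) ?i x = \<psi> x" if x: "x \<in> space P - X" for x
  proof (rule the_inv_into_f_eq)
    show "inj_on ?i (space Q - Y)"
      using bi by (simp add: bij_betw_def)
    show "?i (\<psi> x) = x"
      by (rule the_inv_into_f_f[OF inj x])
    show "\<psi> x \<in> space Q - Y"
      using im x by auto
  qed
  have "the_inv_into (space Q - Y) ?i \<in> ?P \<rightarrow>\<^sub>M ?Q"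
    using m(1) by (subst measurable_cong[of _ _ \<psi>]) (use ii sP in auto)
  moreover have "distr ?Q ?P ?i = ?P"
  proof -
    have "distr ?Q ?P ?i = distr (distr ?P ?Q \<psi>) ?P ?i"
      by (simp only: d)
    also have "\<dots> = distr ?P ?P (\<lambda>x. ?i (\<psi> x))"
      by (subst distr_distr[OF m(2) m(1)]) (simp add: comp_def)
    also have "\<dots> = distr ?P ?P (\<lambda>x. x)"
      by (rule distr_cong[OF refl refl]) (use the_inv_into_f_f[OF inj] sP in auto)
    finally show ?thesis
      by (simp add: distr_id2)
  qed
  ultimately show ?thesis
    using X bi m(2) by (simp add: mod0_isomorphism_def)
qed

locale triplet_pair =
  T1: triplet P W M1 \<Omega>1 S1 + T2: triplet P W M2 \<Omega>2 S2
  for P W M1 \<Omega>1 S1 M2 \<Omega>2 S2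
begin

lemma noise_hom_of_mod0_isomorphism:
  assumes iso: "mod0_isomorphism T1.Q T2.Q X Y \<psi>"
    and fields: "\<And>s t. s < t \<Longrightarrow> {\<psi> ` (A - X) | A. A \<in> T1.N s t} = {B - Y | B. B \<in> T2.N s t}"
  obtains \<phi> where "noise_hom P W M1 \<Omega>1 S1 M2 \<Omega>2 S2 \<phi>" "\<And>x. x \<in> T1.\<Omega>M - X \<Longrightarrow> \<phi> x = \<psi> x"
proof -
  have X: "X \<in> null_sets T1.Q" and Y: "Y \<in> null_sets T2.Q"
    and b: "bij_betw \<psi> (T1.\<Omega>M - X) (T2.\<Omega>M - Y)"
    and m: "\<psi> \<in> restrict_space T1.Q (T1.\<Omega>M - X) \<rightarrow>\<^sub>M restrict_space T2.Q (T2.\<Omega>M - Y)"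
    and d: "distr (restrict_space T1.Q (T1.\<Omega>M - X)) (restrict_space T2.Q (T2.\<Omega>M - Y)) \<psi> = restrict_space T2.Q (T2.\<Omega>M - Y)"
    using iso by (auto simp: mod0_isomorphism_def)
  have inj: "inj_on \<psi> (T1.\<Omega>M - X)" and im: "\<psi> ` (T1.\<Omega>M - X) = T2.\<Omega>M - Y"
    using b by (auto simp: bij_betw_def)
  obtain y0 where y0: "y0 \<in> T2.\<Omega>M"
    using T2.Q.not_empty by auto
  \<comment> \<open>An arbitrary value on the null set \<open>X\<close> makes the map total; all
    preimages change by null sets only, which belong to every local field.\<close>
  define \<phi> where "\<phi> x = (if x \<in> X then y0 else \<psi> x)" for x
  have \<Omega>1: "T1.\<Omega>M \<in> sets T1.Q" and \<Omega>2: "T2.\<Omega>M \<in> sets T2.Q"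
    using sets.top[of T1.Q] sets.top[of T2.Q] by simp_all
  have \<Omega>X': "(T1.\<Omega>M - X) \<inter> space T1.Q \<in> sets T1.Q"
    using X \<Omega>1 by (auto intro: sets.Diff sets.Int)
  have \<Omega>Y': "(T2.\<Omega>M - Y) \<inter> space T2.Q \<in> sets T2.Q"
    using Y \<Omega>2 by (auto intro: sets.Diff sets.Int)
  have \<phi>in: "\<phi> x \<in> T2.\<Omega>M" if "x \<in> T1.\<Omega>M" for x
    using that im y0 by (auto simp: \<phi>_def)
  have \<Omega>X: "T1.\<Omega>M - X \<in> sets T1.Q" and \<Omega>Y: "T2.\<Omega>M - Y \<in> sets T2.Q"
    using X Y \<Omega>1 \<Omega>2 by (auto intro: sets.Diff)
  have pre: "\<psi> -` (D - Y) \<inter> (T1.\<Omega>M - X) \<in> sets T1.Q"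
    and pre_m: "emeasure T1.Q (\<psi> -` (D - Y) \<inter> (T1.\<Omega>M - X)) = emeasure T2.Q D" if D: "D \<in> sets T2.Q" for D
  proof -
    have DY: "D - Y \<in> sets T2.Q" "D - Y \<subseteq> T2.\<Omega>M - Y"
      using D Y sets.sets_into_space[OF D] by (auto intro: sets.Diff)
    have r: "D - Y \<in> sets (restrict_space T2.Q (T2.\<Omega>M - Y))"
      using DY unfolding sets_restrict_space_iff[OF \<Omega>Y'] by simp
    have sp: "space (restrict_space T1.Q (T1.\<Omega>M - X)) = T1.\<Omega>M - X"
      by (auto simp: space_restrict_space)
    have r1: "\<psi> -` (D - Y) \<inter> (T1.\<Omega>M - X) \<in> sets (restrict_space T1.Q (T1.\<Omega>M - X))"
      using measurable_sets[OF m r] by (simp only: sp)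
    then show "\<psi> -` (D - Y) \<inter> (T1.\<Omega>M - X) \<in> sets T1.Q"
      unfolding sets_restrict_space_iff[OF \<Omega>X'] by simp
    have "emeasure T1.Q (\<psi> -` (D - Y) \<inter> (T1.\<Omega>M - X)) =
        emeasure (restrict_space T1.Q (T1.\<Omega>M - X)) (\<psi> -` (D - Y) \<inter> (T1.\<Omega>M - X))"
      by (rule emeasure_restrict_space[OF \<Omega>X', symmetric]) simp
    also have "\<dots> = emeasure (restrict_space T2.Q (T2.\<Omega>M - Y)) (D - Y)"
      using emeasure_distr[OF m r] by (simp only: d sp)
    also have "\<dots> = emeasure T2.Q (D - Y)"
      by (rule emeasure_restrict_space[OF \<Omega>Y' DY(2)])
    also have "\<dots> = emeasure T2.Q D"
      by (rule emeasure_Diff_null_set[OF Y D])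
    finally show "emeasure T1.Q (\<psi> -` (D - Y) \<inter> (T1.\<Omega>M - X)) = emeasure T2.Q D" .
  qed
  have split: "\<phi> -` D \<inter> T1.\<Omega>M = (\<psi> -` (D - Y) \<inter> (T1.\<Omega>M - X)) \<union> (X \<inter> (\<phi> -` D \<inter> T1.\<Omega>M))" for D
  proof -
    have "\<psi> x \<notin> Y" if "x \<in> T1.\<Omega>M - X" for x
      using im that by blast
    then have "x \<in> \<phi> -` D \<inter> T1.\<Omega>M \<longleftrightarrow> x \<in> (\<psi> -` (D - Y) \<inter> (T1.\<Omega>M - X)) \<union> (X \<inter> (\<phi> -` D \<inter> T1.\<Omega>M))" for x
      by (simp add: \<phi>_def) blast
    then show ?thesis
      by (rule set_eqI)
  qed
  have null: "X \<inter> (\<phi> -` D \<inter> T1.\<Omega>M) \<in> null_sets T1.Q" for D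
    by (rule T1.Q.complete2[OF _ X]) auto
  have \<phi>m: "\<phi> \<in> T1.Q \<rightarrow>\<^sub>M T2.Q"
  proof (rule measurableI)
    fix D assume "D \<in> sets T2.Q"
    then have "\<phi> -` D \<inter> T1.\<Omega>M \<in> sets T1.Q"
      using pre null[of D] by (subst split) auto
    then show "\<phi> -` D \<inter> space T1.Q \<in> sets T1.Q"
      by simp
  qed (simp add: \<phi>in)
  have "noise_hom P W M1 \<Omega>1 S1 M2 \<Omega>2 S2 \<phi>"
  proof
    show "\<phi> \<in> T1.Q \<rightarrow>\<^sub>M T2.Q"
      by (rule \<phi>m)
    show "distr T1.Q T2.Q \<phi> = T2.Q"
    proof (rule measure_eqI)
      fix D assume "D \<in> sets (distr T1.Q T2.Q \<phi>)"
      then have D: "D \<in> sets T2.Q"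
        by simp
      have "emeasure (distr T1.Q T2.Q \<phi>) D = emeasure T1.Q (\<phi> -` D \<inter> T1.\<Omega>M)"
        using emeasure_distr[OF \<phi>m D] by simp
      also have "\<dots> = emeasure T1.Q (\<psi> -` (D - Y) \<inter> (T1.\<Omega>M - X))"
        by (subst split) (rule emeasure_Un_null_set[OF pre[OF D] null])
      finally show "emeasure (distr T1.Q T2.Q \<phi>) D = emeasure T2.Q D"
        using pre_m[OF D] by simp
    qed simp
    fix s t D assume st: "s < t" and D: "D \<in> T2.N s t"
    then have "D - Y \<in> {\<psi> ` (A - X) | A. A \<in> T1.N s t}"
      unfolding fields[OF st] by blast
    then obtain A where A: "A \<in> T1.N s t" "D - Y = \<psi> ` (A - X)"
      by blast
    have "A \<subseteq> T1.\<Omega>M"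
      using sets.sets_into_space[OF subsetD[OF T1.N_Q[OF st] A(1)]] by simp
    then have AX: "A - X \<subseteq> T1.\<Omega>M - X"
      by blast
    have eq: "\<psi> -` (D - Y) \<inter> (T1.\<Omega>M - X) = A - X"
      unfolding A(2) using AX inj_on_image_mem_iff[OF inj _ AX] by blast
    show "\<phi> -` D \<inter> T1.\<Omega>M \<in> T1.N s t"
    proof (rule T1.N_AE[OF A(1)])
      show "AE x in T1.Q. x \<in> A \<longleftrightarrow> x \<in> \<phi> -` D \<inter> T1.\<Omega>M"
        using AE_not_in[OF X]
      proof eventually_elim
        case (elim x)
        then have "x \<in> A \<longleftrightarrow> x \<in> \<psi> -` (D - Y) \<inter> (T1.\<Omega>M - X)"
          unfolding eq by simp
        then show ?case
          using elim by (subst split) simp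
      qed
    qed simp
  qed
  then show ?thesis
    by (rule that) (simp add: \<phi>_def)
qed

text \<open>The pair (c * \<omega>, \<eta>) is a sample of the second triplet only for paths in
  \<open>G\<close>, which has full measure; elsewhere a fixed sample is used. The law is preserved
  because the points listed by \<open>S2\<close> along c * \<omega> form another injective list of
  the points of \<open>M1 \<omega>\<close>. Local fields correspond since scaling keeps the path
  fields and \<open>N_sign\<close> covers the transported enumeration.\<close>

lemma scale_image:
  assumes c: "c = 1 \<or> c = (-1 :: real)"
    and eq: "AE \<omega> in W. M1 \<omega> = M2 (\<lambda>t. c * \<omega> t)"
    and G: "G = {\<omega> \<in> \<Omega>1. (\<lambda>t. c * \<omega> t) \<in> \<Omega>2 \<and> M1 \<omega> = M2 (\<lambda>t. c * \<omega> t)}"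
  obtains \<phi> where "noise_hom P W M1 \<Omega>1 S1 M2 \<Omega>2 S2 \<phi>"
    "\<And>x. x \<in> T1.\<Omega>M \<Longrightarrow> fst x \<in> G \<Longrightarrow> \<phi> x = ((\<lambda>t. c * fst x t), snd x)"
    "{x \<in> T1.\<Omega>M. fst x \<notin> G} \<in> null_sets T1.Q"
proof -
  define k where "k \<omega> = (\<lambda>t. c * \<omega> t)" for \<omega> :: "real \<Rightarrow> real"
  have kW: "k \<in> W \<rightarrow>\<^sub>M W" "distr W W k = W"
    using T1.scale_W[OF c] by (simp_all add: k_def[abs_def])
  have kF: "k \<in> \<F> W s t \<rightarrow>\<^sub>M \<F> W s t" for s t
    using T1.scale_\<F>[OF c] by (simp add: k_def[abs_def])
  have G: "G = {\<omega> \<in> \<Omega>1. k \<omega> \<in> \<Omega>2 \<and> M1 \<omega> = M2 (k \<omega>)}"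
    by (simp only: G k_def)
  have Gae: "AE \<omega> in W. \<omega> \<in> G"
    using eq T1.AE_\<Omega>\<^sub>1 T1.AE_W_vimage[OF kW T2.AE_\<Omega>\<^sub>1]
    by eventually_elim (simp add: G k_def)
  have Gx: "AE x in T1.Q. fst x \<in> G"
    by (rule T1.AE_Q_fst[OF Gae])
  have "{\<omega> \<in> \<Omega>\<^sub>0. \<omega> \<in> G} \<in> sets W"
    by (rule T1.sets_W_if_AE[OF Gae])
  moreover have "{\<omega> \<in> \<Omega>\<^sub>0. \<omega> \<in> G} = G"
    using T1.\<Omega>\<^sub>1_subset by (auto simp: G)
  ultimately have GW: "G \<in> sets W"
    by simp
  obtain y0 where y0: "y0 \<in> T2.\<Omega>M"
    using T2.Q.not_empty by auto
  define \<phi> where "\<phi> x = (if fst x \<in> G then (k (fst x), snd x) else y0)" for x :: sample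
  have \<phi>in: "\<phi> x \<in> T2.\<Omega>M" if "x \<in> T1.\<Omega>M" for x
    using that y0 by (auto simp: \<phi>_def G T1.\<Omega>M_iff T2.\<Omega>M_iff)
  \<comment> \<open>\<open>law_rectangle\<close> asks for an injective list on all of
    \<open>\<Omega>1\<close>, so \<open>S1\<close> is used off \<open>G\<close>.\<close>
  define S' where "S' j \<omega> = (if \<omega> \<in> G then S2 j (k \<omega>) else S1 j \<omega>)" for j \<omega>
  have S'm: "S' j \<in> W \<rightarrow>\<^sub>M borel_dagger" for j
    unfolding S'_def
  proof (rule measurable_If)
    show "(\<lambda>\<omega>. S2 j (k \<omega>)) \<in> W \<rightarrow>\<^sub>M borel_dagger"
      by (rule measurable_compose[OF kW(1) T2.S_meas])
    show "{\<omega> \<in> space W. \<omega> \<in> G} \<in> sets W"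
      using GW sets.sets_into_space[OF GW] by (simp add: Collect_conj_eq Int_absorb1)
  qed (rule T1.S_meas)
  have S'inj: "inj (\<lambda>j. S' j \<omega>)" and S'M: "S' j \<omega> \<in> Some ` M1 \<omega>" if "\<omega> \<in> \<Omega>1" for \<omega> j
  proof -
    have both: "inj (\<lambda>j. S' j \<omega>) \<and> S' j \<omega> \<in> Some ` M1 \<omega>"
    proof (cases "\<omega> \<in> G")
      case True
      then have "k \<omega> \<in> \<Omega>2" and M: "M1 \<omega> = M2 (k \<omega>)"
        by (auto simp: G)
      then have "inj (\<lambda>j. S2 j (k \<omega>)) \<and> S2 j (k \<omega>) \<in> Some ` M2 (k \<omega>)"
        by (intro conjI T2.S_inj T2.S_M)
      then show ?thesis
        unfolding M S'_def if_P[OF True] .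
    next
      case False
      have "inj (\<lambda>j. S1 j \<omega>) \<and> S1 j \<omega> \<in> Some ` M1 \<omega>"
        using that by (intro conjI T1.S_inj T1.S_M)
      then show ?thesis
        unfolding S'_def if_not_P[OF False] .
    qed
    show "inj (\<lambda>j. S' j \<omega>)" "S' j \<omega> \<in> Some ` M1 \<omega>"
      by (rule conjunct1[OF both] conjunct2[OF both])+
  qed
  have rect_eq: "AE x in T1.Q. x \<in> {x \<in> T1.\<Omega>M. fst x \<in> k -` A \<inter> space W \<and> snd (\<Theta> S' x) \<in> C} \<longleftrightarrow>
      x \<in> {x \<in> space T1.Q. fst (\<phi> x) \<in> A \<and> snd (\<Theta> S2 (\<phi> x)) \<in> C}" for A C
    using Gx
  proof eventually_elim
    case (elim x)
    have "snd (\<Theta> S' x) = snd (\<Theta> S2 (\<phi> x))"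
      by (rule ext) (use elim in \<open>simp add: T1.snd_\<Theta> S'_def \<phi>_def\<close>)
    then show ?case
      using elim T1.fst_\<Omega>M(2)[of x] by (auto simp: \<phi>_def)
  qed
  have pre: "k -` A \<inter> space W \<in> sets W" "measure W (k -` A \<inter> space W) = measure W A" if "A \<in> sets W" for A
    using measurable_sets[OF kW(1) that] measure_distr[OF kW(1) that] by (simp_all add: kW(2))
  have rect0: "{x \<in> T1.\<Omega>M. fst x \<in> k -` A \<inter> space W \<and> snd (\<Theta> S' x) \<in> C} \<in> sets T1.Q"
    "measure T1.Q {x \<in> T1.\<Omega>M. fst x \<in> k -` A \<inter> space W \<and> snd (\<Theta> S' x) \<in> C} = measure W A * measure coins C"
    if "A \<in> sets W" "C \<in> sets coins" for A C
    unfolding pre(2)[OF that(1), symmetric]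
    by (rule T1.law_rectangle(1)[OF S'm S'inj S'M pre(1)[OF that(1)] that(2)], assumption+,
        rule T1.law_rectangle(2)[OF S'm S'inj S'M pre(1)[OF that(1)] that(2)], assumption+)
  have rect1: "{x \<in> space T1.Q. fst (\<phi> x) \<in> A \<and> snd (\<Theta> S2 (\<phi> x)) \<in> C} \<in> sets T1.Q"
    if "A \<in> sets W" "C \<in> sets coins" for A C
    by (rule T1.Q.in_sets_AE[OF rect_eq rect0(1)[OF that]]) auto
  have rect2: "measure T1.Q {x \<in> space T1.Q. fst (\<phi> x) \<in> A \<and> snd (\<Theta> S2 (\<phi> x)) \<in> C} = measure W A * measure coins C"
    if "A \<in> sets W" "C \<in> sets coins" for A C
    using T1.Q.finite_measure_eq_AE[OF rect_eq rect0(1)[OF that] rect1[OF that]] rect0(2)[OF that] by simp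
  note mp = T2.measure_preserving_rectangles[OF T1.Q.complete_measure_axioms T1.Q.prob_space_axioms]
  have \<phi>m: "\<phi> \<in> T1.Q \<rightarrow>\<^sub>M T2.Q"
    by (rule mp(1)) (rule rect1 rect2, assumption+ | simp add: \<phi>in)+
  have \<phi>d: "distr T1.Q T2.Q \<phi> = T2.Q"
    by (rule mp(2)) (rule rect1 rect2, assumption+ | simp add: \<phi>in)+
  have local: "\<phi> -` D \<inter> T1.\<Omega>M \<in> T1.N s t" if st: "s < t" and D: "D \<in> T2.N s t" for s t D
  proof -
    interpret N: sigma_algebra T1.\<Omega>M "T1.N s t"
      by (rule T1.N_sigma_algebra)
    from D show ?thesis
      unfolding T2.N_eq
    proof (induction rule: sigma_sets.induct)
      case (Basic a)
      then consider u v A where "a = {x \<in> T2.\<Omega>M. fst x v - fst x u \<in> A}" "A \<in> sets borel" "s < ereal u" "u \<le> v" "ereal v < t"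
        | j C where "a = {x \<in> T2.\<Omega>M. snd x (the (T2.R s t j (fst x))) \<in> C}" | "a \<in> null_sets T2.Q"
        unfolding T2.N_generator_def by blast
      then show ?case
      proof cases
        case 1
        have "(\<lambda>x. c * (fst x v - fst x u)) \<in> borel_measurable (T1.NS s t)"
          by (intro borel_measurable_times T1.N_open_increment 1) simp
        from measurable_sets[OF this 1(2)]
        have "{x \<in> T1.\<Omega>M. c * (fst x v - fst x u) \<in> A} \<in> T1.N s t"
          by (simp add: T1.sets_NS vimage_def Int_def conj_commute)
        then show ?thesis
        proof (rule T1.N_AE)
          show "AE x in T1.Q. x \<in> {x \<in> T1.\<Omega>M. c * (fst x v - fst x u) \<in> A} \<longleftrightarrow> x \<in> \<phi> -` a \<inter> T1.\<Omega>M"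
            using Gx
          proof eventually_elim
            case (elim x)
            then show ?case
              using \<phi>in[of x] by (auto simp: 1 \<phi>_def k_def right_diff_distrib)
          qed
        qed simp
      next
        case 2
        have Rm: "(\<lambda>\<omega>. T2.R s t j (k \<omega>)) \<in> \<F> W s t \<rightarrow>\<^sub>M borel_dagger"
          by (rule measurable_compose[OF kF T2.R_local(1)[OF st]])
        have "AE \<omega> in W. T2.R s t j (k \<omega>) \<in> Some ` (M1 \<omega> \<inter> ereal_interval s t)"
          using Gae
        proof eventually_elim
          case (elim \<omega>)
          then show ?case
            using T2.R_local(4)[OF st, of "k \<omega>" j] by (simp add: G)
        qed
        from T1.N_sign[OF st Rm this]
        show ?thesis
        proof (rule T1.N_AE)
          show "AE x in T1.Q. x \<in> {x \<in> T1.\<Omega>M. snd x (the (T2.R s t j (k (fst x)))) \<in> C} \<longleftrightarrow> x \<in> \<phi> -` a \<inter> T1.\<Omega>M"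
            using Gx
          proof eventually_elim
            case (elim x)
            then show ?case
              using \<phi>in[of x] by (auto simp: 2 \<phi>_def)
          qed
        qed simp
      next
        case 3
        then have "\<phi> -` a \<inter> space T1.Q \<in> null_sets T1.Q"
          using emeasure_distr[OF \<phi>m, of a] measurable_sets[OF \<phi>m, of a] by (simp add: \<phi>d null_sets_def)
        then show ?thesis
          by (intro T1.null_in_N) simp
      qed
    next
      case (Compl a)
      have "\<phi> -` (T2.\<Omega>M - a) \<inter> T1.\<Omega>M = T1.\<Omega>M - (\<phi> -` a \<inter> T1.\<Omega>M)"
        using \<phi>in by auto
      then show ?case
        using N.compl_sets[OF Compl.IH] by (simp only:)
    next
      case (Union a)
      have "(\<Union>i. \<phi> -` a i \<inter> T1.\<Omega>M) \<in> T1.N s t"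
        using Union.IH by (intro N.countable_UN) auto
      moreover have "(\<Union>i. \<phi> -` a i \<inter> T1.\<Omega>M) = \<phi> -` \<Union> (range a) \<inter> T1.\<Omega>M"
        by auto
      ultimately show ?case
        by (simp only:)
    qed simp
  qed
  have hom: "noise_hom P W M1 \<Omega>1 S1 M2 \<Omega>2 S2 \<phi>"
    by unfold_locales (rule \<phi>m \<phi>d local; assumption)+
  have "{x \<in> space T1.Q. \<not> fst x \<in> G} \<in> null_sets T1.Q"
    by (rule iffD1[OF T1.Q.AE_iff_null_sets Gx])
  then have "{x \<in> T1.\<Omega>M. fst x \<notin> G} \<in> null_sets T1.Q"
    by simp
  then show ?thesis
    by (rule that[OF hom, rotated]) (simp add: \<phi>_def k_def)
qed

text \<open>Here \<psi> is \<phi> off a null set, and its image is the complement of another. The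
  conditions in one direction of an isomorphism then follow from those on \<phi>, a local event on
  the right being the image of its preimage. Applied in both directions it yields the whole
  isomorphism.\<close>

lemma mod0_measurable:
  assumes h: "noise_hom P W M1 \<Omega>1 S1 M2 \<Omega>2 S2 \<phi>"
    and X: "X \<in> null_sets T1.Q" and Y: "Y \<in> null_sets T2.Q"
    and im: "\<psi> ` (T1.\<Omega>M - X) = T2.\<Omega>M - Y" and eq: "\<And>x. x \<in> T1.\<Omega>M - X \<Longrightarrow> \<phi> x = \<psi> x"
  shows "\<psi> \<in> restrict_space T1.Q (T1.\<Omega>M - X) \<rightarrow>\<^sub>M restrict_space T2.Q (T2.\<Omega>M - Y)"
    and "distr (restrict_space T1.Q (T1.\<Omega>M - X)) (restrict_space T2.Q (T2.\<Omega>M - Y)) \<psi> = restrict_space T2.Q (T2.\<Omega>M - Y)"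
    and "\<And>s t B. s < t \<Longrightarrow> B \<in> T2.N s t \<Longrightarrow> \<exists>A\<in>T1.N s t. B - Y = \<psi> ` (A - X)"
proof -
  interpret h: noise_hom P W M1 \<Omega>1 S1 M2 \<Omega>2 S2 \<phi>
    by (rule h)
  let ?R1 = "restrict_space T1.Q (T1.\<Omega>M - X)" and ?R2 = "restrict_space T2.Q (T2.\<Omega>M - Y)"
  have s1: "space ?R1 = T1.\<Omega>M - X" and s2: "space ?R2 = T2.\<Omega>M - Y"
    by (auto simp: space_restrict_space)
  have \<Omega>X: "T1.\<Omega>M - X \<in> sets T1.Q" and \<Omega>Y: "T2.\<Omega>M - Y \<in> sets T2.Q"
    using X Y sets.top[of T1.Q] sets.top[of T2.Q] by (auto intro: sets.Diff)
  have \<Omega>X': "(T1.\<Omega>M - X) \<inter> space T1.Q \<in> sets T1.Q"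
    using X sets.top[of T1.Q] by (auto intro: sets.Diff sets.Int)
  have \<Omega>Y': "(T2.\<Omega>M - Y) \<inter> space T2.Q \<in> sets T2.Q"
    using Y sets.top[of T2.Q] by (auto intro: sets.Diff sets.Int)
  have "\<phi> \<in> ?R1 \<rightarrow>\<^sub>M ?R2"
    using im eq s1 by (intro measurable_restrict_space2 measurable_restrict_space1 h.\<phi>_measurable) force
  then show m: "\<psi> \<in> ?R1 \<rightarrow>\<^sub>M ?R2"
    by (rule measurable_cong[THEN iffD1, rotated]) (use eq s1 in auto)
  show "distr ?R1 ?R2 \<psi> = ?R2"
  proof (rule measure_eqI)
    fix D assume "D \<in> sets (distr ?R1 ?R2 \<psi>)"
    then have D: "D \<in> sets ?R2"
      by simp
    then have D2: "D \<in> sets T2.Q" "D \<subseteq> T2.\<Omega>M - Y"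
      unfolding sets_restrict_space_iff[OF \<Omega>Y'] by simp_all
    have "emeasure (distr ?R1 ?R2 \<psi>) D = emeasure ?R1 (\<psi> -` D \<inter> (T1.\<Omega>M - X))"
      using emeasure_distr[OF m D] by (simp only: s1)
    also have "\<dots> = emeasure T1.Q (\<psi> -` D \<inter> (T1.\<Omega>M - X))"
      by (rule emeasure_restrict_space[OF \<Omega>X']) auto
    also have "\<psi> -` D \<inter> (T1.\<Omega>M - X) = (\<phi> -` D \<inter> T1.\<Omega>M) - X"
      using eq by auto
    also have "emeasure T1.Q \<dots> = emeasure T1.Q (\<phi> -` D \<inter> T1.\<Omega>M)"
      using measurable_sets[OF h.\<phi>_measurable D2(1)] by (intro emeasure_Diff_null_set[OF X]) simp
    also have "\<dots> = emeasure T2.Q D"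
      using emeasure_distr[OF h.\<phi>_measurable D2(1)] by (simp add: h.distr_\<phi>)
    also have "\<dots> = emeasure ?R2 D"
      by (rule emeasure_restrict_space[OF \<Omega>Y' D2(2), symmetric])
    finally show "emeasure (distr ?R1 ?R2 \<psi>) D = emeasure ?R2 D" .
  qed simp
  fix s t B assume st: "s < t" and B: "B \<in> T2.N s t"
  have "B \<subseteq> T2.\<Omega>M"
    using sets.sets_into_space[OF subsetD[OF T2.N_Q[OF st] B]] by simp
  then have "B - Y = \<psi> ` ((\<phi> -` B \<inter> T1.\<Omega>M) - X)"
    using im eq by force
  then show "\<exists>A\<in>T1.N s t. B - Y = \<psi> ` (A - X)"
    using h.\<phi>_local[OF st B] by blast
qed

end

definition scale_sample :: "real \<Rightarrow> sample \<Rightarrow> sample" where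
  "scale_sample c x = ((\<lambda>t. c * fst x t), snd x)"

lemma scale_sample_involution: "c = 1 \<or> c = -1 \<Longrightarrow> scale_sample c (scale_sample c x) = x"
  by (auto simp: scale_sample_def)

lemma scale_sample_shift_M: "scale_sample c (shift_M h x) = shift_M h (scale_sample c x)"
  by (simp add: scale_sample_def shift_M_def \<Delta>_def split_beta right_diff_distrib)

text \<open>The condition on good paths is symmetric in the two triplets because c squared is 1. So
  scaling exchanges the two good parts, and is a bijection between them as it is its own
  inverse.\<close>

lemma scale_sample_matched:
  assumes c: "c = 1 \<or> c = (-1 :: real)"
    and x: "x \<in> \<Omega>_M M \<Omega>" "fst x \<in> {\<omega> \<in> \<Omega>. (\<lambda>t. c * \<omega> t) \<in> \<Omega>' \<and> M \<omega> = M' (\<lambda>t. c * \<omega> t)}"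
  shows "scale_sample c x \<in> \<Omega>_M M' \<Omega>'"
    and "fst (scale_sample c x) \<in> {\<omega> \<in> \<Omega>'. (\<lambda>t. c * \<omega> t) \<in> \<Omega> \<and> M' \<omega> = M (\<lambda>t. c * \<omega> t)}"
proof -
  obtain \<omega> \<eta> where x': "x = (\<omega>, \<eta>)"
    by (cases x)
  define \<omega>' where "\<omega>' = (\<lambda>t. c * \<omega> t)"
  have inv: "(\<lambda>t. c * \<omega>' t) = \<omega>"
    using c by (auto simp: \<omega>'_def)
  have h: "\<omega> \<in> \<Omega>" "\<eta> \<in> M \<omega> \<rightarrow>\<^sub>E {-1, 1}" "\<omega>' \<in> \<Omega>'" "M \<omega> = M' \<omega>'"
    using x by (auto simp: x' \<omega>'_def \<Omega>_M_def)
  have s: "scale_sample c x = (\<omega>', \<eta>)"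
    by (simp add: scale_sample_def x' \<omega>'_def)
  show "scale_sample c x \<in> \<Omega>_M M' \<Omega>'"
    using h unfolding s by (simp add: \<Omega>_M_def)
  show "fst (scale_sample c x) \<in> {\<omega> \<in> \<Omega>'. (\<lambda>t. c * \<omega> t) \<in> \<Omega> \<and> M' \<omega> = M (\<lambda>t. c * \<omega> t)}"
    using h unfolding s by (simp add: inv)
qed

context triplet_pair begin

lemma swap: "triplet_pair P W M2 \<Omega>2 S2 M1 \<Omega>1 S1"
  by (rule triplet_pair.intro[OF T2.triplet_axioms T1.triplet_axioms])

text \<open>Substitute c * \<omega> for \<omega>, which preserves \<open>W\<close>; scaling twice
  gives back the path.\<close>

lemma AE_scale_swap:
  assumes c: "c = 1 \<or> c = (-1 :: real)" and ae: "AE \<omega> in W. R (\<lambda>t. c * \<omega> t) \<omega>"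
  shows "AE \<omega> in W. R \<omega> (\<lambda>t. c * \<omega> t)"
proof -
  have "AE \<omega> in W. R (\<lambda>t. c * (c * \<omega> t)) (\<lambda>t. c * \<omega> t)"
    by (rule T1.AE_W_vimage[OF T1.scale_W[OF c] ae])
  then show ?thesis
  proof eventually_elim
    case (elim \<omega>)
    have "(\<lambda>t. c * (c * \<omega> t)) = \<omega>"
      using c by auto
    from this elim show ?case
      by (rule subst[where P="\<lambda>v. R v (\<lambda>t. c * \<omega> t)"])
  qed
qed

lemma isomorphic_if_scaled:
  assumes c: "c = 1 \<or> c = (-1 :: real)" and eq: "AE \<omega> in W. M1 \<omega> = M2 (\<lambda>t. c * \<omega> t)"
  shows "isomorphic_noises (noise_of W M1 \<Omega>1 S1) (noise_of W M2 \<Omega>2 S2)"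
proof -
  interpret swap: triplet_pair P W M2 \<Omega>2 S2 M1 \<Omega>1 S1
    by (rule swap)
  have "AE \<omega> in W. M2 (\<lambda>t. c * \<omega> t) = M1 \<omega>"
    using eq by eventually_elim (rule sym)
  then have eq': "AE \<omega> in W. M2 \<omega> = M1 (\<lambda>t. c * \<omega> t)"
    by (rule AE_scale_swap[where R="\<lambda>v w. M2 v = M1 w", OF c])
  define G1 where "G1 = {\<omega> \<in> \<Omega>1. (\<lambda>t. c * \<omega> t) \<in> \<Omega>2 \<and> M1 \<omega> = M2 (\<lambda>t. c * \<omega> t)}"
  define G2 where "G2 = {\<omega> \<in> \<Omega>2. (\<lambda>t. c * \<omega> t) \<in> \<Omega>1 \<and> M2 \<omega> = M1 (\<lambda>t. c * \<omega> t)}"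
  define X where "X = {x \<in> T1.\<Omega>M. fst x \<notin> G1}"
  define Y where "Y = {x \<in> T2.\<Omega>M. fst x \<notin> G2}"
  let ?\<psi> = "scale_sample c"
  obtain \<phi> where \<phi>: "noise_hom P W M1 \<Omega>1 S1 M2 \<Omega>2 S2 \<phi>"
    and \<phi>_eq: "\<And>x. x \<in> T1.\<Omega>M \<Longrightarrow> fst x \<in> G1 \<Longrightarrow> \<phi> x = ?\<psi> x" and X: "X \<in> null_sets T1.Q"
    by (rule scale_image[OF c eq G1_def]) (rule that, unfold X_def scale_sample_def)
  obtain \<phi>' where \<phi>': "noise_hom P W M2 \<Omega>2 S2 M1 \<Omega>1 S1 \<phi>'"
    and \<phi>'_eq: "\<And>x. x \<in> T2.\<Omega>M \<Longrightarrow> fst x \<in> G2 \<Longrightarrow> \<phi>' x = ?\<psi> x" and Y: "Y \<in> null_sets T2.Q"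
    by (rule swap.scale_image[OF c eq' G2_def]) (rule that, unfold Y_def scale_sample_def)
  have inv: "?\<psi> (?\<psi> x) = x" for x
    by (rule scale_sample_involution[OF c])
  have to2: "?\<psi> x \<in> T2.\<Omega>M - Y" if "x \<in> T1.\<Omega>M - X" for x
    using that scale_sample_matched[OF c, of x M1 \<Omega>1 \<Omega>2 M2] unfolding X_def Y_def G1_def G2_def by blast
  have to1: "?\<psi> x \<in> T1.\<Omega>M - X" if "x \<in> T2.\<Omega>M - Y" for x
    using that scale_sample_matched[OF c, of x M2 \<Omega>2 \<Omega>1 M1] unfolding X_def Y_def G1_def G2_def by blast
  have bij: "bij_betw ?\<psi> (T1.\<Omega>M - X) (T2.\<Omega>M - Y)"
    by (rule bij_betw_byWitness[where f'="?\<psi>"]) (use inv to1 to2 in auto)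
  have im: "?\<psi> ` (T1.\<Omega>M - X) = T2.\<Omega>M - Y"
    using bij by (simp add: bij_betw_def)
  then have im': "?\<psi> ` (T2.\<Omega>M - Y) = T1.\<Omega>M - X"
    by (simp add: im[symmetric] image_image inv)
  have "\<phi> x = ?\<psi> x" if "x \<in> T1.\<Omega>M - X" for x
    using that by (intro \<phi>_eq) (auto simp: X_def)
  note m = mod0_measurable[OF \<phi> X Y im this]
  have "\<phi>' x = ?\<psi> x" if "x \<in> T2.\<Omega>M - Y" for x
    using that by (intro \<phi>'_eq) (auto simp: Y_def)
  note m' = swap.mod0_measurable[OF \<phi>' Y X im' this]
  have "the_inv_into (T1.\<Omega>M - X) ?\<psi> y = ?\<psi> y" if "y \<in> T2.\<Omega>M - Y" for y
    by (rule the_inv_into_f_eq) (use bij inv to1[OF that] in \<open>simp_all add: bij_betw_def\<close>)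
  then have "the_inv_into (T1.\<Omega>M - X) ?\<psi> \<in> restrict_space T2.Q (T2.\<Omega>M - Y) \<rightarrow>\<^sub>M restrict_space T1.Q (T1.\<Omega>M - X)"
    by (intro measurable_cong[THEN iffD2, OF _ m'(1)]) (simp add: space_restrict_space)
  then have mod0: "mod0_isomorphism T1.Q T2.Q X Y ?\<psi>"
    using X Y bij m(1,2) by (simp add: mod0_isomorphism_def)
  have fields: "{?\<psi> ` (A - X) | A. A \<in> T1.N s t} = {B - Y | B. B \<in> T2.N s t}" (is "?L = ?R") if st: "s < t" for s t
  proof
    show "?R \<subseteq> ?L"
      using m(3)[OF _ st] by blast
    show "?L \<subseteq> ?R"
    proof
      fix D assume "D \<in> ?L"
      then obtain A where "A \<in> T1.N s t" "D = ?\<psi> ` (A - X)"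
        by blast
      moreover from m'(3)[OF _ st this(1)] obtain B where "B \<in> T2.N s t" "A - X = ?\<psi> ` (B - Y)"
        by blast
      ultimately have "B \<in> T2.N s t" "D = B - Y"
        by (simp_all add: image_image inv)
      then show "D \<in> ?R"
        by blast
    qed
  qed
  have "noise_isomorphism (noise_of W M1 \<Omega>1 S1) (noise_of W M2 \<Omega>2 S2) X Y ?\<psi>"
    unfolding noise_isomorphism_def noise_of_def noise_system.simps
    by (intro conjI allI impI mod0 fields AE_I2 scale_sample_shift_M)
  then show ?thesis
    unfolding isomorphic_noises_def by blast
qed

lemma scaled_if_isomorphic:
  assumes "isomorphic_noises (noise_of W M1 \<Omega>1 S1) (noise_of W M2 \<Omega>2 S2)"
  shows "\<exists>c. (c = 1 \<or> c = (-1 :: real)) \<and> (AE \<omega> in W. M1 \<omega> = M2 (\<lambda>t. c * \<omega> t))"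
proof -
  interpret swap: triplet_pair P W M2 \<Omega>2 S2 M1 \<Omega>1 S1
    by (rule swap)
  obtain X Y \<psi> where "noise_isomorphism (noise_of W M1 \<Omega>1 S1) (noise_of W M2 \<Omega>2 S2) X Y \<psi>"
    using assms unfolding isomorphic_noises_def by blast
  then have iso: "mod0_isomorphism T1.Q T2.Q X Y \<psi>"
    and fields: "\<And>s t. s < t \<Longrightarrow> {\<psi> ` (A - X) | A. A \<in> T1.N s t} = {B - Y | B. B \<in> T2.N s t}"
    and shift: "\<And>h. AE x in T1.Q. \<psi> (shift_M h x) = shift_M h (\<psi> x)"
    unfolding noise_isomorphism_def noise_of_def noise_system.simps by blast+
  define \<psi>' where "\<psi>' = the_inv_into (T1.\<Omega>M - X) \<psi>"
  have iso': "mod0_isomorphism T2.Q T1.Q Y X \<psi>'"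
    using mod0_isomorphism_sym[OF iso] by (simp add: \<psi>'_def)
  have X: "X \<in> null_sets T1.Q" and Y: "Y \<in> null_sets T2.Q"
    and bij: "bij_betw \<psi> (T1.\<Omega>M - X) (T2.\<Omega>M - Y)" and bij': "bij_betw \<psi>' (T2.\<Omega>M - Y) (T1.\<Omega>M - X)"
    using iso iso' by (auto simp: mod0_isomorphism_def)
  have inj: "inj_on \<psi> (T1.\<Omega>M - X)" and im: "\<psi> ` (T1.\<Omega>M - X) = T2.\<Omega>M - Y"
    using bij by (auto simp: bij_betw_def)
  have inv: "\<psi>' ` \<psi> ` (A - X) = A - X" if "s < t" "A \<in> T1.N s t" for A s t
  proof -
    have "A \<subseteq> T1.\<Omega>M"
      using sets.sets_into_space[OF subsetD[OF T1.N_Q[OF that(1)] that(2)]] by simp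
    then have "\<psi>' (\<psi> x) = x" if "x \<in> A - X" for x
      unfolding \<psi>'_def using that by (intro the_inv_into_f_f[OF inj]) blast
    then show ?thesis
      by (simp add: image_image)
  qed
  have fields': "{\<psi>' ` (B - Y) | B. B \<in> T2.N s t} = {A - X | A. A \<in> T1.N s t}" (is "?L = ?R") if st: "s < t" for s t
  proof
    show "?L \<subseteq> ?R"
    proof
      fix D assume "D \<in> ?L"
      then obtain B where B: "B \<in> T2.N s t" "D = \<psi>' ` (B - Y)"
        by blast
      then have "B - Y \<in> {\<psi> ` (A - X) | A. A \<in> T1.N s t}"
        unfolding fields[OF st] by blast
      then obtain A where "A \<in> T1.N s t" "B - Y = \<psi> ` (A - X)"
        by blast
      then have "A \<in> T1.N s t" "D = A - X"
        using inv[OF st] by (simp_all add: B)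
      then show "D \<in> ?R"
        by blast
    qed
    show "?R \<subseteq> ?L"
    proof
      fix D assume "D \<in> ?R"
      then obtain A where A: "A \<in> T1.N s t" "D = A - X"
        by blast
      then have "\<psi> ` (A - X) \<in> {B - Y | B. B \<in> T2.N s t}"
        unfolding fields[OF st, symmetric] by blast
      then obtain B where "B \<in> T2.N s t" "\<psi> ` (A - X) = B - Y"
        by blast
      then have "B \<in> T2.N s t" "D = \<psi>' ` (B - Y)"
        using inv[OF st A(1)] by (simp_all add: A(2))
      then show "D \<in> ?L"
        by blast
    qed
  qed
  obtain \<phi> where \<phi>: "noise_hom P W M1 \<Omega>1 S1 M2 \<Omega>2 S2 \<phi>" "\<And>x. x \<in> T1.\<Omega>M - X \<Longrightarrow> \<phi> x = \<psi> x"
    by (rule noise_hom_of_mod0_isomorphism[OF iso fields]) (assumption | rule that)+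
  obtain \<phi>' where \<phi>': "noise_hom P W M2 \<Omega>2 S2 M1 \<Omega>1 S1 \<phi>'" "\<And>y. y \<in> T2.\<Omega>M - Y \<Longrightarrow> \<phi>' y = \<psi>' y"
    by (rule swap.noise_hom_of_mod0_isomorphism[OF iso' fields']) (assumption | rule that)+
  interpret h: noise_hom P W M1 \<Omega>1 S1 M2 \<Omega>2 S2 \<phi>
    by (rule \<phi>(1))
  interpret h': noise_hom P W M2 \<Omega>2 S2 M1 \<Omega>1 S1 \<phi>'
    by (rule \<phi>'(1))
  have X': "AE x in T1.Q. x \<in> T1.\<Omega>M - X"
    using AE_not_in[OF X] T1.AE_Q_\<Omega>M by eventually_elim simp
  have Y': "AE y in T2.Q. y \<in> T2.\<Omega>M - Y"
    using AE_not_in[OF Y] T2.AE_Q_\<Omega>M by eventually_elim simp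
  \<comment> \<open>\<phi> agrees with \<psi> only off \<open>X\<close>, so the shifted sample must
    avoid \<open>X\<close> as well; it does almost surely because the shift preserves the
    law.\<close>
  have shift': "AE x in T1.Q. \<phi> (shift_M h x) = shift_M h (\<phi> x)" for h
  proof -
    have "AE x in T1.Q. shift_M h x \<in> T1.\<Omega>M - X"
      by (rule AE_distrD[OF T1.shift_Q(1)]) (simp only: T1.shift_Q(2) X')
    then show ?thesis
      using X' shift[of h]
    proof eventually_elim
      case (elim x)
      then show ?case
        by (simp only: \<phi>(2))
    qed
  qed
  obtain c :: real where c: "c = 1 \<or> c = -1" and ae: "AE x in T1.Q. fst (\<phi> x) = (\<lambda>t. c * fst x t)"
    using h.ex_sign[OF shift'] by blast
  \<comment> \<open>The constant of the inverse is not obtained from \<open>ex_sign\<close> but from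
    inverting \<phi>. This ensures that it is the same c, so that the two inclusions concern the
    same pair of sets.\<close>
  have "AE y in T2.Q. fst (\<phi>' y) = (\<lambda>t. c * fst y t)"
    using h'.AE_\<phi>[OF ae] Y'
  proof eventually_elim
    case (elim y)
    have "\<psi>' y \<in> T1.\<Omega>M - X" "\<psi> (\<psi>' y) = y"
      using bij_betwE[OF bij'] f_the_inv_into_f[OF inj] elim(2) im by (auto simp: \<psi>'_def)
    then have "\<phi> (\<phi>' y) = y"
      using elim(2) by (simp only: \<phi>(2) \<phi>'(2))
    then have "fst y = (\<lambda>t. c * fst (\<phi>' y) t)"
      using elim(1) by simp
    then show ?case
      using c by auto
  qed
  then have "AE \<omega> in W. M1 (\<lambda>t. c * \<omega> t) \<subseteq> M2 \<omega>"
    by (rule h'.points_subset[OF c])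
  then have "AE \<omega> in W. M1 \<omega> \<subseteq> M2 (\<lambda>t. c * \<omega> t)"
    by (rule AE_scale_swap[where R="\<lambda>v w. M1 v \<subseteq> M2 w", OF c])
  then have "AE \<omega> in W. M1 \<omega> = M2 (\<lambda>t. c * \<omega> t)"
    using h.points_subset[OF c ae] by eventually_elim (rule equalityI)
  then show ?thesis
    using c by blast
qed

end

theorem theorem7p11:
  fixes W :: "(real \<Rightarrow> real) measure"
    and M1 M2 :: random_set
    and \<Omega>1 \<Omega>2 :: "(real \<Rightarrow> real) set"
    and S1 S2 :: enumeration
  assumes "completed_wiener W"
    and "admissible_triplet W M1 \<Omega>1 S1"
    and "admissible_triplet W M2 \<Omega>2 S2"
  shows "(\<not> empty_random_set W (\<lambda>\<omega>. sym_diff (M1 \<omega>) (M2 \<omega>)) \<and>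
          \<not> empty_random_set W (\<lambda>\<omega>. sym_diff (M1 \<omega>) (reflected M2 \<omega>)))
     \<longleftrightarrow> \<not> isomorphic_noises (noise_of W M1 \<Omega>1 S1) (noise_of W M2 \<Omega>2 S2)"
proof -
  obtain P where "two_sided_wiener P" "W = completion P"
    using assms(1) unfolding completed_wiener_def by blast
  then interpret triplet_pair P W M1 \<Omega>1 S1 M2 \<Omega>2 S2
    using assms by unfold_locales
  \<comment> \<open>The values 1 and -1 of c correspond to the two symmetric differences of
    condition (A).\<close>
  let ?E = "\<lambda>c :: real. AE \<omega> in W. M1 \<omega> = M2 (\<lambda>t. c * \<omega> t)"
  have empty: "empty_random_set W (\<lambda>\<omega>. sym_diff (M1 \<omega>) (M \<omega>)) \<longleftrightarrow> (AE \<omega> in W. M1 \<omega> = M \<omega>)" for M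
    unfolding empty_random_set_def by (rule arg_cong[where f="\<lambda>R. AE \<omega> in W. R \<omega>"]) (rule ext, blast)
  have "isomorphic_noises (noise_of W M1 \<Omega>1 S1) (noise_of W M2 \<Omega>2 S2) \<longleftrightarrow> ?E 1 \<or> ?E (-1)"
    using isomorphic_if_scaled[of 1] isomorphic_if_scaled[of "-1"] scaled_if_isomorphic by blast
  then show ?thesis
    unfolding empty reflected_def by simp
qed

end
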